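(* Let $n\ge 1$ with binary expansion $n=2^{k_1}+\dots+2^{k_s}$, $k_1>\dots>k_s\ge 0$, and let $F=(F_1,\dots,F_s)$ be a forest of size $n$. (1) Let $\underline F=(F_1,\dots,F_{s-1})$ be $F$ with its last (smallest) tree $F_s$ removed. Then the down-set of $F$ is $$F^{-}=\underline F\times F_s^{-},$$ where $F_s^-$ is the down-set of $F_s$ regarded as a forest of size $2^{k_s}$. (2) Let $d$ be the smallest nonnegative integer not in $\mathrm{Bin}(n)=\{k_1,\dots,k_s\}$. Write $F$ as the concatenation $F^{>d}\times F^{<d}$, where $F^{>d}$ is the tuple of trees of $F$ of height greater than $d$ and $F^{<d}$ is the tuple of trees of $F$ of height less than $d$ (so $F^{<d}$ is a forest of size $2^d-1$). Then the up-set of $F$ is $$F^{+}=F^{>d}\times (F^{<d})^{+}.$$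
   Context: Groups. $H_0$ is trivial and, for $k\ge1$, $H_k=H_{k-1}\wr C_2$, $C_2=\{\pm1\}$: elements are $(\sigma_1,\sigma_2)^{\epsilon}$ with $\sigma_i\in H_{k-1}$, $\epsilon\in\{\pm1\}$, and $(\sigma_1,\sigma_2)^{1}(\tau_1,\tau_2)^{\epsilon}=(\sigma_1\tau_1,\sigma_2\tau_2)^{\epsilon}$, $(\sigma_1,\sigma_2)^{-1}(\tau_1,\tau_2)^{\epsilon}=(\sigma_1\tau_2,\sigma_2\tau_1)^{-\epsilon}$. $H_k$ is a Sylow 2-subgroup of $S_{2^k}$. For $n=2^{k_1}+\dots+2^{k_s}$ with $k_1>\dots>k_s$, put $\mathrm{Bin}(n)=\{k_1,\dots,k_s\}$ and $P_n=H_{k_1}\times\dots\times H_{k_s}$ (a Sylow 2-subgroup of $S_n$; $P_0$ is trivial). Inclusions. $P_{2^k-1}=H_{k-1}\times P_{2^{k-1}-1}\subset H_{k-1}\times H_{k-1}\subset H_k$ for $k\ge 1$ (recursively, using $P_{2^{k-1}-1}\subset H_{k-1}$ on the second factor; $P_0=H_0$ are trivial). In general $P_{n-1}=H_{k_1}\times\dots\times H_{k_{s-1}}\times P_{2^{k_s}-1}\subset P_n$. Irreducible complex representations of $H_k$, $k\ge1$. For $\phi$ irreducible for $H_{k-1}$, $\mathrm{Ext}^{\pm}(\phi)$ are the two extensions of $\phi\otimes\phi$ from $H_{k-1}\times H_{k-1}$ to $H_k$, with character value $\pm\phi(\sigma_1\sigma_2)$ at $(\sigma_1,\sigma_2)^{-1}$.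 For nonisomorphic irreducibles $\phi_1,\phi_2$ of $H_{k-1}$, $\mathrm{Ind}(\phi_1,\phi_2)=\mathrm{Ind}_{H_{k-1}\times H_{k-1}}^{H_k}(\phi_1\otimes\phi_2)$. These are all the irreducibles of $H_k$. Trees. A 1-2 binary tree of height $0$ is a single root vertex $(r,\emptyset)$; one of height $k\ge1$ is $(r,S)$ with $S$ a multiset of one or two 1-2 binary trees of height $k-1$ (unordered, up to isomorphism). A forest of size $n$ is a tuple $(T_1,\dots,T_s)$ with $T_i$ a 1-2 binary tree of height $k_i$; the forest of size $0$ is the empty tuple; a tree of height $k$ is identified with the corresponding one-element forest of size $2^k$. The bijection $\theta_{2^k}$ from irreducibles of $H_k$ to trees of height $k$ sends the trivial representation of $H_0$ to $(r,\emptyset)$, $\mathrm{Ext}^+(\phi)\mapsto(r,\{\theta(\phi),\theta(\phi)\})$, $\mathrm{Ext}^-(\phi)\mapsto(r,\{\theta(\phi)\})$, $\mathrm{Ind}(\phi_1,\phi_2)\mapsto(r,\{\theta(\phi_1),\theta(\phi_2)\})$. Put $\theta_n=\theta_{2^{k_1}}\times\dots\times\theta_{2^{k_s}}$, a bijection from irreducibles of $P_n$ to forests of size $n$. Down-sets and up-sets. For a forest $F=\theta_n(\Gamma)$ of size $n\ge1$, the down-set $F^-$ is the multiset of forests $\theta_{n-1}(\gamma)$ of size $n-1$, with multiplicity that of $\gamma$ in $\mathrm{Res}^{P_n}_{P_{n-1}}\Gamma$. For a forest $F$ of size $n\ge0$, the up-set $F^+$ is the multiset of forests $F'$ of size $n+1$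 with $F\in F'^-$, each with the multiplicity of $F$ in $F'^-$. For a tuple of trees $A$ and a multiset $M$ of tuples of trees, $A\times M$ is the multiset obtained by concatenating $A$ in front of every element of $M$. *)

theory Defs
  imports
    "HOL-Library.Multiset"
    "HOL-Algebra.Weak_Morphisms"
    "Jordan_Normal_Form.VS_Connect"
begin

section \<open>Complex matrix representations\<close>

definition GL :: "nat \<Rightarrow> complex mat monoid" where
  "GL d = units_of (ring_mat TYPE(complex) d ())"

text \<open>A representation on \<open>\<complex>\<^sup>d\<close> is a function into matrices whose values outside the carrier
  are irrelevant; its dimension \<open>d\<close> is read off from the matrix of the identity.\<close>

definition rep_dim :: "('g, 'b) monoid_scheme \<Rightarrow> ('g \<Rightarrow> complex mat) \<Rightarrow> nat" where
  "rep_dim G \<rho> = dim_row (\<rho> \<one>\<^bsub>G\<^esub>)"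

definition representation :: "('g, 'b) monoid_scheme \<Rightarrow> ('g \<Rightarrow> complex mat) \<Rightarrow> bool" where
  "representation G \<rho> \<longleftrightarrow> \<rho> \<in> hom G (GL (rep_dim G \<rho>))"

definition iso_rep ::
  "('g, 'b) monoid_scheme \<Rightarrow> ('g \<Rightarrow> complex mat) \<Rightarrow> ('g \<Rightarrow> complex mat) \<Rightarrow> bool" where
  "iso_rep G \<rho> \<sigma> \<longleftrightarrow>
     representation G \<rho> \<and> representation G \<sigma> \<and> rep_dim G \<rho> = rep_dim G \<sigma> \<and>
     (\<exists>T \<in> carrier (GL (rep_dim G \<rho>)). \<forall>g \<in> carrier G. T * \<rho> g = \<sigma> g * T)"

definition irrep :: "('g, 'b) monoid_scheme \<Rightarrow> ('g \<Rightarrow> complex mat) \<Rightarrow> bool" where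
  "irrep G \<rho> \<longleftrightarrow>
     representation G \<rho> \<and> rep_dim G \<rho> > 0 \<and>
     (\<forall>W. VectorSpace.subspace class_ring W (module_vec TYPE(complex) (rep_dim G \<rho>)) \<and>
          (\<forall>g \<in> carrier G. \<forall>w \<in> W. \<rho> g *\<^sub>v w \<in> W) \<longrightarrow>
          W = {0\<^sub>v (rep_dim G \<rho>)} \<or> W = carrier_vec (rep_dim G \<rho>))"

definition direct_sum_rep :: "('g \<Rightarrow> complex mat) list \<Rightarrow> 'g \<Rightarrow> complex mat" where
  "direct_sum_rep \<rho>s g = diag_block_mat (map (\<lambda>\<rho>. \<rho> g) \<rho>s)"

text \<open>The number of summands isomorphic to \<open>\<gamma>\<close> in a decomposition of \<open>\<rho>\<close> into irreducibles; by
  Maschke and Krull-Schmidt it exists and is unique for representations of finite groups.\<close>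

definition multiplicity_rep ::
  "('g, 'b) monoid_scheme \<Rightarrow> ('g \<Rightarrow> complex mat) \<Rightarrow> ('g \<Rightarrow> complex mat) \<Rightarrow> nat" where
  "multiplicity_rep G \<gamma> \<rho> =
     (THE m. \<exists>\<rho>s. (\<forall>\<sigma> \<in> set \<rho>s. irrep G \<sigma>) \<and> iso_rep G \<rho> (direct_sum_rep \<rho>s) \<and>
                  m = length (filter (iso_rep G \<gamma>) \<rho>s))"

definition mat_trace :: "complex mat \<Rightarrow> complex" where
  "mat_trace A = (\<Sum>i<dim_row A. A $$ (i, i))"

text \<open>The Kronecker product: the basis vector \<open>e\<^sub>i \<otimes> e\<^sub>j\<close> has index \<open>i * n + j\<close>.\<close>

definition kron :: "complex mat \<Rightarrow> complex mat \<Rightarrow> complex mat" where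
  "kron A B = mat (dim_row A * dim_row B) (dim_col A * dim_col B)
     (\<lambda>(i, j). A $$ (i div dim_row B, j div dim_col B) * B $$ (i mod dim_row B, j mod dim_col B))"

text \<open>Induction from a subgroup \<open>K\<close> with left transversal \<open>t\<^sub>0, t\<^sub>1, \<dots>\<close>: the block in position
  \<open>(a, b)\<close> of the matrix of \<open>g\<close> is \<open>\<rho> (t\<^sub>a\<^sup>-\<^sup>1 g t\<^sub>b)\<close>, read as \<open>0\<close> when \<open>t\<^sub>a\<^sup>-\<^sup>1 g t\<^sub>b \<notin> K\<close>.\<close>

definition induced_rep ::
  "('g, 'b) monoid_scheme \<Rightarrow> 'g set \<Rightarrow> 'g list \<Rightarrow> ('g \<Rightarrow> complex mat) \<Rightarrow> 'g \<Rightarrow> complex mat" where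
  "induced_rep G K ts \<rho> g =
     (let d = rep_dim G \<rho> in
      mat (length ts * d) (length ts * d)
        (\<lambda>(i, j). let x = inv\<^bsub>G\<^esub> (ts ! (i div d)) \<otimes>\<^bsub>G\<^esub> g \<otimes>\<^bsub>G\<^esub> (ts ! (j div d))
                  in if x \<in> K then \<rho> x $$ (i mod d, j mod d) else 0))"


section \<open>The groups \<open>H\<^sub>k\<close> and \<open>P\<^sub>n\<close>\<close>

text \<open>\<open>Wr \<sigma>\<^sub>1 \<sigma>\<^sub>2 \<epsilon>\<close> stands for \<open>(\<sigma>\<^sub>1, \<sigma>\<^sub>2)\<^sup>\<epsilon>\<close>, with \<open>\<epsilon> \<in> {1, -1}\<close> enforced by the carrier.\<close>

datatype helem = Triv | Wr helem helem int

fun h_carrier :: "nat \<Rightarrow> helem set" where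
  "h_carrier 0 = {Triv}"
| "h_carrier (Suc k) = {Wr a b e | a b e. a \<in> h_carrier k \<and> b \<in> h_carrier k \<and> e \<in> {1, -1}}"

fun h_mult :: "helem \<Rightarrow> helem \<Rightarrow> helem" where
  "h_mult Triv y = y"
| "h_mult x Triv = x"
| "h_mult (Wr a b e) (Wr c d f) =
     (if e = 1 then Wr (h_mult a c) (h_mult b d) f else Wr (h_mult a d) (h_mult b c) (- f))"

fun h_one :: "nat \<Rightarrow> helem" where
  "h_one 0 = Triv"
| "h_one (Suc k) = Wr (h_one k) (h_one k) 1"

definition H :: "nat \<Rightarrow> helem monoid" where
  "H k = \<lparr>carrier = h_carrier k, monoid.mult = h_mult, one = h_one k\<rparr>"

definition Bin :: "nat \<Rightarrow> nat set" where
  "Bin n = {k. bit n k}"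

definition bin_list :: "nat \<Rightarrow> nat list" where
  "bin_list n = rev (sorted_list_of_set (Bin n))"

text \<open>Elements of \<open>P\<^sub>n\<close> are lists, the first entry belonging to the largest \<open>k \<in> Bin n\<close>.\<close>

definition P :: "nat \<Rightarrow> helem list monoid" where
  "P n = DirProd_list (map H (bin_list n))"

text \<open>The inclusion of \<open>P\<^sub>m\<close>, \<open>m = 2\<^sup>k - 1\<close>, into \<open>H\<^sub>k\<close>; here \<open>bin_list m = [k - 1, \<dots>, 0]\<close>.\<close>

fun incl_H :: "nat \<Rightarrow> helem list \<Rightarrow> helem" where
  "incl_H 0 xs = Triv"
| "incl_H (Suc k) xs = Wr (hd xs) (incl_H k (tl xs)) 1"

text \<open>The inclusion of \<open>P\<^sub>m\<close>, \<open>m = n - 1\<close>, into \<open>P\<^sub>n\<close>, for \<open>n \<ge> 1\<close>.\<close>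

definition incl_P :: "nat \<Rightarrow> helem list \<Rightarrow> helem list" where
  "incl_P n xs =
     (let s = length (bin_list n)
      in take (s - 1) xs @ [incl_H (last (bin_list n)) (drop (s - 1) xs)])"


section \<open>Irreducible representations of \<open>H\<^sub>k\<close>\<close>

type_synonym hrep = "helem \<Rightarrow> complex mat"

text \<open>The subgroup \<open>H\<^sub>k \<times> H\<^sub>k\<close> of \<open>H (Suc k)\<close>, and \<open>\<phi>\<^sub>1 \<otimes> \<phi>\<^sub>2\<close> on it.\<close>

definition base :: "nat \<Rightarrow> helem set" where
  "base k = {Wr a b 1 | a b. a \<in> carrier (H k) \<and> b \<in> carrier (H k)}"

fun tensor :: "hrep \<Rightarrow> hrep \<Rightarrow> hrep" where
  "tensor \<phi>\<^sub>1 \<phi>\<^sub>2 (Wr a b e) = kron (\<phi>\<^sub>1 a) (\<phi>\<^sub>2 b)"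
| "tensor \<phi>\<^sub>1 \<phi>\<^sub>2 Triv = undefined"

text \<open>\<open>\<psi>\<close> is the extension of \<open>\<phi> \<otimes> \<phi>\<close> to \<open>H (Suc k)\<close> of sign \<open>\<epsilon> \<in> {1, -1}\<close>.\<close>

definition is_Ext :: "complex \<Rightarrow> nat \<Rightarrow> hrep \<Rightarrow> hrep \<Rightarrow> bool" where
  "is_Ext \<epsilon> k \<phi> \<psi> \<longleftrightarrow>
     representation (H (Suc k)) \<psi> \<and>
     (\<forall>x \<in> base k. \<psi> x = tensor \<phi> \<phi> x) \<and>
     (\<forall>a \<in> carrier (H k). \<forall>b \<in> carrier (H k).
        mat_trace (\<psi> (Wr a b (-1))) = \<epsilon> * mat_trace (\<phi> (a \<otimes>\<^bsub>H k\<^esub> b)))"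

definition Ind :: "nat \<Rightarrow> hrep \<Rightarrow> hrep \<Rightarrow> hrep" where
  "Ind k \<phi>\<^sub>1 \<phi>\<^sub>2 =
     induced_rep (H (Suc k)) (base k)
       [Wr (h_one k) (h_one k) 1, Wr (h_one k) (h_one k) (-1)] (tensor \<phi>\<^sub>1 \<phi>\<^sub>2)"


section \<open>Trees, forests and the bijection \<open>\<theta>\<close>\<close>

datatype tree = Node "tree multiset"

inductive is_tree :: "nat \<Rightarrow> tree \<Rightarrow> bool" where
  "is_tree 0 (Node {#})"
| "size S \<in> {1, 2} \<Longrightarrow> \<forall>T \<in># S. is_tree k T \<Longrightarrow> is_tree (Suc k) (Node S)"

definition is_forest :: "nat \<Rightarrow> tree list \<Rightarrow> bool" where
  "is_forest n F \<longleftrightarrow> list_all2 is_tree (bin_list n) F"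

text \<open>\<open>theta k \<psi> T\<close> says that \<open>\<psi>\<close> is an irreducible representation of \<open>H\<^sub>k\<close> and that \<open>\<theta>\<close> sends its
  isomorphism class to \<open>T\<close>.\<close>

inductive theta :: "nat \<Rightarrow> hrep \<Rightarrow> tree \<Rightarrow> bool" where
  triv: "irrep (H 0) \<psi> \<Longrightarrow> iso_rep (H 0) \<psi> (\<lambda>_. 1\<^sub>m 1) \<Longrightarrow> theta 0 \<psi> (Node {#})"
| Ext_plus: "theta k \<phi> T \<Longrightarrow> is_Ext 1 k \<phi> \<chi> \<Longrightarrow>
    irrep (H (Suc k)) \<psi> \<Longrightarrow> iso_rep (H (Suc k)) \<psi> \<chi> \<Longrightarrow> theta (Suc k) \<psi> (Node {#T, T#})"
| Ext_minus: "theta k \<phi> T \<Longrightarrow> is_Ext (-1) k \<phi> \<chi> \<Longrightarrow>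
    irrep (H (Suc k)) \<psi> \<Longrightarrow> iso_rep (H (Suc k)) \<psi> \<chi> \<Longrightarrow> theta (Suc k) \<psi> (Node {#T#})"
| Ind: "theta k \<phi>\<^sub>1 T\<^sub>1 \<Longrightarrow> theta k \<phi>\<^sub>2 T\<^sub>2 \<Longrightarrow> \<not> iso_rep (H k) \<phi>\<^sub>1 \<phi>\<^sub>2 \<Longrightarrow>
    irrep (H (Suc k)) \<psi> \<Longrightarrow> iso_rep (H (Suc k)) \<psi> (Ind k \<phi>\<^sub>1 \<phi>\<^sub>2) \<Longrightarrow>
    theta (Suc k) \<psi> (Node {#T\<^sub>1, T\<^sub>2#})"

definition tensor_list :: "hrep list \<Rightarrow> helem list \<Rightarrow> complex mat" where
  "tensor_list \<phi>s xs = foldr kron (map2 (\<lambda>\<phi> x. \<phi> x) \<phi>s xs) (1\<^sub>m 1)"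

definition theta_forest :: "nat \<Rightarrow> (helem list \<Rightarrow> complex mat) \<Rightarrow> tree list \<Rightarrow> bool" where
  "theta_forest n \<Gamma> F \<longleftrightarrow>
     irrep (P n) \<Gamma> \<and> length F = length (bin_list n) \<and>
     (\<exists>\<phi>s. length \<phi>s = length (bin_list n) \<and>
           (\<forall>i < length (bin_list n). theta (bin_list n ! i) (\<phi>s ! i) (F ! i)) \<and>
           iso_rep (P n) \<Gamma> (tensor_list \<phi>s))"

text \<open>A representative of the isomorphism class corresponding to the forest \<open>F\<close> of size \<open>n\<close>.\<close>

definition theta_inv :: "nat \<Rightarrow> tree list \<Rightarrow> helem list \<Rightarrow> complex mat" where
  "theta_inv n F = (SOME \<Gamma>. theta_forest n \<Gamma> F)"


section \<open>Down-sets and up-sets\<close>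

text \<open>For each size there are only finitely many forests (shown below), so the sums are genuine.\<close>

definition down_set :: "nat \<Rightarrow> tree list \<Rightarrow> tree list multiset" where
  "down_set n F =
     (\<Sum>F' \<in> {F'. is_forest (n - 1) F'}.
        replicate_mset
          (multiplicity_rep (P (n - 1)) (theta_inv (n - 1) F') (theta_inv n F \<circ> incl_P n)) F')"

definition up_set :: "nat \<Rightarrow> tree list \<Rightarrow> tree list multiset" where
  "up_set n F =
     (\<Sum>F' \<in> {F'. is_forest (n + 1) F'}. replicate_mset (count (down_set (n + 1) F') F) F')"

definition prepend :: "tree list \<Rightarrow> tree list multiset \<Rightarrow> tree list multiset" where
  "prepend A M = image_mset (\<lambda>B. A @ B) M"

definition trees_above :: "nat \<Rightarrow> tree list \<Rightarrow> tree list" where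
  "trees_above d F = filter (\<lambda>T. \<exists>k > d. is_tree k T) F"

definition trees_below :: "nat \<Rightarrow> tree list \<Rightarrow> tree list" where
  "trees_below d F = filter (\<lambda>T. \<exists>k < d. is_tree k T) F"

lemma finite_trees: "finite {T. is_tree k T}"
proof (induction k)
  case 0
  have "{T. is_tree 0 T} = {Node {#}}"
    by (auto elim: is_tree.cases intro: is_tree.intros)
  then show ?case by simp
next
  case (Suc k)
  let ?A = "{T. is_tree k T}"
  have "{T. is_tree (Suc k) T} \<subseteq>
      (\<lambda>T. Node {#T#}) ` ?A \<union> (\<lambda>(T, U). Node {#T, U#}) ` (?A \<times> ?A)"
  proof
    fix T assume "T \<in> {T. is_tree (Suc k) T}"
    then obtain S where S: "T = Node S" "size S \<in> {1, 2}" "\<forall>U \<in># S. is_tree k U"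
      by (auto elim: is_tree.cases)
    then consider "size S = 1" | "size S = Suc 1" by auto
    then show "T \<in> (\<lambda>T. Node {#T#}) ` ?A \<union> (\<lambda>(T, U). Node {#T, U#}) ` (?A \<times> ?A)"
    proof cases
      case 1
      then obtain U where "S = {#U#}" using size_1_singleton_mset by metis
      with S show ?thesis by auto
    next
      case 2
      then obtain U S' where "S = add_mset U S'" "size S' = 1"
        by (metis size_eq_Suc_imp_eq_union size_add_mset nat.inject)
      then obtain V where "S = {#U, V#}"
        using size_1_singleton_mset by metis
      with S show ?thesis by auto
    qed
  qed
  then show ?case
    by (rule finite_subset) (use Suc.IH in simp)
qed

lemma finite_forests: "finite {F. is_forest n F}"
proof -
  have "finite {F. list_all2 is_tree ks F}" for ks
  proof (induction ks)
    case (Cons k ks)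
    have "{F. list_all2 is_tree (k # ks) F} \<subseteq>
        (\<lambda>(T, F). T # F) ` ({T. is_tree k T} \<times> {F. list_all2 is_tree ks F})"
      by (auto simp: list_all2_Cons1)
    then show ?case
      using Cons finite_trees by (auto intro: finite_subset)
  qed simp
  then show ?thesis by (simp add: is_forest_def)
qed

end

theory Submission
  imports Defs "Jordan_Normal_Form.DL_Rank" "Jordan_Normal_Form.Spectral_Radius"
begin

text \<open>Everything is computed with characters. Since the multiplicity of an irreducible \<open>\<gamma>\<close> in \<open>\<rho>\<close> is
  the inner product of their characters, and a representation whose character has norm \<open>1\<close> is
  irreducible, the explicit characters of \<open>Ext\<close> and \<open>Ind\<close> show that distinct trees have orthogonal
  characters. The inclusion of \<open>P (n - 1)\<close> into \<open>P n\<close> is the identity on all factors but the last, so the inner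
  product defining a multiplicity factors into orthogonality relations for the common trees and
  the multiplicity for the last tree alone. This is the statement on down-sets; the one on up-sets
  follows because a carry turns the blocks \<open>d - 1, \<dots>, 0\<close> of \<open>n\<close> into the last block \<open>d\<close> of \<open>n + 1\<close>.\<close>

section \<open>Matrices and representations\<close>

text \<open>The definitions pick objects by description: \<open>multiplicity_rep\<close> is a
  \<open>THE\<close> over decompositions, and \<open>theta_inv\<close> is a \<open>SOME\<close> over
  representations, made separately for each size. Such choices cannot be compared as matrices, only
  through characters, and both descriptions must first be shown to denote something. For the
  \<open>THE\<close>, Maschke's theorem supplies a decomposition and orthogonality makes the count
  independent of it. For the \<open>SOME\<close>, every tree has to be realised by matrices; the
  delicate case is Ext, obtained by composing a Kronecker product with the swap S of the two tensor
  factors, because tr((A \<otimes> B) S) = tr(A B) is the prescribed value at (\<sigma>,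
  \<tau>)^{-1}. No branching rule for H_k is computed: the restriction of the last tree enters both
  sides of the claim as the same unevaluated inner product. The pairing of characters uses the value
  at the inverse element in place of a complex conjugate, which keeps the argument
  algebraic.\<close>

lemma GL_carrier_iff:
  "A \<in> carrier (GL d) \<longleftrightarrow> A \<in> carrier_mat d d \<and> (\<exists>B \<in> carrier_mat d d. A * B = 1\<^sub>m d \<and> B * A = 1\<^sub>m d)"
  by (auto simp: GL_def units_of_def Units_def ring_mat_simps)

text \<open>The dimension is an argument and only matrix equations occur, so that explicit families
  of matrices can be checked directly; \<open>representation_iff\<close> links this to
  \<open>representation\<close>.\<close>

definition rep_on :: "('g, 'b) monoid_scheme \<Rightarrow> nat \<Rightarrow> ('g \<Rightarrow> complex mat) \<Rightarrow> bool" where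
  "rep_on G d \<rho> \<longleftrightarrow>
     (\<forall>g \<in> carrier G. \<rho> g \<in> carrier_mat d d) \<and> \<rho> \<one>\<^bsub>G\<^esub> = 1\<^sub>m d \<and>
     (\<forall>g \<in> carrier G. \<forall>h \<in> carrier G. \<rho> (g \<otimes>\<^bsub>G\<^esub> h) = \<rho> g * \<rho> h)"

lemma rep_on_dim: "rep_on G d \<rho> \<Longrightarrow> rep_dim G \<rho> = d"
  by (simp add: rep_on_def rep_dim_def)

lemma mult_GL: "x \<otimes>\<^bsub>GL d\<^esub> y = x * y"
  by (simp add: GL_def units_of_def ring_mat_simps)

lemma one_GL: "\<one>\<^bsub>GL d\<^esub> = 1\<^sub>m d"
  by (simp add: GL_def units_of_def ring_mat_simps)

lemma group_GL: "group (GL d)"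
  unfolding GL_def
  by (rule monoid.units_group) (use ring_mat[where 'a = complex, of d "()"] in \<open>simp add: ring_def\<close>)

text \<open>Invertibility comes for free: over a group, \<rho>(g^{-1}) is a two-sided inverse of
  \<rho>(g).\<close>

lemma representation_iff:
  assumes "group G"
  shows "representation G \<rho> \<longleftrightarrow> rep_on G (rep_dim G \<rho>) \<rho>" (is "?L \<longleftrightarrow> ?R")
proof
  assume L: ?L
  then have hom: "\<rho> \<in> hom G (GL (rep_dim G \<rho>))" by (simp add: representation_def)
  interpret h: group_hom G "GL (rep_dim G \<rho>)" \<rho>
    using assms group_GL hom by (simp add: group_hom_def group_hom_axioms_def)
  have "\<rho> g \<in> carrier_mat (rep_dim G \<rho>) (rep_dim G \<rho>)" if "g \<in> carrier G" for g
    using h.hom_closed[OF that] GL_carrier_iff by auto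
  then show ?R
    using h.hom_one h.hom_mult by (auto simp: rep_on_def one_GL mult_GL)
next
  assume R: ?R
  interpret group G by fact
  let ?d = "rep_dim G \<rho>"
  have "\<rho> g \<in> carrier (GL ?d)" if g: "g \<in> carrier G" for g
  proof -
    have "\<rho> g * \<rho> (inv\<^bsub>G\<^esub> g) = 1\<^sub>m ?d" "\<rho> (inv\<^bsub>G\<^esub> g) * \<rho> g = 1\<^sub>m ?d"
      using R g r_inv[OF g] l_inv[OF g] inv_closed[OF g] unfolding rep_on_def by metis+
    then show ?thesis
      using R g unfolding GL_carrier_iff rep_on_def
      by (intro conjI bexI[of _ "\<rho> (inv\<^bsub>G\<^esub> g)"]) auto
  qed
  then show ?L
    using R by (auto simp: representation_def hom_def mult_GL rep_on_def)
qed

lemma rep_on_representation: "group G \<Longrightarrow> rep_on G d \<rho> \<Longrightarrow> representation G \<rho>"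
  by (simp add: representation_iff rep_on_dim)

lemma subspaceI:
  assumes "W \<subseteq> carrier_vec n" "0\<^sub>v n \<in> W" "\<And>v w. v \<in> W \<Longrightarrow> w \<in> W \<Longrightarrow> v + w \<in> W"
    "\<And>c v. v \<in> W \<Longrightarrow> c \<cdot>\<^sub>v v \<in> W"
  shows "VectorSpace.subspace class_ring W (module_vec TYPE(complex) n)"
proof -
  interpret vec_space "TYPE(complex)" n .
  show ?thesis
    unfolding VectorSpace.subspace_def submodule_def
    using assms vec_vs[where 'a=complex, of n] vec_module[where 'a=complex, of n]
    by (auto simp: module_vec_simps)
qed

lemma subspaceD:
  assumes "VectorSpace.subspace class_ring W (module_vec TYPE(complex) n)"
  shows "W \<subseteq> carrier_vec n" "0\<^sub>v n \<in> W" "\<And>v w. v \<in> W \<Longrightarrow> w \<in> W \<Longrightarrow> v + w \<in> W"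
    "\<And>c v. v \<in> W \<Longrightarrow> c \<cdot>\<^sub>v v \<in> W"
  using assms
  unfolding VectorSpace.subspace_def submodule_def
  by (auto simp: module_vec_simps)

text \<open>Rectangular factors are allowed on purpose: \<open>bijective_mat_square\<close> compares
  the traces of an m by m and an n by n product.\<close>

lemma trace_comm:
  assumes "A \<in> carrier_mat n m" "B \<in> carrier_mat m n"
  shows "mat_trace (A * B) = mat_trace (B * A)"
proof -
  have "mat_trace (A * B) = (\<Sum>i<n. \<Sum>j<m. A $$ (i, j) * B $$ (j, i))"
    using assms by (auto simp: mat_trace_def scalar_prod_def atLeast0LessThan)
  also have "\<dots> = (\<Sum>j<m. \<Sum>i<n. B $$ (j, i) * A $$ (i, j))"
    by (subst sum.swap) (simp add: mult.commute)
  also have "\<dots> = mat_trace (B * A)"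
    using assms by (auto simp: mat_trace_def scalar_prod_def atLeast0LessThan)
  finally show ?thesis .
qed

lemma trace_one: "mat_trace (1\<^sub>m n) = of_nat n"
  by (simp add: mat_trace_def)

lemma trace_similar:
  assumes "T \<in> carrier (GL d)" "A \<in> carrier_mat d d" "B \<in> carrier_mat d d" "T * A = B * T"
  shows "mat_trace A = mat_trace B"
proof -
  obtain S where T: "T \<in> carrier_mat d d" and S: "S \<in> carrier_mat d d" "T * S = 1\<^sub>m d" "S * T = 1\<^sub>m d"
    using assms(1) GL_carrier_iff by auto
  have "mat_trace A = mat_trace (S * (T * A))"
    using S T assms(2) by (simp flip: assoc_mult_mat[of S d d T d A d])
  also have "\<dots> = mat_trace (T * A * S)"
    by (rule trace_comm[of _ d d]) (use S T assms in auto)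
  also have "T * A * S = B"
    using S T assms by (simp add: assoc_mult_mat[of _ d d _ d _ d])
  finally show ?thesis .
qed

lemma mult_unit_vec:
  assumes "A \<in> carrier_mat n m" "i < m"
  shows "A *\<^sub>v unit_vec m i = (col A i :: complex vec)"
  using assms by (intro eq_vecI) auto

text \<open>The linear algebra behind Schur's lemma: a matrix with trivial kernel and full range is square
  because the two traces of its one-sided inverse agree.\<close>

lemma bijective_mat_square:
  fixes T :: "complex mat"
  assumes T: "T \<in> carrier_mat m n"
    and inj: "\<And>v. v \<in> carrier_vec n \<Longrightarrow> T *\<^sub>v v = 0\<^sub>v m \<Longrightarrow> v = 0\<^sub>v n"
    and surj: "\<And>w. w \<in> carrier_vec m \<Longrightarrow> \<exists>v \<in> carrier_vec n. T *\<^sub>v v = w"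
  shows "m = n \<and> T \<in> carrier (GL n)"
proof -
  have "\<forall>i. \<exists>v \<in> carrier_vec n. i < m \<longrightarrow> T *\<^sub>v v = unit_vec m i"
    using surj by (metis unit_vec_carrier)
  then obtain f where f: "\<And>i. f i \<in> carrier_vec n" "\<And>i. i < m \<Longrightarrow> T *\<^sub>v f i = unit_vec m i"
    by metis
  \<comment> \<open>The columns of V are preimages of the unit vectors, which makes V a right
    inverse of T.\<close>
  define V where "V = mat_of_cols n (map f [0..<m])"
  have V: "V \<in> carrier_mat n m" by (simp add: V_def carrier_matI)
  have colV: "col V i = f i" if "i < m" for i
    using that f(1) by (simp add: V_def)
  have TV: "T * V = 1\<^sub>m m"
  proof (rule mat_col_eqI)
    fix i assume "i < dim_col (1\<^sub>m m :: complex mat)"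
    then have "i < m" by simp
    then show "col (T * V) i = col (1\<^sub>m m) i"
      using col_mult2[OF T V] colV f by simp
  qed (use T V in auto)
  \<comment> \<open>From T V = 1 it follows that T (V T u - u) = 0 for each unit vector u, so the
    trivial kernel turns the right inverse into a left one.\<close>
  have VT: "V * T = 1\<^sub>m n"
  proof (rule mat_col_eqI)
    fix i assume "i < dim_col (1\<^sub>m n :: complex mat)"
    then have i: "i < n" by simp
    let ?u = "unit_vec n i"
    let ?w = "(V * T) *\<^sub>v ?u"
    have w: "?w \<in> carrier_vec n" using V T by auto
    have "T *\<^sub>v ?w = (T * (V * T)) *\<^sub>v ?u"
      by (rule assoc_mult_mat_vec[symmetric]) (use V T in auto)
    also have "T * (V * T) = T"
      using T V TV by (simp flip: assoc_mult_mat[OF T V T])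
    finally have "T *\<^sub>v (?w - ?u) = 0\<^sub>v m"
      using T w by (subst mult_minus_distrib_mat_vec) auto
    then have eq: "?w - ?u = 0\<^sub>v n"
      by (intro inj) (use w in auto)
    have "?w = ?u"
    proof (rule eq_vecI)
      fix j assume "j < dim_vec ?u"
      then show "?w $ j = ?u $ j"
        using arg_cong[OF eq, of "\<lambda>v. v $ j"] w by simp
    qed (use V in auto)
    then show "col (V * T) i = col (1\<^sub>m n) i"
      using mult_unit_vec[OF mult_carrier_mat[OF V T] i] i by simp
  qed (use T V in auto)
  have "of_nat m = (of_nat n :: complex)"
    using trace_comm[OF T V] TV VT trace_one by metis
  then have "m = n" by simp
  then show ?thesis using T V TV VT GL_carrier_iff by auto
qed

section \<open>Schur's lemma\<close>

lemma mult_mat_index: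
  fixes A B :: "complex mat"
  assumes "A \<in> carrier_mat k m" "B \<in> carrier_mat m n" "i < k" "j < n"
  shows "(A * B) $$ (i, j) = (\<Sum>l<m. A $$ (i, l) * B $$ (l, j))"
  using assms by (auto simp: scalar_prod_def atLeast0LessThan)

text \<open>Matrix sizes are values rather than types, so the size is passed along; an empty family
  then still sums to a zero matrix of the right shape.\<close>

definition msum :: "nat \<Rightarrow> nat \<Rightarrow> 'i set \<Rightarrow> ('i \<Rightarrow> complex mat) \<Rightarrow> complex mat" where
  "msum m n S F = mat m n (\<lambda>(i, j). \<Sum>h\<in>S. F h $$ (i, j))"

lemma msum_carrier [simp]: "msum m n S F \<in> carrier_mat m n"
  by (simp add: msum_def)

lemma msum_index: "i < m \<Longrightarrow> j < n \<Longrightarrow> msum m n S F $$ (i, j) = (\<Sum>h\<in>S. F h $$ (i, j))"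
  by (simp add: msum_def)

lemma msum_cong: "(\<And>h. h \<in> S \<Longrightarrow> F h = F' h) \<Longrightarrow> msum m n S F = msum m n S F'"
  by (simp add: msum_def)

lemma msum_reindex: "bij_betw f S S' \<Longrightarrow> msum m n S (\<lambda>h. F (f h)) = msum m n S' F"
  unfolding msum_def by (intro cong_mat) (auto intro: sum.reindex_bij_betw)

lemma mult_msum:
  assumes A: "A \<in> carrier_mat k m" and F: "\<And>h. h \<in> S \<Longrightarrow> F h \<in> carrier_mat m n"
  shows "A * msum m n S F = msum k n S (\<lambda>h. A * F h)"
proof (rule eq_matI)
  fix i j assume "i < dim_row (msum k n S (\<lambda>h. A * F h))" "j < dim_col (msum k n S (\<lambda>h. A * F h))"
  then have ij: "i < k" "j < n" by (auto simp: msum_def)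
  have "(A * msum m n S F) $$ (i, j) = (\<Sum>l<m. A $$ (i, l) * (\<Sum>h\<in>S. F h $$ (l, j)))"
    using A ij by (auto simp: scalar_prod_def msum_def atLeast0LessThan)
  also have "\<dots> = (\<Sum>h\<in>S. \<Sum>l<m. A $$ (i, l) * F h $$ (l, j))"
    unfolding sum_distrib_left by (rule sum.swap)
  also have "\<dots> = (\<Sum>h\<in>S. (A * F h) $$ (i, j))"
    using mult_mat_index[OF A F] ij by (intro sum.cong) auto
  finally show "(A * msum m n S F) $$ (i, j) = msum k n S (\<lambda>h. A * F h) $$ (i, j)"
    using ij by (simp add: msum_index)
qed (use A in \<open>auto simp: msum_def\<close>)

lemma msum_mult:
  assumes A: "A \<in> carrier_mat n k" and F: "\<And>h. h \<in> S \<Longrightarrow> F h \<in> carrier_mat m n"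
  shows "msum m n S F * A = msum m k S (\<lambda>h. F h * A)"
proof (rule eq_matI)
  fix i j assume "i < dim_row (msum m k S (\<lambda>h. F h * A))" "j < dim_col (msum m k S (\<lambda>h. F h * A))"
  then have ij: "i < m" "j < k" by (auto simp: msum_def)
  have "(msum m n S F * A) $$ (i, j) = (\<Sum>l<n. (\<Sum>h\<in>S. F h $$ (i, l)) * A $$ (l, j))"
    using A ij by (auto simp: scalar_prod_def msum_def atLeast0LessThan)
  also have "\<dots> = (\<Sum>h\<in>S. \<Sum>l<n. F h $$ (i, l) * A $$ (l, j))"
    unfolding sum_distrib_right by (rule sum.swap)
  also have "\<dots> = (\<Sum>h\<in>S. (F h * A) $$ (i, j))"
    using mult_mat_index[OF F A] ij by (intro sum.cong) auto
  finally show "(msum m n S F * A) $$ (i, j) = msum m k S (\<lambda>h. F h * A) $$ (i, j)"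
    using ij by (simp add: msum_index)
qed (use A in \<open>auto simp: msum_def\<close>)

lemma trace_msum:
  "(\<And>h. h \<in> S \<Longrightarrow> F h \<in> carrier_mat n n) \<Longrightarrow> mat_trace (msum n n S F) = (\<Sum>h\<in>S. mat_trace (F h))"
  by (subst sum.cong[OF refl, of S _ "\<lambda>h. \<Sum>i<n. F h $$ (i, i)"])
    (auto simp: mat_trace_def msum_def intro: sum.swap)

text \<open>The matrix unit E_ab. Placed between two matrices it isolates a product of one entry of
  each, which lets products of characters be written through averaged intertwiners.\<close>

definition elem_mat :: "nat \<Rightarrow> nat \<Rightarrow> nat \<Rightarrow> nat \<Rightarrow> complex mat" where
  "elem_mat m n a b = mat m n (\<lambda>(i, j). if i = a \<and> j = b then 1 else 0)"

lemma elem_mat_carrier [simp]: "elem_mat m n a b \<in> carrier_mat m n"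
  by (simp add: elem_mat_def)

lemma mult_elem_mat_mult:
  assumes A: "A \<in> carrier_mat k m" and B: "B \<in> carrier_mat n l"
    and "i < k" "a < m" "b < n" "j < l"
  shows "(A * elem_mat m n a b * B) $$ (i, j) = A $$ (i, a) * B $$ (b, j)"
proof -
  have 1: "(A * elem_mat m n a b) $$ (i, q) = (if q = b then A $$ (i, a) else 0)" if "q < n" for q
  proof -
    have "(A * elem_mat m n a b) $$ (i, q) = (\<Sum>p<m. A $$ (i, p) * (if p = a \<and> q = b then 1 else 0))"
      using assms that by (auto simp: scalar_prod_def elem_mat_def atLeast0LessThan)
    also have "\<dots> = (\<Sum>p<m. if p = a then (if q = b then A $$ (i, a) else 0) else 0)"
      by (intro sum.cong) auto
    also have "\<dots> = (if q = b then A $$ (i, a) else 0)"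
      using assms by simp
    finally show ?thesis .
  qed
  have "(A * elem_mat m n a b * B) $$ (i, j) = (\<Sum>q<n. (A * elem_mat m n a b) $$ (i, q) * B $$ (q, j))"
    using assms mult_carrier_mat[OF A elem_mat_carrier[of m n a b]]
    by (auto simp: scalar_prod_def elem_mat_def atLeast0LessThan)
  also have "\<dots> = (\<Sum>q<n. if q = b then A $$ (i, a) * B $$ (b, j) else 0)"
    by (intro sum.cong) (auto simp: 1)
  also have "\<dots> = A $$ (i, a) * B $$ (b, j)" using assms by simp
  finally show ?thesis .
qed

lemma zero_matI:
  fixes T :: "complex mat"
  assumes "T \<in> carrier_mat m n" "\<And>v. v \<in> carrier_vec n \<Longrightarrow> T *\<^sub>v v = 0\<^sub>v m"
  shows "T = 0\<^sub>m m n"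
proof (rule mat_col_eqI)
  fix i assume "i < dim_col (0\<^sub>m m n :: complex mat)"
  then show "col T i = col (0\<^sub>m m n) i"
    using mult_unit_vec[OF assms(1)] assms(2)[of "unit_vec n i"] by simp
qed (use assms in auto)

section \<open>Representations of a finite group\<close>

locale finite_group = group G for G (structure) +
  assumes finite_carrier [simp]: "finite (carrier G)"
begin

lemma card_pos: "card (carrier G) > 0"
  using one_closed finite_carrier card_gt_0_iff by blast

lemma carrier_nonempty [simp]: "carrier G \<noteq> {}"
  using one_closed by blast

lemma rep_on: "representation G \<rho> \<Longrightarrow> rep_on G (rep_dim G \<rho>) \<rho>"
  using representation_iff[OF is_group] by simp

lemma rep_carrier: "representation G \<rho> \<Longrightarrow> g \<in> carrier G \<Longrightarrow> \<rho> g \<in> carrier_mat (rep_dim G \<rho>) (rep_dim G \<rho>)"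
  using rep_on by (auto simp: rep_on_def)

lemma rep_mult: "representation G \<rho> \<Longrightarrow> g \<in> carrier G \<Longrightarrow> h \<in> carrier G \<Longrightarrow> \<rho> (g \<otimes> h) = \<rho> g * \<rho> h"
  using rep_on by (auto simp: rep_on_def)

lemma rep_one: "representation G \<rho> \<Longrightarrow> \<rho> \<one> = 1\<^sub>m (rep_dim G \<rho>)"
  using rep_on by (auto simp: rep_on_def)

lemma rep_inv_mult: "representation G \<rho> \<Longrightarrow> g \<in> carrier G \<Longrightarrow> \<rho> (inv g) * \<rho> g = 1\<^sub>m (rep_dim G \<rho>)"
  using rep_mult[of \<rho> "inv g" g] rep_one by simp

lemma irrep_rep: "irrep G \<rho> \<Longrightarrow> representation G \<rho>"
  by (simp add: irrep_def)

lemma irrepD: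
  assumes "irrep G \<rho>" "W \<subseteq> carrier_vec (rep_dim G \<rho>)" "0\<^sub>v (rep_dim G \<rho>) \<in> W"
    "\<And>v w. v \<in> W \<Longrightarrow> w \<in> W \<Longrightarrow> v + w \<in> W" "\<And>c v. v \<in> W \<Longrightarrow> c \<cdot>\<^sub>v v \<in> W"
    "\<And>g w. g \<in> carrier G \<Longrightarrow> w \<in> W \<Longrightarrow> \<rho> g *\<^sub>v w \<in> W"
  shows "W = {0\<^sub>v (rep_dim G \<rho>)} \<or> W = carrier_vec (rep_dim G \<rho>)"
  using assms subspaceI[OF assms(2-5)] unfolding irrep_def by blast

lemma iso_rep_sym: assumes "iso_rep G \<rho> \<sigma>" shows "iso_rep G \<sigma> \<rho>"
proof -
  let ?d = "rep_dim G \<rho>"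
  obtain T where r: "representation G \<rho>" "representation G \<sigma>" "?d = rep_dim G \<sigma>"
    and T: "T \<in> carrier (GL ?d)" "\<And>g. g \<in> carrier G \<Longrightarrow> T * \<rho> g = \<sigma> g * T"
    using assms by (auto simp: iso_rep_def)
  obtain S where S: "S \<in> carrier_mat ?d ?d" "T * S = 1\<^sub>m ?d" "S * T = 1\<^sub>m ?d"
    and T': "T \<in> carrier_mat ?d ?d"
    using T(1) GL_carrier_iff by auto
  have "S * \<sigma> g = \<rho> g * S" if g: "g \<in> carrier G" for g
  proof -
    have c: "\<rho> g \<in> carrier_mat ?d ?d" "\<sigma> g \<in> carrier_mat ?d ?d"
      using rep_carrier[OF r(1) g] rep_carrier[OF r(2) g] r(3) by auto
    have "S * \<sigma> g = S * (\<sigma> g * (T * S))" using S c by simp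
    also have "\<dots> = S * (T * \<rho> g * S)"
      using S c T T' g by (simp add: assoc_mult_mat[of _ ?d ?d _ ?d _ ?d])
    also have "\<dots> = S * T * (\<rho> g * S)"
      using S(1) c T' by (simp add: assoc_mult_mat[of _ ?d ?d _ ?d _ ?d])
    finally show ?thesis using S c by simp
  qed
  moreover have "S \<in> carrier (GL ?d)" using S T' GL_carrier_iff by auto
  ultimately show ?thesis using r by (auto simp: iso_rep_def)
qed

lemma iso_rep_refl: "representation G \<rho> \<Longrightarrow> iso_rep G \<rho> \<rho>"
proof -
  assume r: "representation G \<rho>"
  have "1\<^sub>m (rep_dim G \<rho>) \<in> carrier (GL (rep_dim G \<rho>))"
    by (auto simp: GL_carrier_iff intro!: bexI[of _ "1\<^sub>m (rep_dim G \<rho>)"])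
  then show ?thesis
    using r rep_carrier[OF r] unfolding iso_rep_def
    by (metis left_mult_one_mat right_mult_one_mat)
qed

text \<open>Kernel and range of T are invariant subspaces. As T is nonzero, irreducibility makes the
  kernel zero and the range everything, and \<open>bijective_mat_square\<close> applies.\<close>

lemma schur:
  assumes \<rho>: "irrep G \<rho>" and \<sigma>: "irrep G \<sigma>"
    and T: "T \<in> carrier_mat (rep_dim G \<sigma>) (rep_dim G \<rho>)"
    and com: "\<And>g. g \<in> carrier G \<Longrightarrow> T * \<rho> g = \<sigma> g * T"
    and nz: "T \<noteq> 0\<^sub>m (rep_dim G \<sigma>) (rep_dim G \<rho>)"
  shows "rep_dim G \<sigma> = rep_dim G \<rho> \<and> T \<in> carrier (GL (rep_dim G \<rho>))"
proof -
  let ?n = "rep_dim G \<rho>" and ?m = "rep_dim G \<sigma>"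
  note \<rho>c = rep_carrier[OF irrep_rep[OF \<rho>]] and \<sigma>c = rep_carrier[OF irrep_rep[OF \<sigma>]]
  have comv: "T *\<^sub>v (\<rho> g *\<^sub>v v) = \<sigma> g *\<^sub>v (T *\<^sub>v v)" if "g \<in> carrier G" "v \<in> carrier_vec ?n" for g v
    using that com[OF that(1)] T \<rho>c[OF that(1)] \<sigma>c[OF that(1)]
    by (metis assoc_mult_mat_vec)
  define K where "K = {v \<in> carrier_vec ?n. T *\<^sub>v v = 0\<^sub>v ?m}"
  have "K = {0\<^sub>v ?n} \<or> K = carrier_vec ?n"
  proof (rule irrepD[OF \<rho>])
    show "0\<^sub>v ?n \<in> K" using T by (auto simp: K_def)
    show "v + w \<in> K" if "v \<in> K" "w \<in> K" for v w
      using that T by (auto simp: K_def mult_add_distrib_mat_vec)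
    show "c \<cdot>\<^sub>v v \<in> K" if "v \<in> K" for c v
      using that T by (auto simp: K_def mult_mat_vec)
    show "\<rho> g *\<^sub>v w \<in> K" if "g \<in> carrier G" "w \<in> K" for g w
      using that \<rho>c[OF that(1)] \<sigma>c[OF that(1)] comv[OF that(1)] by (auto simp: K_def)
  qed (auto simp: K_def)
  moreover have "K \<noteq> carrier_vec ?n"
    using nz zero_matI[OF T] unfolding K_def by blast
  ultimately have K: "K = {0\<^sub>v ?n}" by simp
  define R where "R = {T *\<^sub>v v | v. v \<in> carrier_vec ?n}"
  have "R = {0\<^sub>v ?m} \<or> R = carrier_vec ?m"
  proof (rule irrepD[OF \<sigma>])
    show "R \<subseteq> carrier_vec ?m" using T by (auto simp: R_def)
    show "0\<^sub>v ?m \<in> R" using T by (auto simp: R_def intro!: exI[of _ "0\<^sub>v ?n"])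
    show "v + w \<in> R" if vw: "v \<in> R" "w \<in> R" for v w
    proof -
      obtain v' w' where "v' \<in> carrier_vec ?n" "w' \<in> carrier_vec ?n" "v = T *\<^sub>v v'" "w = T *\<^sub>v w'"
        using vw unfolding R_def by blast
      then show ?thesis
        using mult_add_distrib_mat_vec[OF T, of v' w'] by (auto simp: R_def intro!: exI[of _ "v' + w'"])
    qed
    show "c \<cdot>\<^sub>v v \<in> R" if v: "v \<in> R" for c v
    proof -
      obtain v' where "v' \<in> carrier_vec ?n" "v = T *\<^sub>v v'"
        using v by (auto simp: R_def)
      then show ?thesis
        using mult_mat_vec[OF T, of v' c] by (auto simp: R_def intro!: exI[of _ "c \<cdot>\<^sub>v v'"])
    qed
    show "\<sigma> g *\<^sub>v w \<in> R" if g: "g \<in> carrier G" and w: "w \<in> R" for g w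
    proof -
      obtain v where "v \<in> carrier_vec ?n" "w = T *\<^sub>v v"
        using w by (auto simp: R_def)
      then show ?thesis
        using comv[OF g, of v] \<rho>c[OF g] by (auto simp: R_def intro!: exI[of _ "\<rho> g *\<^sub>v v"])
    qed
  qed
  moreover have "R \<noteq> {0\<^sub>v ?m}"
    using nz zero_matI[OF T] unfolding R_def by blast
  ultimately have R: "R = carrier_vec ?m" by simp
  show ?thesis
  proof (rule bijective_mat_square[OF T])
    fix v assume "v \<in> carrier_vec ?n" "T *\<^sub>v v = 0\<^sub>v ?m"
    then have "v \<in> K" by (simp add: K_def)
    then show "v = 0\<^sub>v ?n" using K by simp
  next
    fix w :: "complex vec" assume "w \<in> carrier_vec ?m"
    then have "w \<in> R" using R by simp
    then show "\<exists>v\<in>carrier_vec ?n. T *\<^sub>v v = w" by (auto simp: R_def)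
  qed
qed

lemma schur_not_iso:
  assumes "irrep G \<rho>" "irrep G \<sigma>" "\<not> iso_rep G \<rho> \<sigma>"
    and "T \<in> carrier_mat (rep_dim G \<sigma>) (rep_dim G \<rho>)"
    and "\<And>g. g \<in> carrier G \<Longrightarrow> T * \<rho> g = \<sigma> g * T"
  shows "T = 0\<^sub>m (rep_dim G \<sigma>) (rep_dim G \<rho>)"
  using schur[OF assms(1,2,4,5)] assms irrep_rep unfolding iso_rep_def by metis

text \<open>Over the complex numbers T has an eigenvalue c. Then T - c still commutes with the
  action but kills an eigenvector, so by \<open>schur\<close> it vanishes.\<close>

lemma schur_scalar:
  assumes \<rho>: "irrep G \<rho>" and T: "T \<in> carrier_mat (rep_dim G \<rho>) (rep_dim G \<rho>)"
    and com: "\<And>g. g \<in> carrier G \<Longrightarrow> T * \<rho> g = \<rho> g * T"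
  shows "\<exists>c. T = c \<cdot>\<^sub>m 1\<^sub>m (rep_dim G \<rho>)"
proof -
  let ?n = "rep_dim G \<rho>"
  note \<rho>c = rep_carrier[OF irrep_rep[OF \<rho>]]
  have "?n > 0" using \<rho> by (simp add: irrep_def)
  then obtain c where "eigenvalue T c"
    using spectrum_non_empty[OF T] by (auto simp: spectrum_def)
  then obtain v where v: "v \<in> carrier_vec ?n" "v \<noteq> 0\<^sub>v ?n" "T *\<^sub>v v = c \<cdot>\<^sub>v v"
    using T by (auto simp: eigenvalue_def eigenvector_def)
  let ?C = "c \<cdot>\<^sub>m 1\<^sub>m ?n"
  have C: "?C \<in> carrier_mat ?n ?n" by simp
  have D: "T - ?C \<in> carrier_mat ?n ?n" using T by auto
  have "(T - ?C) * \<rho> g = \<rho> g * (T - ?C)" if g: "g \<in> carrier G" for g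
    using \<rho>c[OF g] T com[OF g]
    by (simp add: minus_mult_distrib_mat[OF T C] mult_minus_distrib_mat[OF _ T C]
        mult_smult_assoc_mat[of _ ?n ?n _ ?n] mult_smult_distrib[of _ ?n ?n _ ?n])
  moreover have "T - ?C \<notin> carrier (GL ?n)"
  proof
    assume "T - ?C \<in> carrier (GL ?n)"
    then obtain S where S: "S \<in> carrier_mat ?n ?n" "S * (T - ?C) = 1\<^sub>m ?n"
      using GL_carrier_iff by auto
    have "(T - ?C) *\<^sub>v v = T *\<^sub>v v - ?C *\<^sub>v v"
      by (rule minus_mult_distrib_mat_vec) (use T v in auto)
    also have "?C *\<^sub>v v = c \<cdot>\<^sub>v v"
      using v by (intro eq_vecI) auto
    finally have "(T - ?C) *\<^sub>v v = 0\<^sub>v ?n" using v by simp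
    then have "S *\<^sub>v ((T - ?C) *\<^sub>v v) = 0\<^sub>v ?n" using S by auto
    then have "(S * (T - ?C)) *\<^sub>v v = 0\<^sub>v ?n"
      using assoc_mult_mat_vec[OF S(1) D v(1)] by simp
    then show False using S v by simp
  qed
  ultimately have "T - ?C = 0\<^sub>m ?n ?n"
    using schur[OF \<rho> \<rho> D] by blast
  moreover have "T = (T - ?C) + ?C" using T by (intro eq_matI) auto
  ultimately have "T = ?C" by simp
  then show ?thesis by blast
qed

end

section \<open>Orthogonality of characters\<close>

text \<open>Associativity of matrices carries dimension conditions; the one long regrouping needed
  in \<open>average_intertwines\<close> is isolated here.\<close>

lemma assoc_mult_mat_six:
  fixes A :: "complex mat"
  assumes A: "A \<in> carrier_mat m m" and S: "S \<in> carrier_mat m m" and X: "X \<in> carrier_mat m n"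
    and R: "R \<in> carrier_mat n n" and Q: "Q \<in> carrier_mat n n" and U: "U \<in> carrier_mat n n"
  shows "A * S * X * (R * Q) * U = A * (S * X * R) * (Q * U)"
proof -
  have SX: "S * X \<in> carrier_mat m n" and SXR: "S * X * R \<in> carrier_mat m n"
    and RQ: "R * Q \<in> carrier_mat n n" and QU: "Q * U \<in> carrier_mat n n"
    and SXRQ: "S * X * R * Q \<in> carrier_mat m n"
    using assms by auto
  have "A * S * X * (R * Q) * U = A * (S * X * R * Q) * U"
    unfolding assoc_mult_mat[OF A S X] assoc_mult_mat[OF A SX RQ] assoc_mult_mat[OF SX R Q] ..
  also have "\<dots> = A * (S * X * R) * (Q * U)"
    unfolding assoc_mult_mat[OF A SXRQ U] assoc_mult_mat[OF SXR Q U] assoc_mult_mat[OF A SXR QU] ..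
  finally show ?thesis .
qed

definition char_of :: "('g \<Rightarrow> complex mat) \<Rightarrow> 'g \<Rightarrow> complex" where
  "char_of \<rho> g = mat_trace (\<rho> g)"

text \<open>For characters of a finite group the value at the inverse is the complex conjugate, so
  on them this is the usual Hermitian product; as written it is a symmetric bilinear form.\<close>

definition char_ip :: "('g, 'b) monoid_scheme \<Rightarrow> ('g \<Rightarrow> complex) \<Rightarrow> ('g \<Rightarrow> complex) \<Rightarrow> complex" where
  "char_ip G \<chi> \<eta> = (\<Sum>g\<in>carrier G. \<chi> g * \<eta> (inv\<^bsub>G\<^esub> g)) / of_nat (card (carrier G))"

context finite_group
begin

lemma char_iso_rep:
  assumes "iso_rep G \<rho> \<sigma>" "g \<in> carrier G"
  shows "char_of \<rho> g = char_of \<sigma> g"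
proof -
  obtain T where "T \<in> carrier (GL (rep_dim G \<rho>))" "T * \<rho> g = \<sigma> g * T"
    and "representation G \<rho>" "representation G \<sigma>" "rep_dim G \<rho> = rep_dim G \<sigma>"
    using assms by (auto simp: iso_rep_def)
  then show ?thesis
    unfolding char_of_def using rep_carrier[OF _ assms(2)] trace_similar by metis
qed

lemma char_ip_cong:
  assumes "\<And>g. g \<in> carrier G \<Longrightarrow> \<chi> g = \<chi>' g" "\<And>g. g \<in> carrier G \<Longrightarrow> \<eta> g = \<eta>' g"
  shows "char_ip G \<chi> \<eta> = char_ip G \<chi>' \<eta>'"
  unfolding char_ip_def using assms by simp

lemma char_ip_add_right:
  "char_ip G \<chi> (\<lambda>g. \<eta> g + \<eta>' g) = char_ip G \<chi> \<eta> + char_ip G \<chi> \<eta>'"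
  by (simp add: char_ip_def sum.distrib distrib_left add_divide_distrib)

lemma inv_bij: "bij_betw (m_inv G) (carrier G) (carrier G)"
  by (rule bij_betwI[where g = "m_inv G"]) auto

lemma char_ip_commute: "char_ip G \<chi> \<eta> = char_ip G \<eta> \<chi>"
proof -
  have "(\<Sum>g\<in>carrier G. \<chi> g * \<eta> (inv g)) = (\<Sum>g\<in>carrier G. \<chi> (inv g) * \<eta> (inv (inv g)))"
    by (rule sum.reindex_bij_betw[OF inv_bij, symmetric])
  also have "\<dots> = (\<Sum>g\<in>carrier G. \<eta> g * \<chi> (inv g))"
    by (intro sum.cong) auto
  finally show ?thesis by (simp add: char_ip_def)
qed

lemma left_mult_bij: "g \<in> carrier G \<Longrightarrow> bij_betw (\<lambda>h. g \<otimes> h) (carrier G) (carrier G)"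
  by (rule bij_betwI[where g = "\<lambda>h. inv g \<otimes> h"]) (auto simp: m_assoc[symmetric])

text \<open>Translating the summation variable from h to g h moves \<sigma>(g) out on the left and
  cancels \<rho>(g) on the right.\<close>

lemma average_intertwines:
  assumes \<rho>: "representation G \<rho>" and \<sigma>: "representation G \<sigma>"
    and X: "X \<in> carrier_mat (rep_dim G \<sigma>) (rep_dim G \<rho>)" and g: "g \<in> carrier G"
  defines "T \<equiv> msum (rep_dim G \<sigma>) (rep_dim G \<rho>) (carrier G) (\<lambda>h. \<sigma> h * X * \<rho> (inv h))"
  shows "T * \<rho> g = \<sigma> g * T"
proof -
  let ?n = "rep_dim G \<rho>" and ?m = "rep_dim G \<sigma>"
  note \<rho>c = rep_carrier[OF \<rho>] and \<sigma>c = rep_carrier[OF \<sigma>]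
  have F: "\<sigma> h * X * \<rho> (inv h) \<in> carrier_mat ?m ?n" if "h \<in> carrier G" for h
    using \<rho>c[of "inv h"] \<sigma>c[of h] X that by auto
  let ?F = "\<lambda>h. \<sigma> h * X * \<rho> (inv h) * \<rho> g"
  have "T * \<rho> g = msum ?m ?n (carrier G) ?F"
    unfolding T_def by (rule msum_mult[OF \<rho>c[OF g] F])
  also have "\<dots> = msum ?m ?n (carrier G) (\<lambda>h. ?F (g \<otimes> h))"
    by (rule msum_reindex[OF left_mult_bij[OF g], symmetric])
  also have "\<dots> = msum ?m ?n (carrier G) (\<lambda>h. \<sigma> g * (\<sigma> h * X * \<rho> (inv h)))"
  proof (rule msum_cong)
    fix h assume h: "h \<in> carrier G"
    have "?F (g \<otimes> h) = \<sigma> g * \<sigma> h * X * (\<rho> (inv h) * \<rho> (inv g)) * \<rho> g"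
      using g h rep_mult[OF \<rho>] rep_mult[OF \<sigma>] by (simp add: inv_mult_group)
    also have "\<dots> = \<sigma> g * (\<sigma> h * X * \<rho> (inv h)) * (\<rho> (inv g) * \<rho> g)"
      using g h \<rho>c \<sigma>c X by (intro assoc_mult_mat_six) auto
    also have "\<dots> = \<sigma> g * (\<sigma> h * X * \<rho> (inv h))"
      using F[OF h] \<sigma>c[OF g] rep_inv_mult[OF \<rho> g] by (simp add: right_mult_one_mat[of _ ?m ?n])
    finally show "?F (g \<otimes> h) = \<sigma> g * (\<sigma> h * X * \<rho> (inv h))" .
  qed
  also have "\<dots> = \<sigma> g * T"
    unfolding T_def by (rule mult_msum[OF \<sigma>c[OF g] F, symmetric])
  finally show ?thesis .
qed

text \<open>A product of two traces is the double sum of \<sigma>_ii \<rho>_jj, and each such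
  product is the (i, j) entry of \<sigma> E_ij \<rho>. The unnormalised inner product is thereby
  expressed through intertwiners, to which Schur's lemma applies.\<close>

lemma char_sum_average:
  assumes \<rho>: "representation G \<rho>" and \<sigma>: "representation G \<sigma>"
  shows "(\<Sum>h\<in>carrier G. char_of \<sigma> h * char_of \<rho> (inv h)) =
    (\<Sum>i<rep_dim G \<sigma>. \<Sum>j<rep_dim G \<rho>.
      msum (rep_dim G \<sigma>) (rep_dim G \<rho>) (carrier G)
        (\<lambda>h. \<sigma> h * elem_mat (rep_dim G \<sigma>) (rep_dim G \<rho>) i j * \<rho> (inv h)) $$ (i, j))"
proof -
  let ?n = "rep_dim G \<rho>" and ?m = "rep_dim G \<sigma>"
  note \<rho>c = rep_carrier[OF \<rho>] and \<sigma>c = rep_carrier[OF \<sigma>]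
  have "(\<Sum>h\<in>carrier G. char_of \<sigma> h * char_of \<rho> (inv h)) =
      (\<Sum>h\<in>carrier G. \<Sum>i<?m. \<Sum>j<?n. \<sigma> h $$ (i, i) * \<rho> (inv h) $$ (j, j))"
    using carrier_matD(1)[OF \<rho>c] carrier_matD(1)[OF \<sigma>c]
    by (intro sum.cong) (auto simp: char_of_def mat_trace_def sum_product)
  also have "\<dots> = (\<Sum>i<?m. \<Sum>h\<in>carrier G. \<Sum>j<?n. \<sigma> h $$ (i, i) * \<rho> (inv h) $$ (j, j))"
    by (rule sum.swap)
  also have "\<dots> = (\<Sum>i<?m. \<Sum>j<?n. \<Sum>h\<in>carrier G. \<sigma> h $$ (i, i) * \<rho> (inv h) $$ (j, j))"
    by (intro sum.cong refl sum.swap)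
  also have "\<dots> = (\<Sum>i<?m. \<Sum>j<?n. \<Sum>h\<in>carrier G. (\<sigma> h * elem_mat ?m ?n i j * \<rho> (inv h)) $$ (i, j))"
    using \<rho>c \<sigma>c by (intro sum.cong refl mult_elem_mat_mult[symmetric]) auto
  finally show ?thesis by (simp add: msum_index)
qed

text \<open>Let n be the dimension and N the group order. By Schur each average T i j is a scalar c,
  whose trace is n c on one side and N tr(E_ij) on the other. Only i = j survives, and the n
  diagonal terms N / n add up to N.\<close>

lemma char_orthogonal_self:
  assumes \<rho>: "irrep G \<rho>"
  shows "char_ip G (char_of \<rho>) (char_of \<rho>) = 1"
proof -
  let ?n = "rep_dim G \<rho>" and ?N = "of_nat (card (carrier G)) :: complex"
  note rep = irrep_rep[OF \<rho>]
  note \<rho>c = rep_carrier[OF rep]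
  define T where "T i j = msum ?n ?n (carrier G) (\<lambda>h. \<rho> h * elem_mat ?n ?n i j * \<rho> (inv h))" for i j
  have n: "?n > 0" using \<rho> by (simp add: irrep_def)
  have T: "T i j $$ (i, j) = (if i = j then ?N / of_nat ?n else 0)" if ij: "i < ?n" "j < ?n" for i j
  proof -
    have "\<exists>c. T i j = c \<cdot>\<^sub>m 1\<^sub>m ?n"
      unfolding T_def
      by (rule schur_scalar[OF \<rho>]) (simp_all add: average_intertwines rep)
    then obtain c where c: "T i j = c \<cdot>\<^sub>m 1\<^sub>m ?n" by blast
    have "of_nat ?n * c = mat_trace (T i j)"
      by (simp add: c mat_trace_def)
    also have "\<dots> = (\<Sum>h\<in>carrier G. mat_trace (\<rho> h * elem_mat ?n ?n i j * \<rho> (inv h)))"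
      unfolding T_def by (rule trace_msum) (use \<rho>c in \<open>auto intro!: mult_carrier_mat[of _ ?n ?n]\<close>)
    also have "\<dots> = (\<Sum>h\<in>carrier G. if i = j then 1 else 0)"
    proof (rule sum.cong[OF refl])
      fix h assume h: "h \<in> carrier G"
      let ?E = "elem_mat ?n ?n i j"
      have c: "\<rho> h \<in> carrier_mat ?n ?n" "\<rho> (inv h) \<in> carrier_mat ?n ?n" using \<rho>c h by auto
      \<comment> \<open>Cyclicity of the trace brings \<rho>(h^{-1}) next to \<rho>(h), leaving the
        trace of the matrix unit.\<close>
      have "mat_trace (\<rho> h * ?E * \<rho> (inv h)) = mat_trace (\<rho> (inv h) * (\<rho> h * ?E))"
        by (rule trace_comm[of _ ?n ?n]) (use c in auto)
      also have "\<rho> (inv h) * (\<rho> h * ?E) = ?E"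
        using c rep_inv_mult[OF rep h] left_mult_one_mat[OF elem_mat_carrier]
        by (simp flip: assoc_mult_mat[of _ ?n ?n _ ?n _ ?n])
      also have "mat_trace ?E = (\<Sum>p<?n. if p = i then (if i = j then 1 else 0) else 0)"
        unfolding mat_trace_def by (intro sum.cong) (auto simp: elem_mat_def)
      also have "\<dots> = (if i = j then 1 else 0)" using ij by simp
      finally show "mat_trace (\<rho> h * ?E * \<rho> (inv h)) = (if i = j then 1 else 0)" .
    qed
    finally have "of_nat ?n * c = (if i = j then ?N else 0)" by simp
    then have "c = (if i = j then ?N / of_nat ?n else 0)"
      using n by (auto simp: field_simps split: if_splits)
    then show ?thesis using ij by (simp add: c)
  qed
  have "(\<Sum>h\<in>carrier G. char_of \<rho> h * char_of \<rho> (inv h)) = (\<Sum>i<?n. \<Sum>j<?n. T i j $$ (i, j))"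
    unfolding T_def by (rule char_sum_average[OF rep rep])
  also have "\<dots> = (\<Sum>i<?n. \<Sum>j<?n. if i = j then ?N / of_nat ?n else 0)"
    by (intro sum.cong) (auto simp: T)
  also have "\<dots> = ?N" using n by simp
  finally show ?thesis by (simp add: char_ip_def)
qed

lemma char_orthogonal:
  assumes \<rho>: "irrep G \<rho>" and \<sigma>: "irrep G \<sigma>"
  shows "char_ip G (char_of \<rho>) (char_of \<sigma>) = (if iso_rep G \<rho> \<sigma> then 1 else 0)"
proof (cases "iso_rep G \<rho> \<sigma>")
  case True
  have "char_ip G (char_of \<rho>) (char_of \<sigma>) = char_ip G (char_of \<rho>) (char_of \<rho>)"
    by (rule char_ip_cong) (auto simp: char_iso_rep[OF True])
  then show ?thesis using True char_orthogonal_self[OF \<rho>] by simp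
next
  case False
  note reps = irrep_rep[OF \<rho>] irrep_rep[OF \<sigma>]
  have "(\<Sum>h\<in>carrier G. char_of \<sigma> h * char_of \<rho> (inv h)) = 0"
    unfolding char_sum_average[OF reps]
    by (intro sum.neutral ballI, subst schur_not_iso[OF \<rho> \<sigma> False])
      (auto simp: average_intertwines reps)
  then have "char_ip G (char_of \<sigma>) (char_of \<rho>) = 0" by (simp add: char_ip_def)
  then show ?thesis using False char_ip_commute by metis
qed

end

section \<open>Maschke's theorem\<close>

text \<open>A maximal independent subset A of W is enlarged to a maximal independent set of the
  whole space; its vectors, those of A first, are the columns of T, and r = |A|. In these
  coordinates the vectors of W vanish from position r on. The last clause ensures r < n for a proper
  W.\<close>

lemma adapted_basis:
  assumes sub: "VectorSpace.subspace class_ring W (module_vec TYPE(complex) n)"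
  shows "\<exists>T r. T \<in> carrier (GL n) \<and> r \<le> n \<and> (\<forall>j<r. col T j \<in> W) \<and>
    (\<forall>w\<in>W. \<exists>v\<in>carrier_vec n. (\<forall>i. r \<le> i \<and> i < n \<longrightarrow> v $ i = 0) \<and> w = T *\<^sub>v v) \<and>
    (r = n \<longrightarrow> W = carrier_vec n)"
proof -
  interpret vec_space "TYPE(complex)" n .
  note W = subspaceD[OF sub]
  have fd: "finite S \<and> card S \<le> n" if "S \<subseteq> carrier_vec n" "lin_indpt S" for S
    using that fin_dim_li_fin[OF fin_dim that(2)] li_le_dim[OF fin_dim _ that(2)] dim_is_n by simp
  have "lin_indpt {}" by (auto simp: lin_dep_def)
  then obtain A where A: "finite A" "maximal A (\<lambda>S. S \<subseteq> W \<and> lin_indpt S)"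
    using maximal_exists[of "\<lambda>S. S \<subseteq> W \<and> lin_indpt S" n "{}"] fd W(1) by blast
  have AW: "A \<subseteq> W" "lin_indpt A" and Amax: "\<And>S. A \<subseteq> S \<Longrightarrow> S \<subseteq> W \<Longrightarrow> lin_indpt S \<Longrightarrow> S = A"
    using A(2) by (auto simp: maximal_def)
  have Ac: "A \<subseteq> carrier_vec n" using AW W by auto
  obtain B where B: "finite B" "maximal B (\<lambda>S. A \<subseteq> S \<and> S \<subseteq> carrier_vec n \<and> lin_indpt S)"
    using maximal_exists[of "\<lambda>S. A \<subseteq> S \<and> S \<subseteq> carrier_vec n \<and> lin_indpt S" n A] fd AW Ac by blast
  have AB: "A \<subseteq> B" and Bc: "B \<subseteq> carrier_vec n" "lin_indpt B"
    using B(2) by (auto simp: maximal_def)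
  \<comment> \<open>Every superset of B contains A, so maximality among the independent sets
    containing A is maximality among all of them.\<close>
  have "maximal B (\<lambda>S. S \<subseteq> carrier_vec n \<and> lin_indpt S)"
  proof -
    have "S = B" if "B \<subseteq> S" "S \<subseteq> carrier_vec n" "lin_indpt S" for S
      using B(2)[unfolded maximal_def] that AB order_trans[OF AB that(1)] by (elim conjE allE[of _ S] impE) simp_all
    then show ?thesis using Bc by (simp add: maximal_def)
  qed
  then have basisB: "basis B" by (rule max_li_is_basis)
  then have cB: "card B = n" using dim_basis[OF B(1)] dim_is_n by simp
  have spanB: "span B = carrier_vec n" using basisB by (simp add: basis_def)
  have spanA: "w \<in> span A" if w: "w \<in> W" for w
  proof (rule ccontr)
    assume nw: "w \<notin> span A"
    then have "w \<notin> A" using in_own_span[of A] Ac by auto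
    then have "lin_indpt (A \<union> {w})"
      using lin_dep_iff_in_span[of A w] nw Ac AW W(1) w by auto
    then have "A \<union> {w} = A" using Amax[of "A \<union> {w}"] AW w by auto
    then show False using \<open>w \<notin> A\<close> by auto
  qed
  obtain xs ys where xs: "set xs = A" "distinct xs" and ys: "set ys = B - A" "distinct ys"
    using finite_distinct_list[OF A(1)] finite_distinct_list[of "B - A"] B(1) by auto
  define zs where "zs = xs @ ys"
  have zs: "set zs = B" "distinct zs" using xs ys AB by (auto simp: zs_def)
  then have lzs: "length zs = n" using cB distinct_card by metis
  define T where "T = mat_of_cols n zs"
  have Tc: "T \<in> carrier_mat n n" using lzs by (simp add: T_def carrier_matI)
  have colsT: "cols T = zs" using zs Bc by (simp add: T_def)
  have colT: "col T i = zs ! i" if "i < n" for i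
    using that zs Bc lzs unfolding T_def by (intro col_mat_of_cols) (auto simp: subset_iff)
  have "rank T = n" by (rule lin_indpt_full_rank[OF Tc]) (simp_all add: colsT zs Bc)
  then have "det T \<noteq> 0" using det_rank_iff[OF Tc] by simp
  then have "T \<in> carrier (GL n)"
    using det_non_zero_imp_unit[OF Tc] by (simp add: GL_def units_of_def)
  moreover have "card A \<le> n" using card_mono[OF B(1) AB] cB by simp
  moreover have "col T j \<in> W" if j: "j < card A" for j
  proof -
    have "j < length xs" using j xs distinct_card by metis
    then have "zs ! j \<in> A" using xs by (auto simp: zs_def nth_append)
    then show ?thesis using colT[of j] j \<open>card A \<le> n\<close> AW by auto
  qed
  moreover have "\<exists>v \<in> carrier_vec n. (\<forall>i. card A \<le> i \<and> i < n \<longrightarrow> v $ i = 0) \<and> w = T *\<^sub>v v"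
    if w: "w \<in> W" for w
  proof -
    obtain a where a: "w = lincomb a A"
      using finite_span[OF A(1) Ac] spanA[OF w] by auto
    \<comment> \<open>Coefficients on A are extended by zero to B; this is what makes the
      coordinates from r on vanish.\<close>
    define b where "b x = (if x \<in> A then a x else 0)" for x
    have "w = lincomb b B"
    proof (rule eq_vecI)
      fix i assume "i < dim_vec (lincomb b B)"
      then have i: "i < n" using lincomb_dim[OF B(1) Bc(1)] by simp
      have "(\<Sum>x\<in>B. b x * x $ i) = (\<Sum>x\<in>A. a x * x $ i)"
        by (rule sum.mono_neutral_cong_right) (use B AB in \<open>auto simp: b_def\<close>)
      then show "w $ i = lincomb b B $ i"
        using lincomb_index[OF i Ac] lincomb_index[OF i Bc(1)] by (simp add: a)
    qed (use lincomb_dim[OF B(1) Bc(1)] lincomb_dim[OF A(1) Ac] a in auto)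
    also have "\<dots> = T *\<^sub>v vec n (\<lambda>i. b (col T i))"
      using mat_mult_eq_lincomb[OF Tc, of b] colsT zs by simp
    finally have "w = T *\<^sub>v vec n (\<lambda>i. b (col T i))" .
    moreover have "b (col T i) = 0" if i: "card A \<le> i" "i < n" for i
    proof -
      have "length xs \<le> i" using i xs distinct_card by metis
      then have "zs ! i \<in> set ys" using i lzs by (auto simp: zs_def nth_append)
      then show ?thesis using ys i colT[of i] by (auto simp: b_def)
    qed
    ultimately show ?thesis by (intro bexI[of _ "vec n (\<lambda>i. b (col T i))"]) auto
  qed
  moreover have "W = carrier_vec n" if "card A = n"
  proof -
    have "A = B" using card_subset_eq[OF B(1) AB] cB that by simp
    moreover have "span A \<subseteq> W"
      using span_is_subset[OF AW(1)] sub by (auto simp: VectorSpace.subspace_def)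
    ultimately show ?thesis using spanB W(1) by auto
  qed
  ultimately show ?thesis by blast
qed

lemma msum_add:
  "msum m n S (\<lambda>h. F h + F' h) = msum m n S F + msum m n S F'" if
  "\<And>h. h \<in> S \<Longrightarrow> F h \<in> carrier_mat m n" "\<And>h. h \<in> S \<Longrightarrow> F' h \<in> carrier_mat m n"
proof (rule eq_matI)
  fix i j assume "i < dim_row (msum m n S F + msum m n S F')" "j < dim_col (msum m n S F + msum m n S F')"
  then have "i < m" "j < n" by (auto simp: msum_def)
  moreover have "(F h + F' h) $$ (i, j) = F h $$ (i, j) + F' h $$ (i, j)" if "h \<in> S" for h
    using that \<open>i < m\<close> \<open>j < n\<close> \<open>\<And>h. h \<in> S \<Longrightarrow> F' h \<in> carrier_mat m n\<close>[OF that] by auto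
  ultimately show "msum m n S (\<lambda>h. F h + F' h) $$ (i, j) = (msum m n S F + msum m n S F') $$ (i, j)"
    by (simp add: msum_def sum.distrib)
qed (simp_all add: msum_def)

lemma msum_const:
  "A \<in> carrier_mat m n \<Longrightarrow> msum m n S (\<lambda>_. A) = of_nat (card S) \<cdot>\<^sub>m A"
  by (rule eq_matI) (auto simp: msum_def)

section \<open>Block matrices and change of basis\<close>

lemma four_block_mat_inj:
  assumes eq: "four_block_mat A B C D = four_block_mat A' B' C' D'"
    and c: "A \<in> carrier_mat r r'" "A' \<in> carrier_mat r r'" "B \<in> carrier_mat r s'" "B' \<in> carrier_mat r s'"
      "C \<in> carrier_mat s r'" "C' \<in> carrier_mat s r'" "D \<in> carrier_mat s s'" "D' \<in> carrier_mat s s'"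
  shows "A = A'" "B = B'" "C = C'" "D = D'"
proof -
  note e = arg_cong[OF eq, of "\<lambda>M. M $$ (_, _)"]
  show "A = A'"
  proof (rule eq_matI)
    fix i j assume "i < dim_row A'" "j < dim_col A'"
    then show "A $$ (i, j) = A' $$ (i, j)" using e[of i j] c by auto
  qed (use c in auto)
  show "B = B'"
  proof (rule eq_matI)
    fix i j assume "i < dim_row B'" "j < dim_col B'"
    then show "B $$ (i, j) = B' $$ (i, j)" using e[of i "r' + j"] c by auto
  qed (use c in auto)
  show "C = C'"
  proof (rule eq_matI)
    fix i j assume "i < dim_row C'" "j < dim_col C'"
    then show "C $$ (i, j) = C' $$ (i, j)" using e[of "r + i" j] c by auto
  qed (use c in auto)
  show "D = D'"
  proof (rule eq_matI)
    fix i j assume "i < dim_row D'" "j < dim_col D'"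
    then show "D $$ (i, j) = D' $$ (i, j)" using e[of "r + i" "r' + j"] c by auto
  qed (use c in auto)
qed

lemma GL_mult: "S \<in> carrier (GL n) \<Longrightarrow> T \<in> carrier (GL n) \<Longrightarrow> S * T \<in> carrier (GL n)"
  using group.is_monoid[OF group_GL] monoid.m_closed mult_GL by metis

lemma GL_upper_unitriangular:
  assumes C: "C \<in> carrier_mat r s"
  shows "four_block_mat (1\<^sub>m r) C (0\<^sub>m s r) (1\<^sub>m s) \<in> carrier (GL (r + s))"
proof -
  let ?U = "\<lambda>C. four_block_mat (1\<^sub>m r) C (0\<^sub>m s r) (1\<^sub>m s) :: complex mat"
  have *: "?U X * ?U Y = ?U (Y + X)" if "X \<in> carrier_mat r s" "Y \<in> carrier_mat r s" for X Y
    using that by (subst mult_four_block_mat[of _ r r _ s _ s _ _ r _ s]) auto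
  have "C + - C = 0\<^sub>m r s" "- C + C = 0\<^sub>m r s" using C by (auto intro!: eq_matI)
  then show ?thesis
    unfolding GL_carrier_iff using *[of C "- C"] *[of "- C" C] C
    by (intro conjI bexI[of _ "?U (- C)"]) auto
qed

lemma GL_block_diag:
  assumes A: "A \<in> carrier (GL r)" and D: "D \<in> carrier (GL s)"
  shows "four_block_mat A (0\<^sub>m r s) (0\<^sub>m s r) D \<in> carrier (GL (r + s))"
proof -
  obtain A' where A': "A \<in> carrier_mat r r" "A' \<in> carrier_mat r r" "A * A' = 1\<^sub>m r" "A' * A = 1\<^sub>m r"
    using A GL_carrier_iff by auto
  obtain D' where D': "D \<in> carrier_mat s s" "D' \<in> carrier_mat s s" "D * D' = 1\<^sub>m s" "D' * D = 1\<^sub>m s"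
    using D GL_carrier_iff by auto
  have *: "four_block_mat X (0\<^sub>m r s) (0\<^sub>m s r) Y * four_block_mat X' (0\<^sub>m r s) (0\<^sub>m s r) Y' =
      four_block_mat (X * X') (0\<^sub>m r s) (0\<^sub>m s r) (Y * Y')"
    if "X \<in> carrier_mat r r" "X' \<in> carrier_mat r r" "Y \<in> carrier_mat s s" "Y' \<in> carrier_mat s s"
    for X X' Y Y' :: "complex mat"
    using that by (subst mult_four_block_mat[of _ r r _ s _ s _ _ r _ s]) auto
  show ?thesis
    unfolding GL_carrier_iff using * A' D'
    by (intro conjI bexI[of _ "four_block_mat A' (0\<^sub>m r s) (0\<^sub>m s r) D'"]) auto
qed

text \<open>The zero blocks read their size off the diagonal ones, as in the recursion of
  \<open>diag_block_mat\<close>, so that a direct sum unfolds to this form.\<close>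

abbreviation block_diag :: "complex mat \<Rightarrow> complex mat \<Rightarrow> complex mat" where
  "block_diag A D \<equiv> four_block_mat A (0\<^sub>m (dim_row A) (dim_col D)) (0\<^sub>m (dim_row D) (dim_col A)) D"

lemma mult_block_diag:
  assumes "A \<in> carrier_mat r r" "A' \<in> carrier_mat r r" "D \<in> carrier_mat s s" "D' \<in> carrier_mat s s"
  shows "block_diag A D * block_diag A' D' = block_diag (A * A') (D * D')"
  using assms by (subst mult_four_block_mat[of _ r r _ s _ s _ _ r _ s]) auto

context finite_group
begin

lemma rep_onI_group: "rep_on G d \<rho> \<Longrightarrow> representation G \<rho>" "rep_on G d \<rho> \<Longrightarrow> rep_dim G \<rho> = d"
  by (simp_all add: rep_on_representation rep_on_dim)

lemma iso_rep_trans: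
  assumes 1: "iso_rep G \<rho> \<sigma>" and 2: "iso_rep G \<sigma> \<tau>"
  shows "iso_rep G \<rho> \<tau>"
proof -
  let ?d = "rep_dim G \<rho>"
  obtain T where T: "T \<in> carrier (GL ?d)" "\<And>g. g \<in> carrier G \<Longrightarrow> T * \<rho> g = \<sigma> g * T"
    using 1 by (auto simp: iso_rep_def)
  obtain S where S: "S \<in> carrier (GL ?d)" "\<And>g. g \<in> carrier G \<Longrightarrow> S * \<sigma> g = \<tau> g * S"
    using 1 2 by (auto simp: iso_rep_def)
  have reps: "representation G \<rho>" "representation G \<sigma>" "representation G \<tau>"
    "rep_dim G \<sigma> = ?d" "rep_dim G \<tau> = ?d"
    using 1 2 by (auto simp: iso_rep_def)
  have c: "S \<in> carrier_mat ?d ?d" "T \<in> carrier_mat ?d ?d" using S T GL_carrier_iff by auto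
  have "S * T * \<rho> g = \<tau> g * (S * T)" if g: "g \<in> carrier G" for g
  proof -
    have \<rho>: "\<rho> g \<in> carrier_mat ?d ?d" and \<sigma>: "\<sigma> g \<in> carrier_mat ?d ?d" and \<tau>: "\<tau> g \<in> carrier_mat ?d ?d"
      using rep_carrier[OF reps(1) g] rep_carrier[OF reps(2) g] rep_carrier[OF reps(3) g] reps by auto
    have "S * T * \<rho> g = S * (T * \<rho> g)" by (rule assoc_mult_mat[OF c \<rho>])
    also have "\<dots> = S * \<sigma> g * T"
      unfolding T(2)[OF g] by (rule assoc_mult_mat[OF c(1) \<sigma> c(2), symmetric])
    also have "\<dots> = \<tau> g * (S * T)"
      unfolding S(2)[OF g] by (rule assoc_mult_mat[OF \<tau> c])
    finally show ?thesis .
  qed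
  then show ?thesis using GL_mult[OF S(1) T(1)] reps by (auto simp: iso_rep_def)
qed

lemma rep_on_block_diag:
  assumes "rep_on G r \<alpha>" "rep_on G s \<delta>"
  shows "rep_on G (r + s) (\<lambda>g. block_diag (\<alpha> g) (\<delta> g))"
  unfolding rep_on_def
proof (intro conjI ballI)
  note \<alpha> = assms(1)[unfolded rep_on_def] and \<delta> = assms(2)[unfolded rep_on_def]
  fix g h assume g: "g \<in> carrier G" and h: "h \<in> carrier G"
  then have "\<alpha> g \<in> carrier_mat r r" "\<alpha> h \<in> carrier_mat r r" "\<delta> g \<in> carrier_mat s s" "\<delta> h \<in> carrier_mat s s"
    using \<alpha> \<delta> by auto
  from mult_block_diag[OF this]
  show "block_diag (\<alpha> (g \<otimes> h)) (\<delta> (g \<otimes> h)) = block_diag (\<alpha> g) (\<delta> g) * block_diag (\<alpha> h) (\<delta> h)"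
    using \<alpha> \<delta> g h by simp
qed (use assms in \<open>auto simp: rep_on_def\<close>)

lemma iso_rep_block_diag:
  assumes 1: "iso_rep G \<alpha> \<alpha>'" and 2: "iso_rep G \<delta> \<delta>'"
  shows "iso_rep G (\<lambda>g. block_diag (\<alpha> g) (\<delta> g)) (\<lambda>g. block_diag (\<alpha>' g) (\<delta>' g))"
proof -
  let ?r = "rep_dim G \<alpha>" and ?s = "rep_dim G \<delta>"
  have reps: "rep_on G ?r \<alpha>" "rep_on G ?r \<alpha>'" "rep_on G ?s \<delta>" "rep_on G ?s \<delta>'"
    using 1 2 rep_on by (auto simp: iso_rep_def) metis+
  obtain T where T: "T \<in> carrier (GL ?r)" "\<And>g. g \<in> carrier G \<Longrightarrow> T * \<alpha> g = \<alpha>' g * T"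
    using 1 by (auto simp: iso_rep_def)
  obtain S where S: "S \<in> carrier (GL ?s)" "\<And>g. g \<in> carrier G \<Longrightarrow> S * \<delta> g = \<delta>' g * S"
    using 2 by (auto simp: iso_rep_def)
  have c: "T \<in> carrier_mat ?r ?r" "S \<in> carrier_mat ?s ?s" using S T GL_carrier_iff by auto
  note dims = rep_onI_group[OF rep_on_block_diag[OF reps(1,3)]] rep_onI_group[OF rep_on_block_diag[OF reps(2,4)]]
  have "block_diag T S * block_diag (\<alpha> g) (\<delta> g) = block_diag (\<alpha>' g) (\<delta>' g) * block_diag T S"
    if g: "g \<in> carrier G" for g
  proof -
    have c': "\<alpha> g \<in> carrier_mat ?r ?r" "\<alpha>' g \<in> carrier_mat ?r ?r"
      "\<delta> g \<in> carrier_mat ?s ?s" "\<delta>' g \<in> carrier_mat ?s ?s"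
      using reps g by (auto simp: rep_on_def)
    show ?thesis
      unfolding mult_block_diag[OF c(1) c'(1) c(2) c'(3)] mult_block_diag[OF c'(2) c(1) c'(4) c(2)]
        T(2)[OF g] S(2)[OF g] ..
  qed
  moreover have "block_diag T S \<in> carrier (GL (?r + ?s))"
    using GL_block_diag[OF T(1) S(1)] c by simp
  ultimately show ?thesis using dims by (auto simp: iso_rep_def)
qed

text \<open>The new family is tied to the old one by T \<rho>' = \<rho> T rather than by a formula
  with the inverse of T, and its multiplicativity follows by cancelling T on the left.\<close>

lemma conj_rep:
  assumes \<rho>: "rep_on G n \<rho>" and T: "T \<in> carrier (GL n)"
    and com: "\<And>g. g \<in> carrier G \<Longrightarrow> \<rho>' g \<in> carrier_mat n n \<and> T * \<rho>' g = \<rho> g * T"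
  shows "rep_on G n \<rho>'" "iso_rep G \<rho> \<rho>'"
proof -
  obtain S where S: "S \<in> carrier_mat n n" "T * S = 1\<^sub>m n" "S * T = 1\<^sub>m n" and Tc: "T \<in> carrier_mat n n"
    using T GL_carrier_iff by auto
  have canc: "A = B" if A: "A \<in> carrier_mat n n" and B: "B \<in> carrier_mat n n" and "T * A = T * B" for A B
  proof -
    have "S * T * A = S * T * B"
      unfolding assoc_mult_mat[OF S(1) Tc A] assoc_mult_mat[OF S(1) Tc B] using that by simp
    then show ?thesis using S(3) A B by simp
  qed
  have mult: "\<rho>' (g \<otimes> h) = \<rho>' g * \<rho>' h" if g: "g \<in> carrier G" and h: "h \<in> carrier G" for g h
  proof (rule canc)
    have c: "\<rho> g \<in> carrier_mat n n" "\<rho> h \<in> carrier_mat n n" using \<rho> g h by (auto simp: rep_on_def)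
    note c' = com[OF g, THEN conjunct1] com[OF h, THEN conjunct1]
    show "\<rho>' (g \<otimes> h) \<in> carrier_mat n n" using com g h by auto
    show "\<rho>' g * \<rho>' h \<in> carrier_mat n n" using c' by auto
    have "T * (\<rho>' g * \<rho>' h) = \<rho> g * T * \<rho>' h"
      using com[OF g] by (simp flip: assoc_mult_mat[OF Tc c'])
    also have "\<dots> = \<rho> g * (\<rho> h * T)"
      unfolding assoc_mult_mat[OF c(1) Tc c'(2)] using com[OF h] by simp
    also have "\<dots> = \<rho> (g \<otimes> h) * T"
      using \<rho> g h assoc_mult_mat[OF c Tc] by (simp add: rep_on_def)
    finally show "T * \<rho>' (g \<otimes> h) = T * (\<rho>' g * \<rho>' h)" using com g h by simp
  qed
  have "\<rho>' \<one> = 1\<^sub>m n"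
    by (rule canc) (use com[of \<one>] \<rho> Tc in \<open>auto simp: rep_on_def\<close>)
  then show r: "rep_on G n \<rho>'" using mult com by (auto simp: rep_on_def)
  have "iso_rep G \<rho>' \<rho>"
    using T com rep_onI_group[OF r] rep_onI_group[OF \<rho>] by (auto simp: iso_rep_def)
  then show "iso_rep G \<rho> \<rho>'" by (rule iso_rep_sym)
qed

text \<open>The average of the cocycle \<open>\<beta>(h) \<delta>(h\<^sup>-\<^sup>1)\<close> splits the upper triangular block.\<close>

lemma split_upper_block:
  assumes rep: "rep_on G (r + s) (\<lambda>g. four_block_mat (\<alpha> g) (\<beta> g) (0\<^sub>m s r) (\<delta> g))"
    and c: "\<And>g. g \<in> carrier G \<Longrightarrow> \<alpha> g \<in> carrier_mat r r \<and> \<beta> g \<in> carrier_mat r s \<and> \<delta> g \<in> carrier_mat s s"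
  shows "rep_on G r \<alpha>" "rep_on G s \<delta>"
    "iso_rep G (\<lambda>g. four_block_mat (\<alpha> g) (\<beta> g) (0\<^sub>m s r) (\<delta> g)) (\<lambda>g. block_diag (\<alpha> g) (\<delta> g))"
proof -
  let ?F = "\<lambda>g. four_block_mat (\<alpha> g) (\<beta> g) (0\<^sub>m s r) (\<delta> g)"
  let ?N = "of_nat (card (carrier G)) :: complex"
  \<comment> \<open>Comparison of blocks in \<open>?F (g \<otimes> h) = ?F g * ?F h\<close>: the
    diagonal blocks are multiplicative and the corner obeys a cocycle identity.\<close>
  have mult: "\<alpha> (g \<otimes> h) = \<alpha> g * \<alpha> h \<and> \<beta> (g \<otimes> h) = \<alpha> g * \<beta> h + \<beta> g * \<delta> h \<and> \<delta> (g \<otimes> h) = \<delta> g * \<delta> h"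
    if g: "g \<in> carrier G" and h: "h \<in> carrier G" for g h
  proof -
    note cg = c[OF g] and ch = c[OF h]
    have gh: "g \<otimes> h \<in> carrier G" using g h by simp
    have "?F (g \<otimes> h) = ?F g * ?F h"
      using rep g h by (simp add: rep_on_def)
    also have "\<dots> = four_block_mat (\<alpha> g * \<alpha> h) (\<alpha> g * \<beta> h + \<beta> g * \<delta> h) (0\<^sub>m s r) (\<delta> g * \<delta> h)"
      using cg ch by (subst mult_four_block_mat[of _ r r _ s _ s _ _ r _ s]) auto
    finally have eq: "?F (g \<otimes> h) = \<dots>" .
    show ?thesis
      using four_block_mat_inj[OF eq, of r r s s] c[OF gh] cg ch by auto
  qed
  have "?F \<one> = four_block_mat (1\<^sub>m r) (0\<^sub>m r s) (0\<^sub>m s r) (1\<^sub>m s)"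
    using rep by (simp add: rep_on_def)
  then have one: "\<alpha> \<one> = 1\<^sub>m r \<and> \<delta> \<one> = 1\<^sub>m s"
    using four_block_mat_inj[of "\<alpha> \<one>" "\<beta> \<one>" "0\<^sub>m s r" "\<delta> \<one>" "1\<^sub>m r" "0\<^sub>m r s" "0\<^sub>m s r" "1\<^sub>m s" r r s s]
      c[OF one_closed] by auto
  show \<alpha>: "rep_on G r \<alpha>" and \<delta>: "rep_on G s \<delta>"
    using mult one c by (auto simp: rep_on_def)
  have inv_r: "\<delta> h * \<delta> (inv h) = 1\<^sub>m s" if "h \<in> carrier G" for h
    using mult[of h "inv h"] one that by simp
  define M where "M = msum r s (carrier G) (\<lambda>h. \<beta> h * \<delta> (inv h))"
  have Mc: "M \<in> carrier_mat r s" by (simp add: M_def)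
  \<comment> \<open>Replacing h by g h in the sum and expanding the cocycle gives \<alpha>(g) M and,
    from each of the N terms, one copy of \<beta>(g).\<close>
  have Mg: "M * \<delta> g = \<alpha> g * M + ?N \<cdot>\<^sub>m \<beta> g" if g: "g \<in> carrier G" for g
  proof -
    note cg = c[OF g]
    have Fc: "\<beta> h * \<delta> (inv h) \<in> carrier_mat r s" if "h \<in> carrier G" for h
      using c[OF that] c[of "inv h"] that by auto
    have "M * \<delta> g = msum r s (carrier G) (\<lambda>h. \<beta> h * \<delta> (inv h) * \<delta> g)"
      unfolding M_def by (rule msum_mult) (use cg Fc in auto)
    also have "\<dots> = msum r s (carrier G) (\<lambda>h. \<beta> (g \<otimes> h) * \<delta> (inv (g \<otimes> h)) * \<delta> g)"
      by (rule msum_reindex[OF left_mult_bij[OF g], symmetric])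
    also have "\<dots> = msum r s (carrier G) (\<lambda>h. \<alpha> g * (\<beta> h * \<delta> (inv h)) + \<beta> g)"
    proof (rule msum_cong)
      fix h assume h: "h \<in> carrier G"
      note ch = c[OF h] and ci = c[OF inv_closed[OF h]]
      have gh: "g \<otimes> h \<in> carrier G" using g h by simp
      have cgh: "\<beta> (g \<otimes> h) \<in> carrier_mat r s" "\<delta> (inv (g \<otimes> h)) \<in> carrier_mat s s"
        using c[OF gh] c[OF inv_closed[OF gh]] by auto
      have "\<beta> (g \<otimes> h) * \<delta> (inv (g \<otimes> h)) * \<delta> g = \<beta> (g \<otimes> h) * (\<delta> (inv (g \<otimes> h)) * \<delta> g)"
        by (rule assoc_mult_mat[OF cgh]) (use cg in blast)
      also have "\<delta> (inv (g \<otimes> h)) * \<delta> g = \<delta> (inv h)"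
        using mult[of "inv (g \<otimes> h)" g] g h by (simp add: inv_mult_group m_assoc)
      also have "\<beta> (g \<otimes> h) * \<delta> (inv h) = (\<alpha> g * \<beta> h + \<beta> g * \<delta> h) * \<delta> (inv h)"
        using mult[OF g h] by simp
      also have "\<dots> = \<alpha> g * \<beta> h * \<delta> (inv h) + \<beta> g * \<delta> h * \<delta> (inv h)"
        by (rule add_mult_distrib_mat[of _ r s]) (use cg ch ci in auto)
      also have "\<alpha> g * \<beta> h * \<delta> (inv h) = \<alpha> g * (\<beta> h * \<delta> (inv h))"
        by (rule assoc_mult_mat[of _ r r _ s]) (use cg ch ci in auto)
      also have "\<beta> g * \<delta> h * \<delta> (inv h) = \<beta> g * (\<delta> h * \<delta> (inv h))"
        by (rule assoc_mult_mat[of _ r s _ s]) (use cg ch ci in auto)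
      also have "\<dots> = \<beta> g" using inv_r[OF h] cg by (simp add: right_mult_one_mat[of _ r s])
      finally show "\<beta> (g \<otimes> h) * \<delta> (inv (g \<otimes> h)) * \<delta> g = \<alpha> g * (\<beta> h * \<delta> (inv h)) + \<beta> g" .
    qed
    also have "\<dots> = msum r s (carrier G) (\<lambda>h. \<alpha> g * (\<beta> h * \<delta> (inv h))) + msum r s (carrier G) (\<lambda>_. \<beta> g)"
      by (rule msum_add) (use cg in \<open>simp_all add: mult_carrier_mat[of _ r r, OF _ Fc]\<close>)
    also have "msum r s (carrier G) (\<lambda>h. \<alpha> g * (\<beta> h * \<delta> (inv h))) = \<alpha> g * M"
      unfolding M_def by (rule mult_msum[symmetric]) (use cg Fc in auto)
    also have "msum r s (carrier G) (\<lambda>_. \<beta> g) = ?N \<cdot>\<^sub>m \<beta> g"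
      using cg by (intro msum_const) auto
    finally show ?thesis .
  qed
  \<comment> \<open>Division by the group order is possible in characteristic zero and exhibits the
    corner as the coboundary X \<delta> - \<alpha> X.\<close>
  define X where "X = (1 / ?N) \<cdot>\<^sub>m M"
  have Xc: "X \<in> carrier_mat r s" using Mc by (simp add: X_def)
  have Xg: "X * \<delta> g = \<alpha> g * X + \<beta> g" if g: "g \<in> carrier G" for g
  proof -
    note cg = c[OF g]
    have "X * \<delta> g = (1 / ?N) \<cdot>\<^sub>m (M * \<delta> g)"
      unfolding X_def by (rule mult_smult_assoc_mat[of _ r s _ s]) (use Mc cg in auto)
    also have "\<dots> = (1 / ?N) \<cdot>\<^sub>m (\<alpha> g * M) + \<beta> g"
    proof (rule eq_matI)
      fix i j assume "i < dim_row ((1 / ?N) \<cdot>\<^sub>m (\<alpha> g * M) + \<beta> g)" "j < dim_col ((1 / ?N) \<cdot>\<^sub>m (\<alpha> g * M) + \<beta> g)"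
      moreover have "dim_row (\<beta> g) = r" "dim_col (\<beta> g) = s" "dim_row (\<alpha> g) = r" "dim_col M = s"
        using cg Mc by auto
      ultimately show "((1 / ?N) \<cdot>\<^sub>m (M * \<delta> g)) $$ (i, j) = ((1 / ?N) \<cdot>\<^sub>m (\<alpha> g * M) + \<beta> g) $$ (i, j)"
        unfolding Mg[OF g] by (simp add: distrib_left)
    qed (use Mc cg in auto)
    also have "(1 / ?N) \<cdot>\<^sub>m (\<alpha> g * M) = \<alpha> g * X"
      unfolding X_def by (rule mult_smult_distrib[of _ r r _ s, symmetric]) (use Mc cg in auto)
    finally show ?thesis .
  qed
  \<comment> \<open>The equation for X is precisely the upper right block of the statement that
    \<open>?T\<close> times the block diagonal matrix equals \<open>?F g\<close> times
    \<open>?T\<close>.\<close>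
  let ?T = "four_block_mat (1\<^sub>m r) X (0\<^sub>m s r) (1\<^sub>m s)"
  show "iso_rep G ?F (\<lambda>g. block_diag (\<alpha> g) (\<delta> g))"
  proof (rule conj_rep(2)[OF rep GL_upper_unitriangular[OF Xc]])
    fix g assume g: "g \<in> carrier G"
    have cg: "\<alpha> g \<in> carrier_mat r r" "\<beta> g \<in> carrier_mat r s" "\<delta> g \<in> carrier_mat s s"
      using c[OF g] by auto
    have T: "?T * four_block_mat (\<alpha> g) (0\<^sub>m r s) (0\<^sub>m s r) (\<delta> g) = ?F g * ?T"
      unfolding mult_four_block_mat[OF one_carrier_mat Xc zero_carrier_mat one_carrier_mat
          cg(1) zero_carrier_mat zero_carrier_mat cg(3)]
        mult_four_block_mat[OF cg(1,2) zero_carrier_mat cg(3)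
          one_carrier_mat Xc zero_carrier_mat one_carrier_mat]
      using cg Xc Xg[OF g] by (intro cong_four_block_mat) simp_all
    have "four_block_mat (\<alpha> g) (0\<^sub>m r s) (0\<^sub>m s r) (\<delta> g) \<in> carrier_mat (r + s) (r + s)"
      by (rule four_block_carrier_mat[OF cg(1,3)])
    with T show "block_diag (\<alpha> g) (\<delta> g) \<in> carrier_mat (r + s) (r + s) \<and> ?T * block_diag (\<alpha> g) (\<delta> g) = ?F g * ?T"
      unfolding carrier_matD[OF cg(1)] carrier_matD[OF cg(3)] by (rule conjI[rotated])
  qed
qed

end

lemma sum_lessThan_add: "(\<Sum>i<r + s. f i) = (\<Sum>i<r. f i) + (\<Sum>i<(s::nat). f (r + i) :: complex)"
  by (induction s) (auto simp: add.assoc)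

lemma sum_list_of_nat: "(\<Sum>x\<leftarrow>xs. of_nat (f x)) = (of_nat (\<Sum>x\<leftarrow>xs. f x) :: complex)"
  by (induction xs) auto

lemma trace_block_diag:
  assumes "dim_row A = dim_col A" "dim_row D = dim_col D"
  shows "mat_trace (block_diag A D) = mat_trace A + mat_trace D"
  using assms by (simp add: mat_trace_def sum_lessThan_add)

lemma direct_sum_rep_singleton [simp]: "direct_sum_rep [\<rho>] = \<rho>"
  unfolding direct_sum_rep_def list.map diag_block_mat_singleton ..

context finite_group
begin

text \<open>In a basis adapted to a proper nonzero invariant subspace the lower left block vanishes,
  and \<open>split_upper_block\<close> removes the upper right one. Both diagonal blocks are smaller
  than \<rho>, as the induction in \<open>maschke\<close> requires.\<close>

lemma reducible_split:
  assumes \<rho>: "representation G \<rho>" and pos: "rep_dim G \<rho> > 0" and red: "\<not> irrep G \<rho>"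
  obtains r s \<alpha> \<delta> where "rep_on G r \<alpha>" "rep_on G s \<delta>" "r < rep_dim G \<rho>" "s < rep_dim G \<rho>"
    "iso_rep G \<rho> (\<lambda>g. block_diag (\<alpha> g) (\<delta> g))"
proof -
  let ?n = "rep_dim G \<rho>"
  let ?Q = "\<lambda>W. VectorSpace.subspace class_ring W (module_vec TYPE(complex) ?n) \<and>
      (\<forall>g\<in>carrier G. \<forall>w\<in>W. \<rho> g *\<^sub>v w \<in> W) \<longrightarrow> W = {0\<^sub>v ?n} \<or> W = carrier_vec ?n"
  have "\<not> (\<forall>W. ?Q W)"
  proof
    assume "\<forall>W. ?Q W"
    with \<rho> pos have "irrep G \<rho>" unfolding irrep_def by (intro conjI)
    with red show False ..
  qed
  then obtain W where "\<not> ?Q W" unfolding not_all by (elim exE)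
  then have sub: "VectorSpace.subspace class_ring W (module_vec TYPE(complex) ?n)"
    and inv: "\<And>g w. g \<in> carrier G \<Longrightarrow> w \<in> W \<Longrightarrow> \<rho> g *\<^sub>v w \<in> W"
    and W: "W \<noteq> {0\<^sub>v ?n}" "W \<noteq> carrier_vec ?n"
    by simp_all
  obtain T r where Tr: "T \<in> carrier (GL ?n) \<and> r \<le> ?n \<and> (\<forall>j<r. col T j \<in> W) \<and>
    (\<forall>w\<in>W. \<exists>v\<in>carrier_vec ?n. (\<forall>i. r \<le> i \<and> i < ?n \<longrightarrow> v $ i = 0) \<and> w = T *\<^sub>v v) \<and>
    (r = ?n \<longrightarrow> W = carrier_vec ?n)"
    using adapted_basis[OF sub] by (elim exE)
  then have T: "T \<in> carrier (GL ?n)" and rn: "r \<le> ?n" and col: "\<And>j. j < r \<Longrightarrow> col T j \<in> W"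
    and full: "r = ?n \<Longrightarrow> W = carrier_vec ?n"
    by simp_all
  have span: "\<exists>v\<in>carrier_vec ?n. (\<forall>i. r \<le> i \<and> i < ?n \<longrightarrow> v $ i = 0) \<and> w = T *\<^sub>v v" if "w \<in> W" for w
    using Tr that by simp
  define s where "s = ?n - r"
  obtain S where Tc: "T \<in> carrier_mat ?n ?n" and S: "S \<in> carrier_mat ?n ?n" "T * S = 1\<^sub>m ?n" "S * T = 1\<^sub>m ?n"
    using T GL_carrier_iff by auto
  \<comment> \<open>A proper W gives r < n, hence s > 0, and a nonzero W gives r > 0, hence s <
    n.\<close>
  have "r < ?n" using full W rn by fastforce
  moreover have "r > 0"
  proof (rule ccontr)
    assume "\<not> 0 < r"
    then have "w = 0\<^sub>v ?n" if w: "w \<in> W" for w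
    proof -
      obtain v where v: "v \<in> carrier_vec ?n" "\<forall>i. r \<le> i \<and> i < ?n \<longrightarrow> v $ i = 0" "w = T *\<^sub>v v"
        using span[OF w] by blast
      then have "v = 0\<^sub>v ?n" using \<open>\<not> 0 < r\<close> by (intro eq_vecI) auto
      then show ?thesis using v Tc by auto
    qed
    then show False using W(1) subspaceD(2)[OF sub] by blast
  qed
  ultimately have rs: "r + s = ?n" "r < ?n" "s < ?n" by (auto simp: s_def)
  define \<rho>' where "\<rho>' g = S * (\<rho> g * T)" for g
  have com: "\<rho>' g \<in> carrier_mat ?n ?n \<and> T * \<rho>' g = \<rho> g * T" if g: "g \<in> carrier G" for g
  proof -
    have "\<rho> g * T \<in> carrier_mat ?n ?n" using rep_carrier[OF \<rho> g] Tc by auto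
    then show ?thesis
      using S Tc by (auto simp: \<rho>'_def simp flip: assoc_mult_mat[OF Tc S(1)])
  qed
  note \<rho>' = conj_rep[OF rep_on[OF \<rho>] T com]
  \<comment> \<open>Column j of T lies in W for j < r, hence so does its image under \<rho>(g), and
    vectors of W have no adapted coordinates from r on.\<close>
  have zero: "\<rho>' g $$ (i, j) = 0" if g: "g \<in> carrier G" and ij: "r \<le> i" "i < ?n" "j < r" for g i j
  proof -
    note c = rep_carrier[OF \<rho> g]
    have "\<rho> g *\<^sub>v col T j \<in> W" using inv g col ij by blast
    then obtain v where v: "v \<in> carrier_vec ?n" "\<forall>i. r \<le> i \<and> i < ?n \<longrightarrow> v $ i = 0"
      "\<rho> g *\<^sub>v col T j = T *\<^sub>v v"
      using span by blast
    have "col (\<rho>' g) j = S *\<^sub>v col (\<rho> g * T) j"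
      unfolding \<rho>'_def by (rule col_mult2[OF S(1) mult_carrier_mat[OF c Tc]]) (use ij rs in auto)
    also have "col (\<rho> g * T) j = T *\<^sub>v v"
      using col_mult2[OF c Tc, of j] v ij rs by simp
    also have "S *\<^sub>v (T *\<^sub>v v) = v"
      using S Tc v assoc_mult_mat_vec[OF S(1) Tc v(1)] by simp
    finally have "col (\<rho>' g) j $ i = 0" using v ij by simp
    then show ?thesis using com[OF g] ij rs by auto
  qed
  define \<alpha> where "\<alpha> g = mat r r (\<lambda>(i, j). \<rho>' g $$ (i, j))" for g
  define \<beta> where "\<beta> g = mat r s (\<lambda>(i, j). \<rho>' g $$ (i, r + j))" for g
  define \<delta> where "\<delta> g = mat s s (\<lambda>(i, j). \<rho>' g $$ (r + i, r + j))" for g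
  have c: "\<And>g. \<alpha> g \<in> carrier_mat r r \<and> \<beta> g \<in> carrier_mat r s \<and> \<delta> g \<in> carrier_mat s s"
    by (auto simp: \<alpha>_def \<beta>_def \<delta>_def)
  let ?F = "\<lambda>g. four_block_mat (\<alpha> g) (\<beta> g) (0\<^sub>m s r) (\<delta> g)"
  have F: "?F g = \<rho>' g" if g: "g \<in> carrier G" for g
  proof (rule eq_matI)
    fix i j assume "i < dim_row (\<rho>' g)" "j < dim_col (\<rho>' g)"
    then show "?F g $$ (i, j) = \<rho>' g $$ (i, j)"
      using com[OF g] rs zero[OF g, of i j] by (auto simp: \<alpha>_def \<beta>_def \<delta>_def)
  qed (use com[OF g] rs in \<open>auto simp: \<alpha>_def \<delta>_def\<close>)
  have repF: "rep_on G (r + s) ?F"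
    using \<rho>'(1) F rs unfolding rep_on_def by simp
  have "iso_rep G \<rho>' ?F"
    using iso_rep_refl[OF rep_onI_group(1)[OF \<rho>'(1)]] F rep_onI_group[OF repF] rep_onI_group[OF \<rho>'(1)] rs
    by (auto simp: iso_rep_def)
  note sp = split_upper_block[OF repF c]
  have "iso_rep G \<rho> (\<lambda>g. block_diag (\<alpha> g) (\<delta> g))"
    using iso_rep_trans[OF \<rho>'(2) iso_rep_trans[OF \<open>iso_rep G \<rho>' ?F\<close> sp(3)]] .
  then show thesis using that[OF sp(1,2)] rs by blast
qed

theorem maschke:
  assumes "representation G \<rho>"
  shows "\<exists>\<sigma>s. (\<forall>\<sigma> \<in> set \<sigma>s. irrep G \<sigma>) \<and> iso_rep G \<rho> (direct_sum_rep \<sigma>s)"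
  using assms
proof (induction "rep_dim G \<rho>" arbitrary: \<rho> rule: less_induct)
  case (less \<rho>)
  consider "rep_dim G \<rho> = 0" | "irrep G \<rho>" | "rep_dim G \<rho> > 0" "\<not> irrep G \<rho>" by blast
  then show ?case
  proof cases
    \<comment> \<open>Irreducibility demands positive dimension, so dimension 0 must be the empty
      direct sum.\<close>
    case 1
    have z: "\<rho> g = 0\<^sub>m 0 0" if "g \<in> carrier G" for g
      using rep_carrier[OF less.prems that] 1 by (intro eq_matI) auto
    have r: "rep_on G 0 (direct_sum_rep [])"
      by (auto simp: rep_on_def direct_sum_rep_def intro!: eq_matI)
    have "iso_rep G \<rho> (direct_sum_rep [])"
      using iso_rep_refl[OF less.prems] z rep_onI_group[OF r] less.prems 1
      by (auto simp: iso_rep_def direct_sum_rep_def)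
    then show ?thesis by (intro exI[of _ "[]"]) auto
  next
    case 2
    then show ?thesis
      by (intro exI[of _ "[\<rho>]"]) (simp add: iso_rep_refl[OF less.prems])
  next
    case 3
    obtain r s \<alpha> \<delta> where sp: "rep_on G r \<alpha>" "rep_on G s \<delta>" "r < rep_dim G \<rho>" "s < rep_dim G \<rho>"
      "iso_rep G \<rho> (\<lambda>g. block_diag (\<alpha> g) (\<delta> g))"
      by (rule reducible_split[OF less.prems 3])
    obtain \<sigma>s where \<sigma>s: "\<forall>\<sigma> \<in> set \<sigma>s. irrep G \<sigma>" "iso_rep G \<alpha> (direct_sum_rep \<sigma>s)"
      using less.hyps[of \<alpha>] rep_onI_group[OF sp(1)] sp(3) by auto
    obtain \<tau>s where \<tau>s: "\<forall>\<sigma> \<in> set \<tau>s. irrep G \<sigma>" "iso_rep G \<delta> (direct_sum_rep \<tau>s)"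
      using less.hyps[of \<delta>] rep_onI_group[OF sp(2)] sp(4) by auto
    have "(\<lambda>g. block_diag (direct_sum_rep \<sigma>s g) (direct_sum_rep \<tau>s g)) = direct_sum_rep (\<sigma>s @ \<tau>s)"
      by (rule ext) (simp add: direct_sum_rep_def diag_block_mat_append Let_def)
    then have "iso_rep G \<rho> (direct_sum_rep (\<sigma>s @ \<tau>s))"
      using iso_rep_trans[OF sp(5) iso_rep_block_diag[OF \<sigma>s(2) \<tau>s(2)]] by simp
    then show ?thesis using \<sigma>s \<tau>s by (intro exI[of _ "\<sigma>s @ \<tau>s"]) auto
  qed
qed


text \<open>Invariant subspaces for \<rho> are pulled back to \<sigma> by taking preimages under the
  intertwiner S.\<close>

lemma irrep_iso:
  assumes iso: "iso_rep G \<rho> \<sigma>" and \<sigma>: "irrep G \<sigma>"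
  shows "irrep G \<rho>"
proof -
  let ?n = "rep_dim G \<rho>"
  obtain S where S: "S \<in> carrier (GL ?n)" "\<And>g. g \<in> carrier G \<Longrightarrow> S * \<sigma> g = \<rho> g * S"
    and dim: "rep_dim G \<sigma> = ?n" and reps: "representation G \<rho>" "representation G \<sigma>"
    using iso_rep_sym[OF iso] by (auto simp: iso_rep_def)
  obtain T where c: "S \<in> carrier_mat ?n ?n" "T \<in> carrier_mat ?n ?n" and ST: "S * T = 1\<^sub>m ?n" "T * S = 1\<^sub>m ?n"
    using S GL_carrier_iff by auto
  have STv: "S *\<^sub>v (T *\<^sub>v v) = v" if "v \<in> carrier_vec ?n" for v
    using assoc_mult_mat_vec[OF c that] ST that by simp
  have S0: "S *\<^sub>v 0\<^sub>v ?n = 0\<^sub>v ?n" using c by (intro eq_vecI) auto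
  show ?thesis
    unfolding irrep_def
  proof (intro conjI allI impI)
    show "representation G \<rho>" by (rule reps)
    show "?n > 0" using \<sigma> dim by (simp add: irrep_def)
    fix W
    assume W: "VectorSpace.subspace class_ring W (module_vec TYPE(complex) ?n) \<and>
      (\<forall>g\<in>carrier G. \<forall>w\<in>W. \<rho> g *\<^sub>v w \<in> W)"
    note sub = subspaceD[OF conjunct1[OF W]]
    define W' where "W' = {v \<in> carrier_vec ?n. S *\<^sub>v v \<in> W}"
    have "W' = {0\<^sub>v (rep_dim G \<sigma>)} \<or> W' = carrier_vec (rep_dim G \<sigma>)"
    proof (rule irrepD[OF \<sigma>])
      show "0\<^sub>v (rep_dim G \<sigma>) \<in> W'" using sub(2) dim S0 by (simp add: W'_def)
      show "v + w \<in> W'" if "v \<in> W'" "w \<in> W'" for v w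
        using that sub(3) by (auto simp: W'_def mult_add_distrib_mat_vec[OF c(1)])
      show "k \<cdot>\<^sub>v v \<in> W'" if "v \<in> W'" for k v
        using that sub(4) by (auto simp: W'_def mult_mat_vec[OF c(1)])
      show "\<sigma> g *\<^sub>v w \<in> W'" if g: "g \<in> carrier G" and w: "w \<in> W'" for g w
      proof -
        have w': "w \<in> carrier_vec ?n" "S *\<^sub>v w \<in> W" using w by (auto simp: W'_def)
        have cg: "\<sigma> g \<in> carrier_mat ?n ?n" "\<rho> g \<in> carrier_mat ?n ?n"
          using rep_carrier[OF reps(2) g] rep_carrier[OF reps(1) g] dim by simp_all
        have "S *\<^sub>v (\<sigma> g *\<^sub>v w) = \<rho> g *\<^sub>v (S *\<^sub>v w)"
          using assoc_mult_mat_vec[OF c(1) cg(1) w'(1)] assoc_mult_mat_vec[OF cg(2) c(1) w'(1)] S(2)[OF g]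
          by simp
        moreover have "\<rho> g *\<^sub>v (S *\<^sub>v w) \<in> W" using W g w' by blast
        ultimately show ?thesis using cg w' by (auto simp: W'_def)
      qed
    qed (auto simp: W'_def dim)
    then show "W = {0\<^sub>v ?n} \<or> W = carrier_vec ?n"
    proof
      assume 0: "W' = {0\<^sub>v (rep_dim G \<sigma>)}"
      have "w = 0\<^sub>v ?n" if w: "w \<in> W" for w
      proof -
        have wc: "w \<in> carrier_vec ?n" using w sub(1) by auto
        then have "T *\<^sub>v w \<in> W'" using w STv[OF wc] c by (auto simp: W'_def)
        then have "T *\<^sub>v w = 0\<^sub>v ?n" using 0 dim by simp
        then show ?thesis using STv[OF wc] S0 by simp
      qed
      then show ?thesis using sub(2) by blast
    next
      assume 1: "W' = carrier_vec (rep_dim G \<sigma>)"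
      have "v \<in> W" if v: "v \<in> carrier_vec ?n" for v
      proof -
        have "T *\<^sub>v v \<in> W'" using 1 dim v c by auto
        then show ?thesis using STv[OF v] by (simp add: W'_def)
      qed
      then show ?thesis using sub(1) by blast
    qed
  qed
qed

section \<open>Multiplicities as inner products and the norm criterion\<close>

lemma char_direct_sum:
  assumes "\<forall>\<sigma> \<in> set \<sigma>s. representation G \<sigma>" and g: "g \<in> carrier G"
  shows "char_of (direct_sum_rep \<sigma>s) g = (\<Sum>\<sigma>\<leftarrow>\<sigma>s. char_of \<sigma> g)"
  using assms(1)
proof (induction \<sigma>s)
  case Nil
  then show ?case by (simp add: char_of_def direct_sum_rep_def mat_trace_def)
next
  case (Cons \<sigma> \<sigma>s)
  have sq: "\<forall>\<sigma> \<in> set (\<sigma> # \<sigma>s). dim_row (\<sigma> g) = dim_col (\<sigma> g)"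
    using Cons.prems rep_carrier[OF _ g] by force
  then have "dim_row (direct_sum_rep \<sigma>s g) = dim_col (direct_sum_rep \<sigma>s g)"
    by (simp add: direct_sum_rep_def dim_diag_block_mat o_def cong: map_cong)
  moreover have "direct_sum_rep (\<sigma> # \<sigma>s) g = block_diag (\<sigma> g) (direct_sum_rep \<sigma>s g)"
    by (simp add: direct_sum_rep_def Let_def)
  ultimately have "char_of (direct_sum_rep (\<sigma> # \<sigma>s)) g = char_of \<sigma> g + char_of (direct_sum_rep \<sigma>s) g"
    using sq trace_block_diag by (simp add: char_of_def)
  then show ?case using Cons by simp
qed

lemma char_ip_sum_list_right:
  "char_ip G \<chi> (\<lambda>g. \<Sum>\<sigma>\<leftarrow>\<sigma>s. \<eta> \<sigma> g) = (\<Sum>\<sigma>\<leftarrow>\<sigma>s. char_ip G \<chi> (\<eta> \<sigma>))"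
  by (induction \<sigma>s) (simp_all add: char_ip_add_right, simp add: char_ip_def)

lemma char_ip_decomposition:
  assumes \<gamma>: "irrep G \<gamma>" and \<sigma>s: "\<forall>\<sigma> \<in> set \<sigma>s. irrep G \<sigma>" and iso: "iso_rep G \<rho> (direct_sum_rep \<sigma>s)"
  shows "char_ip G (char_of \<gamma>) (char_of \<rho>) = of_nat (length (filter (iso_rep G \<gamma>) \<sigma>s))"
proof -
  have "char_ip G (char_of \<gamma>) (char_of \<rho>) = char_ip G (char_of \<gamma>) (\<lambda>g. \<Sum>\<sigma>\<leftarrow>\<sigma>s. char_of \<sigma> g)"
    using \<sigma>s irrep_rep char_direct_sum[of \<sigma>s] by (intro char_ip_cong) (simp_all add: char_iso_rep[OF iso])
  also have "\<dots> = (\<Sum>\<sigma>\<leftarrow>\<sigma>s. char_ip G (char_of \<gamma>) (char_of \<sigma>))"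
    by (rule char_ip_sum_list_right)
  also have "\<dots> = of_nat (length (filter (iso_rep G \<gamma>) \<sigma>s))"
    using \<sigma>s by (induction \<sigma>s) (auto simp: char_orthogonal[OF \<gamma>])
  finally show ?thesis .
qed

text \<open>The \<open>THE\<close> denotes: Maschke gives one decomposition, and every other one
  yields the same count, because the count equals an inner product in which no decomposition
  occurs.\<close>

theorem multiplicity_rep_eq_char_ip:
  assumes \<gamma>: "irrep G \<gamma>" and \<rho>: "representation G \<rho>"
  shows "of_nat (multiplicity_rep G \<gamma> \<rho>) = char_ip G (char_of \<gamma>) (char_of \<rho>)"
proof -
  obtain \<sigma>s where \<sigma>s: "\<forall>\<sigma> \<in> set \<sigma>s. irrep G \<sigma>" "iso_rep G \<rho> (direct_sum_rep \<sigma>s)"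
    using maschke[OF \<rho>] by blast
  have "multiplicity_rep G \<gamma> \<rho> = length (filter (iso_rep G \<gamma>) \<sigma>s)"
    unfolding multiplicity_rep_def
  proof (rule the_equality)
    show "\<exists>\<rho>s. (\<forall>\<sigma>\<in>set \<rho>s. irrep G \<sigma>) \<and> iso_rep G \<rho> (direct_sum_rep \<rho>s) \<and>
        length (filter (iso_rep G \<gamma>) \<sigma>s) = length (filter (iso_rep G \<gamma>) \<rho>s)"
      using \<sigma>s by blast
  next
    fix m
    assume "\<exists>\<rho>s. (\<forall>\<sigma>\<in>set \<rho>s. irrep G \<sigma>) \<and> iso_rep G \<rho> (direct_sum_rep \<rho>s) \<and>
        m = length (filter (iso_rep G \<gamma>) \<rho>s)"
    then have "of_nat m = (of_nat (length (filter (iso_rep G \<gamma>) \<sigma>s)) :: complex)"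
      using char_ip_decomposition[OF \<gamma>] \<sigma>s by metis
    then show "m = length (filter (iso_rep G \<gamma>) \<sigma>s)" by (simp only: of_nat_eq_iff)
  qed
  then show ?thesis using char_ip_decomposition[OF \<gamma> \<sigma>s] by simp
qed

text \<open>Decomposing \<rho> in one slot only turns the norm into the sum, over the summands
  \<sigma>, of the multiplicity of \<sigma> in \<rho>. Each term is at least 1, since \<sigma>
  counts itself, so norm 1 leaves a single summand.\<close>

theorem irrep_if_char_ip_1:
  assumes \<rho>: "representation G \<rho>" and ip: "char_ip G (char_of \<rho>) (char_of \<rho>) = 1"
  shows "irrep G \<rho>"
proof -
  obtain \<sigma>s where \<sigma>s: "\<forall>\<sigma> \<in> set \<sigma>s. irrep G \<sigma>" and iso: "iso_rep G \<rho> (direct_sum_rep \<sigma>s)"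
    using maschke[OF \<rho>] by blast
  let ?m = "\<lambda>\<sigma>. length (filter (iso_rep G \<sigma>) \<sigma>s)"
  have "char_ip G (char_of \<rho>) (char_of \<rho>) = char_ip G (char_of \<rho>) (\<lambda>g. \<Sum>\<sigma>\<leftarrow>\<sigma>s. char_of \<sigma> g)"
    using \<sigma>s irrep_rep char_direct_sum[of \<sigma>s] by (intro char_ip_cong) (simp_all add: char_iso_rep[OF iso])
  also have "\<dots> = (\<Sum>\<sigma>\<leftarrow>\<sigma>s. char_ip G (char_of \<rho>) (char_of \<sigma>))"
    by (rule char_ip_sum_list_right)
  also have "\<dots> = (\<Sum>\<sigma>\<leftarrow>\<sigma>s. of_nat (?m \<sigma>))"
    using char_ip_decomposition[OF _ \<sigma>s iso] \<sigma>s
    by (intro arg_cong[where f = sum_list] map_cong refl) (simp add: char_ip_commute[of "char_of \<rho>"])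
  also have "\<dots> = of_nat (\<Sum>\<sigma>\<leftarrow>\<sigma>s. ?m \<sigma>)" by (rule sum_list_of_nat)
  finally have sum: "(\<Sum>\<sigma>\<leftarrow>\<sigma>s. ?m \<sigma>) = 1" using ip by (metis of_nat_eq_1_iff)
  have "?m \<sigma> \<ge> 1" if "\<sigma> \<in> set \<sigma>s" for \<sigma>
  proof -
    have "\<sigma> \<in> set (filter (iso_rep G \<sigma>) \<sigma>s)" using that \<sigma>s irrep_rep iso_rep_refl by auto
    from length_pos_if_in_set[OF this] show ?thesis by (simp only: Suc_le_eq One_nat_def)
  qed
  then have "(\<Sum>\<sigma>\<leftarrow>\<sigma>s. 1) \<le> (\<Sum>\<sigma>\<leftarrow>\<sigma>s. ?m \<sigma>)" by (intro sum_list_mono)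
  then have "length \<sigma>s \<le> 1" using sum by (simp add: sum_list_triv)
  moreover have "\<sigma>s \<noteq> []" using sum by auto
  ultimately obtain \<sigma> where \<sigma>: "\<sigma>s = [\<sigma>]" by (cases \<sigma>s) auto
  then show ?thesis using direct_sum_rep_singleton irrep_iso[of \<rho> \<sigma>] iso \<sigma> \<sigma>s by simp
qed

end

section \<open>Kronecker products and the groups \<open>H\<^sub>k\<close>\<close>

lemma kron_carrier:
  "A \<in> carrier_mat n m \<Longrightarrow> B \<in> carrier_mat p q \<Longrightarrow> kron A B \<in> carrier_mat (n * p) (m * q)"
  by (auto simp: kron_def)

lemma kron_index:
  assumes "A \<in> carrier_mat n m" "B \<in> carrier_mat p q" "i < n * p" "j < m * q"
  shows "kron A B $$ (i, j) = A $$ (i div p, j div q) * B $$ (i mod p, j mod q)"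
  using assms by (auto simp: kron_def)

text \<open>Splits an index as i = a m + b, the ordering of basis vectors used by
  \<open>kron\<close>.\<close>

lemma sum_lessThan_mult:
  "(\<Sum>i<n * (m::nat). f i) = (\<Sum>a<n. \<Sum>b<m. f (a * m + b) :: complex)"
proof -
  have "(\<Sum>i<n * m. f i) = (\<Sum>(a, b)\<in>{..<n} \<times> {..<m}. f (a * m + b))"
  proof (rule sum.reindex_bij_witness[where i = "\<lambda>(a, b). a * m + b" and j = "\<lambda>i. (i div m, i mod m)"])
    fix i assume "i \<in> {..<n * m}"
    then have "i < n * m" by simp
    then show "(i div m, i mod m) \<in> {..<n} \<times> {..<m}"
      using less_mult_imp_div_less by (cases "m = 0") auto
  next
    fix ab assume "ab \<in> {..<n} \<times> {..<m}"
    then obtain a b where ab: "ab = (a, b)" "a < n" "b < m" by auto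
    have "a * m + b < Suc a * m" using ab by simp
    also have "\<dots> \<le> n * m" using ab by (intro mult_right_mono) auto
    finally show "(case ab of (a, b) \<Rightarrow> a * m + b) \<in> {..<n * m}" using ab by simp
    show "((case ab of (a, b) \<Rightarrow> a * m + b) div m, (case ab of (a, b) \<Rightarrow> a * m + b) mod m) = ab"
      using ab by simp
  qed auto
  then show ?thesis by (simp add: sum.cartesian_product)
qed

lemma div_mod_less:
  "i < n * (m :: nat) \<Longrightarrow> i div m < n \<and> i mod m < m"
  using less_mult_imp_div_less[of i n m] by (cases "m = 0") auto

lemma kron_mult:
  assumes A: "A \<in> carrier_mat n m" and B: "B \<in> carrier_mat p q"
    and C: "C \<in> carrier_mat m m'" and D: "D \<in> carrier_mat q q'"
  shows "kron A B * kron C D = kron (A * C) (B * D)"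
proof (rule eq_matI)
  note c = kron_carrier[OF A B] kron_carrier[OF C D] 
  have AC: "A * C \<in> carrier_mat n m'" and BD: "B * D \<in> carrier_mat p q'" using assms by auto
  fix i j assume "i < dim_row (kron (A * C) (B * D))" "j < dim_col (kron (A * C) (B * D))"
  then have ij: "i < n * p" "j < m' * q'" using kron_carrier[OF AC BD] by auto
  note dij = div_mod_less[OF ij(1)] div_mod_less[OF ij(2)]
  have "(kron A B * kron C D) $$ (i, j) = (\<Sum>l<m * q. kron A B $$ (i, l) * kron C D $$ (l, j))"
    by (rule mult_mat_index[OF c ij])
  also have "\<dots> = (\<Sum>a<m. \<Sum>b<q. kron A B $$ (i, a * q + b) * kron C D $$ (a * q + b, j))"
    by (rule sum_lessThan_mult)
  also have "\<dots> = (\<Sum>a<m. \<Sum>b<q. (A $$ (i div p, a) * C $$ (a, j div q')) * (B $$ (i mod p, b) * D $$ (b, j mod q')))"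
  proof (intro sum.cong refl)
    fix a b assume "a \<in> {..<m}" "b \<in> {..<q}"
    then have ab: "a < m" "b < q" by auto
    have "a * q + b < Suc a * q" using ab by simp
    also have "\<dots> \<le> m * q" using ab by (intro mult_right_mono) auto
    finally have "a * q + b < m * q" .
    then show "kron A B $$ (i, a * q + b) * kron C D $$ (a * q + b, j) =
        (A $$ (i div p, a) * C $$ (a, j div q')) * (B $$ (i mod p, b) * D $$ (b, j mod q'))"
      using kron_index[OF A B ij(1)] kron_index[OF C D _ ij(2)] ab by simp
  qed
  also have "\<dots> = (A * C) $$ (i div p, j div q') * (B * D) $$ (i mod p, j mod q')"
    using mult_mat_index[OF A C, of "i div p" "j div q'"] mult_mat_index[OF B D, of "i mod p" "j mod q'"] dij
    by (simp add: sum_product)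
  also have "\<dots> = kron (A * C) (B * D) $$ (i, j)"
    by (rule kron_index[OF AC BD ij, symmetric])
  finally show "(kron A B * kron C D) $$ (i, j) = kron (A * C) (B * D) $$ (i, j)" .
qed (use assms in \<open>auto simp: kron_def\<close>)

lemma kron_one: "kron (1\<^sub>m n) (1\<^sub>m m) = 1\<^sub>m (n * m)"
proof (rule eq_matI)
  fix i j assume "i < dim_row (1\<^sub>m (n * m) :: complex mat)" "j < dim_col (1\<^sub>m (n * m) :: complex mat)"
  then have ij: "i < n * m" "j < n * m" by auto
  have "i = j \<longleftrightarrow> i div m = j div m \<and> i mod m = j mod m"
    by (metis div_mult_mod_eq)
  then show "kron (1\<^sub>m n) (1\<^sub>m m) $$ (i, j) = 1\<^sub>m (n * m) $$ (i, j)"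
    using kron_index[OF one_carrier_mat one_carrier_mat ij] ij div_mod_less[OF ij(1)] div_mod_less[OF ij(2)]
    by auto
qed (simp_all add: kron_def)

lemma trace_kron:
  assumes A: "A \<in> carrier_mat n n" and B: "B \<in> carrier_mat m m"
  shows "mat_trace (kron A B) = mat_trace A * mat_trace B"
proof -
  have "mat_trace (kron A B) = (\<Sum>i<n * m. kron A B $$ (i, i))"
    using kron_carrier[OF A B] by (simp add: mat_trace_def)
  also have "\<dots> = (\<Sum>i<n * m. A $$ (i div m, i div m) * B $$ (i mod m, i mod m))"
    using kron_index[OF A B] by (intro sum.cong) auto
  also have "\<dots> = (\<Sum>a<n. \<Sum>b<m. A $$ (a, a) * B $$ (b, b))"
    unfolding sum_lessThan_mult by (intro sum.cong) auto
  also have "\<dots> = mat_trace A * mat_trace B"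
    using A B by (simp add: mat_trace_def sum_product)
  finally show ?thesis .
qed

text \<open>The permutation matrix sending e_i \<otimes> e_j to e_j \<otimes> e_i. Up to the sign
  \<epsilon> it is the matrix of (1, 1)^{-1} in Ext.\<close>

definition swap_mat :: "nat \<Rightarrow> complex mat" where
  "swap_mat d = mat (d * d) (d * d) (\<lambda>(i, j). if i div d = j mod d \<and> i mod d = j div d then 1 else 0)"

lemma swap_mat_carrier [simp]: "swap_mat d \<in> carrier_mat (d * d) (d * d)"
  by (simp add: swap_mat_def)

lemma mult_swap_mat_index:
  assumes M: "M \<in> carrier_mat (d * d) (d * d)" and i: "i < d * d" and j: "j < d * d"
  shows "(M * swap_mat d) $$ (i, j) = M $$ (i, (j mod d) * d + j div d)"
    "(swap_mat d * M) $$ (i, j) = M $$ ((i mod d) * d + i div d, j)"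
proof -
  have less: "(k mod d) * d + k div d < d * d" if "k < d * d" for k
  proof -
    have "(k mod d) * d + k div d < Suc (k mod d) * d" using div_mod_less[OF that] by simp
    also have "\<dots> \<le> d * d" using div_mod_less[OF that] by (intro mult_right_mono) auto
    finally show ?thesis .
  qed
  \<comment> \<open>The index with quotient and remainder exchanged is unique, so exactly one term
    survives in each product with the swap.\<close>
  have iff: "(l div d = k mod d \<and> l mod d = k div d) \<longleftrightarrow> l = (k mod d) * d + k div d" if "k < d * d" for k l
  proof
    assume "l div d = k mod d \<and> l mod d = k div d"
    then show "l = (k mod d) * d + k div d" using div_mult_mod_eq[of l d] by metis
  qed (use div_mod_less[OF that] in simp)
  have "(M * swap_mat d) $$ (i, j) = (\<Sum>l<d * d. M $$ (i, l) * swap_mat d $$ (l, j))"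
    by (rule mult_mat_index[OF M _ i j]) simp
  also have "\<dots> = (\<Sum>l<d * d. if l = (j mod d) * d + j div d then M $$ (i, (j mod d) * d + j div d) else 0)"
    using iff[OF j] j by (intro sum.cong) (auto simp: swap_mat_def)
  finally show "(M * swap_mat d) $$ (i, j) = M $$ (i, (j mod d) * d + j div d)"
    using less[OF j] by simp
  have "(swap_mat d * M) $$ (i, j) = (\<Sum>l<d * d. swap_mat d $$ (i, l) * M $$ (l, j))"
    by (rule mult_mat_index[OF _ M i j]) simp
  also have "\<dots> = (\<Sum>l<d * d. if l = (i mod d) * d + i div d then M $$ ((i mod d) * d + i div d, j) else 0)"
  proof (rule sum.cong[OF refl])
    fix l assume l: "l \<in> {..<d * d}"
    have e: "i div d = l mod d \<and> i mod d = l div d \<longleftrightarrow> l = (i mod d) * d + i div d"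
      using iff[OF i, of l] by metis
    have "swap_mat d $$ (i, l) = (if l = (i mod d) * d + i div d then 1 else 0)"
      unfolding e[symmetric] using i l by (simp add: swap_mat_def)
    then show "swap_mat d $$ (i, l) * M $$ (l, j) =
        (if l = (i mod d) * d + i div d then M $$ ((i mod d) * d + i div d, j) else 0)"
      by simp
  qed
  finally show "(swap_mat d * M) $$ (i, j) = M $$ ((i mod d) * d + i div d, j)"
    using less[OF i] by simp
qed


lemma swap_mat_index_less:
  assumes "i < d * (d :: nat)"
  shows "(i mod d) * d + i div d < d * d"
    "((i mod d) * d + i div d) div d = i mod d" "((i mod d) * d + i div d) mod d = i div d"
proof -
  have "(i mod d) * d + i div d < Suc (i mod d) * d" using div_mod_less[OF assms] by simp
  also have "\<dots> \<le> d * d" using div_mod_less[OF assms] by (intro mult_right_mono) auto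
  finally show "(i mod d) * d + i div d < d * d" .
qed (use div_mod_less[OF assms] in auto)

lemma swap_mat_involution: "swap_mat d * swap_mat d = 1\<^sub>m (d * d)"
proof (rule eq_matI)
  fix i j assume "i < dim_row (1\<^sub>m (d * d) :: complex mat)" "j < dim_col (1\<^sub>m (d * d) :: complex mat)"
  then have ij: "i < d * d" "j < d * d" by auto
  have "i = j \<longleftrightarrow> i div d = j div d \<and> i mod d = j mod d"
    by (metis div_mult_mod_eq)
  then show "(swap_mat d * swap_mat d) $$ (i, j) = 1\<^sub>m (d * d) $$ (i, j)"
    using mult_swap_mat_index(1)[OF swap_mat_carrier ij] swap_mat_index_less[OF ij(2)] ij
    by (auto simp: swap_mat_def)
qed (simp_all add: swap_mat_def)

lemma kron_swap:
  assumes A: "A \<in> carrier_mat d d" and B: "B \<in> carrier_mat d d"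
  shows "kron A B * swap_mat d = swap_mat d * kron B A"
proof (rule eq_matI)
  note c = kron_carrier[OF A B] kron_carrier[OF B A]
  fix i j assume "i < dim_row (swap_mat d * kron B A)" "j < dim_col (swap_mat d * kron B A)"
  then have ij: "i < d * d" "j < d * d" using c by (auto simp: swap_mat_def)
  show "(kron A B * swap_mat d) $$ (i, j) = (swap_mat d * kron B A) $$ (i, j)"
    unfolding mult_swap_mat_index(1)[OF c(1) ij] mult_swap_mat_index(2)[OF c(2) ij]
      kron_index[OF A B ij(1) swap_mat_index_less(1)[OF ij(2)]]
      kron_index[OF B A swap_mat_index_less(1)[OF ij(1)] ij(2)]
      swap_mat_index_less(2,3)[OF ij(1)] swap_mat_index_less(2,3)[OF ij(2)]
    by (rule mult.commute)
qed (use assms in \<open>auto simp: kron_def swap_mat_def\<close>)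

text \<open>With the swap inserted the diagonal entries become A_ab B_ba. This is where the
  character value \<phi>(\<sigma>_1 \<sigma>_2) at (\<sigma>_1, \<sigma>_2)^{-1} comes from.\<close>

lemma trace_kron_swap:
  assumes A: "A \<in> carrier_mat d d" and B: "B \<in> carrier_mat d d"
  shows "mat_trace (kron A B * swap_mat d) = mat_trace (A * B)"
proof -
  note c = kron_carrier[OF A B]
  have "mat_trace (kron A B * swap_mat d) = (\<Sum>i<d * d. (kron A B * swap_mat d) $$ (i, i))"
    using c by (simp add: mat_trace_def)
  also have "\<dots> = (\<Sum>i<d * d. A $$ (i div d, i mod d) * B $$ (i mod d, i div d))"
    using mult_swap_mat_index(1)[OF c] kron_index[OF A B] swap_mat_index_less by (intro sum.cong) auto
  also have "\<dots> = (\<Sum>a<d. \<Sum>b<d. A $$ (a, b) * B $$ (b, a))"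
    unfolding sum_lessThan_mult by (intro sum.cong) auto
  also have "\<dots> = (\<Sum>a<d. (A * B) $$ (a, a))"
    using mult_mat_index[OF A B] by (intro sum.cong) auto
  also have "\<dots> = mat_trace (A * B)" using A by (simp add: mat_trace_def)
  finally show ?thesis .
qed

section \<open>The groups H_k\<close>

lemma h_one_carrier: "h_one k \<in> h_carrier k"
  by (induction k) auto

lemma h_mult_carrier: "a \<in> h_carrier k \<Longrightarrow> b \<in> h_carrier k \<Longrightarrow> h_mult a b \<in> h_carrier k"
  by (induction k arbitrary: a b) fastforce+

lemma h_mult_one_left: "a \<in> h_carrier k \<Longrightarrow> h_mult (h_one k) a = a"
  by (induction k arbitrary: a) auto

lemma h_mult_one_right: "a \<in> h_carrier k \<Longrightarrow> h_mult a (h_one k) = a"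
  by (induction k arbitrary: a) auto

lemma h_mult_assoc:
  "a \<in> h_carrier k \<Longrightarrow> b \<in> h_carrier k \<Longrightarrow> c \<in> h_carrier k \<Longrightarrow>
    h_mult (h_mult a b) c = h_mult a (h_mult b c)"
proof (induction k arbitrary: a b c)
  case (Suc k)
  then show ?case by auto
qed simp

lemma h_inverse_exists: "a \<in> h_carrier k \<Longrightarrow> \<exists>b \<in> h_carrier k. h_mult b a = h_one k"
proof (induction k arbitrary: a)
  case (Suc k)
  obtain x y e where a: "a = Wr x y e" "x \<in> h_carrier k" "y \<in> h_carrier k" "e = 1 \<or> e = -1"
    using Suc.prems by auto
  obtain x' y' where inv: "x' \<in> h_carrier k" "h_mult x' x = h_one k" "y' \<in> h_carrier k" "h_mult y' y = h_one k"
    using Suc.IH a by metis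
  show ?case
  proof (cases "e = 1")
    case True
    then show ?thesis using a inv by (intro bexI[of _ "Wr x' y' 1"]) auto
  next
    case False
    \<comment> \<open>A left factor of sign -1 crosses the components of its right neighbour, so the
      two componentwise inverses trade places.\<close>
    then show ?thesis using a inv by (intro bexI[of _ "Wr y' x' (-1)"]) auto
  qed
qed simp

lemma H_simps [simp]: "carrier (H k) = h_carrier k" "\<one>\<^bsub>H k\<^esub> = h_one k" "x \<otimes>\<^bsub>H k\<^esub> y = h_mult x y"
  by (simp_all add: H_def)

lemma group_H: "group (H k)"
  by (rule groupI) (auto simp: h_one_carrier h_mult_carrier h_mult_one_left h_mult_assoc h_inverse_exists)

lemma h_carrier_Suc_image:
  "h_carrier (Suc k) = (\<lambda>(a, b, e). Wr a b e) ` (h_carrier k \<times> h_carrier k \<times> {1, -1})"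
  by (auto simp: image_iff)

lemma finite_h_carrier: "finite (h_carrier k)"
proof (induction k)
  case (Suc k)
  then show ?case unfolding h_carrier_Suc_image by blast
qed simp

lemma finite_group_H: "finite_group (H k)"
  by (simp add: finite_group_def finite_group_axioms_def group_H finite_h_carrier)

lemma inv_H_Suc:
  assumes a: "a \<in> h_carrier k" and b: "b \<in> h_carrier k"
  shows "inv\<^bsub>H (Suc k)\<^esub> (Wr a b 1) = Wr (inv\<^bsub>H k\<^esub> a) (inv\<^bsub>H k\<^esub> b) 1"
    "inv\<^bsub>H (Suc k)\<^esub> (Wr a b (-1)) = Wr (inv\<^bsub>H k\<^esub> b) (inv\<^bsub>H k\<^esub> a) (-1)"
proof -
  interpret group "H k" by (rule group_H)
  have i: "inv\<^bsub>H k\<^esub> a \<in> h_carrier k" "inv\<^bsub>H k\<^esub> b \<in> h_carrier k"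
    "h_mult (inv\<^bsub>H k\<^esub> a) a = h_one k" "h_mult (inv\<^bsub>H k\<^esub> b) b = h_one k"
    using inv_closed l_inv a b by (auto simp del: inv_closed) 
  show "inv\<^bsub>H (Suc k)\<^esub> (Wr a b 1) = Wr (inv\<^bsub>H k\<^esub> a) (inv\<^bsub>H k\<^esub> b) 1"
    by (rule group.inv_equality[OF group_H]) (use a b i in auto)
  show "inv\<^bsub>H (Suc k)\<^esub> (Wr a b (-1)) = Wr (inv\<^bsub>H k\<^esub> b) (inv\<^bsub>H k\<^esub> a) (-1)"
    by (rule group.inv_equality[OF group_H]) (use a b i in auto)
qed

section \<open>Extended representations\<close>

lemma h_carrier_Suc_union:
  "h_carrier (Suc k) = (\<lambda>(a, b). Wr a b 1) ` (h_carrier k \<times> h_carrier k) \<union>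
    (\<lambda>(a, b). Wr a b (-1)) ` (h_carrier k \<times> h_carrier k)"
  by (auto simp: image_iff)

lemma sum_h_carrier_Suc:
  fixes F :: "helem \<Rightarrow> complex"
  shows "(\<Sum>x\<in>h_carrier (Suc k). F x) =
    (\<Sum>a\<in>h_carrier k. \<Sum>b\<in>h_carrier k. F (Wr a b 1)) + (\<Sum>a\<in>h_carrier k. \<Sum>b\<in>h_carrier k. F (Wr a b (-1)))"
  unfolding h_carrier_Suc_union
  by (subst sum.union_disjoint)
    (auto simp: finite_h_carrier sum.reindex inj_on_def sum.cartesian_product case_prod_unfold)

lemma card_h_carrier_Suc: "card (h_carrier (Suc k)) = 2 * (card (h_carrier k) * card (h_carrier k))"
proof -
  have "complex_of_nat (card (h_carrier (Suc k))) = (\<Sum>x\<in>h_carrier (Suc k). 1)"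
    by simp
  also have "\<dots> = of_nat (2 * (card (h_carrier k) * card (h_carrier k)))"
    unfolding sum_h_carrier_Suc by simp
  finally show ?thesis by (simp only: of_nat_eq_iff)
qed

text \<open>The character of an extension in terms of the character f of \<phi>. The value at
  \<open>Triv\<close> is a default outside the carrier of H_{k+1}.\<close>

definition ext_char :: "complex \<Rightarrow> (helem \<Rightarrow> complex) \<Rightarrow> helem \<Rightarrow> complex" where
  "ext_char \<epsilon> f x = (case x of Triv \<Rightarrow> 0 | Wr a b e \<Rightarrow> if e = 1 then f a * f b else \<epsilon> * f (h_mult a b))"

text \<open>Conjugation by the swap exchanges the tensor factors, hence the symmetrised product on
  the base group; elements of the other coset interchange the two blocks of the induced matrix and
  have trace 0.\<close>

definition ind_char :: "(helem \<Rightarrow> complex) \<Rightarrow> (helem \<Rightarrow> complex) \<Rightarrow> helem \<Rightarrow> complex" where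
  "ind_char f g x = (case x of Triv \<Rightarrow> 0 | Wr a b e \<Rightarrow> if e = 1 then f a * g b + f b * g a else 0)"

lemma ext_char_simps [simp]:
  "ext_char \<epsilon> f (Wr a b 1) = f a * f b" "ext_char \<epsilon> f (Wr a b (-1)) = \<epsilon> * f (h_mult a b)"
  by (simp_all add: ext_char_def)

lemma ind_char_simps [simp]:
  "ind_char f g (Wr a b 1) = f a * g b + f b * g a" "ind_char f g (Wr a b (-1)) = 0"
  by (simp_all add: ind_char_def)

context
  fixes k :: nat
begin

interpretation Hk: finite_group "H k" by (rule finite_group_H)

abbreviation ipk :: "(helem \<Rightarrow> complex) \<Rightarrow> (helem \<Rightarrow> complex) \<Rightarrow> complex" where
  "ipk f g \<equiv> char_ip (H k) f g"

lemma card_h_carrier_pos: "card (h_carrier k) > 0"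
  using Hk.card_pos by simp

lemma sum_eq_char_ip:
  "(\<Sum>a\<in>h_carrier k. f a * g (inv\<^bsub>H k\<^esub> a)) = of_nat (card (h_carrier k)) * ipk f g"
  using card_h_carrier_pos by (simp add: char_ip_def)

text \<open>The sum is split over the two cosets of H_k \<times> H_k. On the nontrivial one
  inversion also exchanges the components, so a and b change places there.\<close>

lemma char_ip_H_Suc:
  "char_ip (H (Suc k)) \<chi> \<eta> =
    ((\<Sum>a\<in>h_carrier k. \<Sum>b\<in>h_carrier k. \<chi> (Wr a b 1) * \<eta> (Wr (inv\<^bsub>H k\<^esub> a) (inv\<^bsub>H k\<^esub> b) 1)) +
     (\<Sum>a\<in>h_carrier k. \<Sum>b\<in>h_carrier k. \<chi> (Wr a b (-1)) * \<eta> (Wr (inv\<^bsub>H k\<^esub> b) (inv\<^bsub>H k\<^esub> a) (-1)))) /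
    (2 * (of_nat (card (h_carrier k)) * of_nat (card (h_carrier k))))"
  unfolding char_ip_def H_simps sum_h_carrier_Suc card_h_carrier_Suc
  by (simp add: inv_H_Suc)

lemma sum_product_char:
  "(\<Sum>a\<in>h_carrier k. \<Sum>b\<in>h_carrier k. (f a * g b) * (f' (inv\<^bsub>H k\<^esub> a) * g' (inv\<^bsub>H k\<^esub> b))) =
    of_nat (card (h_carrier k)) * of_nat (card (h_carrier k)) * (ipk f f' * ipk g g')"
proof -
  have "(\<Sum>a\<in>h_carrier k. \<Sum>b\<in>h_carrier k. (f a * g b) * (f' (inv\<^bsub>H k\<^esub> a) * g' (inv\<^bsub>H k\<^esub> b))) =
      (\<Sum>a\<in>h_carrier k. f a * f' (inv\<^bsub>H k\<^esub> a)) * (\<Sum>b\<in>h_carrier k. g b * g' (inv\<^bsub>H k\<^esub> b))"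
    by (simp add: sum_product mult_ac)
  then show ?thesis by (simp add: sum_eq_char_ip)
qed

text \<open>For fixed a the product a b runs once through H_k, so the sum over pairs is |H_k| copies
  of a single sum.\<close>

lemma sum_mult_char:
  "(\<Sum>a\<in>h_carrier k. \<Sum>b\<in>h_carrier k. f (h_mult a b) * f' (h_mult (inv\<^bsub>H k\<^esub> b) (inv\<^bsub>H k\<^esub> a))) =
    of_nat (card (h_carrier k)) * of_nat (card (h_carrier k)) * ipk f f'"
proof -
  have "(\<Sum>b\<in>h_carrier k. f (h_mult a b) * f' (h_mult (inv\<^bsub>H k\<^esub> b) (inv\<^bsub>H k\<^esub> a))) =
      of_nat (card (h_carrier k)) * ipk f f'" if a: "a \<in> h_carrier k" for a
  proof -
    have "(\<Sum>b\<in>h_carrier k. f (h_mult a b) * f' (h_mult (inv\<^bsub>H k\<^esub> b) (inv\<^bsub>H k\<^esub> a))) =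
        (\<Sum>b\<in>h_carrier k. f (h_mult a b) * f' (inv\<^bsub>H k\<^esub> (h_mult a b)))"
      using Hk.inv_mult_group a by (intro sum.cong) simp_all
    also have "\<dots> = (\<Sum>b\<in>h_carrier k. f b * f' (inv\<^bsub>H k\<^esub> b))"
      using sum.reindex_bij_betw[OF Hk.left_mult_bij[of a], of "\<lambda>b. f b * f' (inv\<^bsub>H k\<^esub> b)"] a by simp
    finally show ?thesis by (simp add: sum_eq_char_ip)
  qed
  then show ?thesis by (simp add: mult.assoc)
qed

text \<open>For signs \<epsilon>, \<delta> and x = \<open>ipk f f'\<close> in {0, 1}, the value (x^2
  + \<epsilon> \<delta> x) / 2 is 1 exactly when x = 1 and the signs agree, and 0 otherwise. The
  second term, from the nontrivial coset, is what separates Ext^+ from Ext^-.\<close>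

lemma char_ip_ext_ext:
  "char_ip (H (Suc k)) (ext_char \<epsilon> f) (ext_char \<delta> f') = (ipk f f' * ipk f f' + \<epsilon> * \<delta> * ipk f f') / 2"
proof -
  have "(\<Sum>a\<in>h_carrier k. \<Sum>b\<in>h_carrier k.
      (\<epsilon> * f (h_mult a b)) * (\<delta> * f' (h_mult (inv\<^bsub>H k\<^esub> b) (inv\<^bsub>H k\<^esub> a)))) =
    \<epsilon> * \<delta> * (\<Sum>a\<in>h_carrier k. \<Sum>b\<in>h_carrier k. f (h_mult a b) * f' (h_mult (inv\<^bsub>H k\<^esub> b) (inv\<^bsub>H k\<^esub> a)))"
    by (simp add: sum_distrib_left mult_ac)
  note eq = this
  show ?thesis
    unfolding char_ip_H_Suc ext_char_simps eq sum_product_char sum_mult_char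
    using card_h_carrier_pos by (simp add: field_simps)
qed

text \<open>Only the base group contributes, as an induced character vanishes off it; the two
  symmetrised terms are equal and cancel the factor 1/2.\<close>

lemma char_ip_ext_ind:
  "char_ip (H (Suc k)) (ext_char \<epsilon> f) (ind_char f' g') = ipk f f' * ipk f g'"
proof -
  have "(\<Sum>a\<in>h_carrier k. \<Sum>b\<in>h_carrier k. (f a * f b) *
      (f' (inv\<^bsub>H k\<^esub> a) * g' (inv\<^bsub>H k\<^esub> b) + f' (inv\<^bsub>H k\<^esub> b) * g' (inv\<^bsub>H k\<^esub> a))) =
    (\<Sum>a\<in>h_carrier k. \<Sum>b\<in>h_carrier k. (f a * f b) * (f' (inv\<^bsub>H k\<^esub> a) * g' (inv\<^bsub>H k\<^esub> b))) +
    (\<Sum>a\<in>h_carrier k. \<Sum>b\<in>h_carrier k. (f a * f b) * (g' (inv\<^bsub>H k\<^esub> a) * f' (inv\<^bsub>H k\<^esub> b)))"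
    by (simp add: sum.distrib distrib_left mult_ac)
  note eq = this
  show ?thesis
    unfolding char_ip_H_Suc ext_char_simps ind_char_simps eq sum_product_char
    using card_h_carrier_pos by (simp add: field_simps)
qed

text \<open>The four product terms on the base group agree in pairs, which again cancels the factor
  1/2.\<close>

lemma char_ip_ind_ind:
  "char_ip (H (Suc k)) (ind_char f g) (ind_char f' g') = ipk f f' * ipk g g' + ipk f g' * ipk g f'"
proof -
  have "(\<Sum>a\<in>h_carrier k. \<Sum>b\<in>h_carrier k. (f a * g b + f b * g a) *
      (f' (inv\<^bsub>H k\<^esub> a) * g' (inv\<^bsub>H k\<^esub> b) + f' (inv\<^bsub>H k\<^esub> b) * g' (inv\<^bsub>H k\<^esub> a))) =
    (\<Sum>a\<in>h_carrier k. \<Sum>b\<in>h_carrier k. (f a * g b) * (f' (inv\<^bsub>H k\<^esub> a) * g' (inv\<^bsub>H k\<^esub> b))) +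
    (\<Sum>a\<in>h_carrier k. \<Sum>b\<in>h_carrier k. (f a * g b) * (g' (inv\<^bsub>H k\<^esub> a) * f' (inv\<^bsub>H k\<^esub> b))) +
    ((\<Sum>a\<in>h_carrier k. \<Sum>b\<in>h_carrier k. (g a * f b) * (f' (inv\<^bsub>H k\<^esub> a) * g' (inv\<^bsub>H k\<^esub> b))) +
    (\<Sum>a\<in>h_carrier k. \<Sum>b\<in>h_carrier k. (g a * f b) * (g' (inv\<^bsub>H k\<^esub> a) * f' (inv\<^bsub>H k\<^esub> b))))"
    unfolding sum.distrib[symmetric] by (intro sum.cong refl) (simp add: algebra_simps)
  note eq = this
  show ?thesis
    unfolding char_ip_H_Suc ext_char_simps ind_char_simps eq sum_product_char
    using card_h_carrier_pos by (simp add: field_simps)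
qed

end

text \<open>Since (\<sigma>_1, \<sigma>_2)^{-1} is (\<sigma>_1, \<sigma>_2)^1 times (1, 1)^{-1}, it
  suffices to let the latter act by \<epsilon> times the swap; d is meant to be the dimension of
  \<phi>.\<close>

definition ext_rep :: "complex \<Rightarrow> nat \<Rightarrow> hrep \<Rightarrow> hrep" where
  "ext_rep \<epsilon> d \<phi> x = (case x of Triv \<Rightarrow> undefined |
     Wr a b e \<Rightarrow> if e = 1 then kron (\<phi> a) (\<phi> b) else \<epsilon> \<cdot>\<^sub>m (kron (\<phi> a) (\<phi> b) * swap_mat d))"

lemma ext_rep_simps [simp]:
  "ext_rep \<epsilon> d \<phi> (Wr a b 1) = kron (\<phi> a) (\<phi> b)"
  "ext_rep \<epsilon> d \<phi> (Wr a b (-1)) = \<epsilon> \<cdot>\<^sub>m (kron (\<phi> a) (\<phi> b) * swap_mat d)"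
  by (simp_all add: ext_rep_def)

lemma h_carrier_SucE:
  assumes "x \<in> h_carrier (Suc k)"
  obtains a b where "a \<in> h_carrier k" "b \<in> h_carrier k" "x = Wr a b 1" | a b where "a \<in> h_carrier k" "b \<in> h_carrier k" "x = Wr a b (-1)"
  using assms by auto

lemma smult_smult_mat: "a \<cdot>\<^sub>m (b \<cdot>\<^sub>m M) = (a * b) \<cdot>\<^sub>m (M :: complex mat)"
  by (rule eq_matI) auto

lemma rep_on_ext_rep:
  assumes \<phi>: "rep_on (H k) d \<phi>" and \<epsilon>: "\<epsilon> * \<epsilon> = 1"
  shows "rep_on (H (Suc k)) (d * d) (ext_rep \<epsilon> d \<phi>)"
proof -
  have c: "\<phi> a \<in> carrier_mat d d" if "a \<in> h_carrier k" for a
    using \<phi> that by (simp add: rep_on_def)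
  have m: "\<phi> (h_mult a b) = \<phi> a * \<phi> b" if "a \<in> h_carrier k" "b \<in> h_carrier k" for a b
    using \<phi> that by (simp add: rep_on_def)
  let ?K = "\<lambda>a b. kron (\<phi> a) (\<phi> b)" and ?S = "swap_mat d"
  have kc: "?K a b \<in> carrier_mat (d * d) (d * d)" if "a \<in> h_carrier k" "b \<in> h_carrier k" for a b
    using kron_carrier[OF c c] that by simp
  have km: "?K (h_mult a a') (h_mult b b') = ?K a b * ?K a' b'"
    if "a \<in> h_carrier k" "b \<in> h_carrier k" "a' \<in> h_carrier k" "b' \<in> h_carrier k" for a b a' b'
    using kron_mult[OF c c c c] that m by simp
  have Sc: "?S \<in> carrier_mat (d * d) (d * d)" by simp
  \<comment> \<open>Moving the swap past a Kronecker product exchanges its factors, which reproduces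
    the crossed multiplication rule of the wreath product.\<close>
  have ks: "?K a b * ?S * ?K a' b' = ?K (h_mult a b') (h_mult b a') * ?S"
    if "a \<in> h_carrier k" "b \<in> h_carrier k" "a' \<in> h_carrier k" "b' \<in> h_carrier k" for a b a' b'
  proof -
    have "?K a b * ?S * ?K a' b' = ?K a b * (?S * ?K a' b')"
      by (rule assoc_mult_mat[OF kc Sc kc]) (use that in auto)
    also have "?S * ?K a' b' = ?K b' a' * ?S"
      using kron_swap[OF c c, of b' a'] that by simp
    also have "?K a b * (?K b' a' * ?S) = ?K a b * ?K b' a' * ?S"
      by (rule assoc_mult_mat[OF kc kc Sc, symmetric]) (use that in auto)
    finally show ?thesis using km that by simp
  qed
  have KSc: "?K a b * ?S \<in> carrier_mat (d * d) (d * d)" if "a \<in> h_carrier k" "b \<in> h_carrier k" for a b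
    using mult_carrier_mat[OF kc Sc] that by simp
  show ?thesis
    unfolding rep_on_def H_simps
  proof (intro conjI ballI)
    fix x assume "x \<in> h_carrier (Suc k)"
    then show "ext_rep \<epsilon> d \<phi> x \<in> carrier_mat (d * d) (d * d)"
      by (rule h_carrier_SucE) (use kc KSc in auto)
  next
    show "ext_rep \<epsilon> d \<phi> (h_one (Suc k)) = 1\<^sub>m (d * d)"
      using \<phi> by (simp add: rep_on_def kron_one)
  next
    fix x y assume x: "x \<in> h_carrier (Suc k)" and y: "y \<in> h_carrier (Suc k)"
    show "ext_rep \<epsilon> d \<phi> (h_mult x y) = ext_rep \<epsilon> d \<phi> x * ext_rep \<epsilon> d \<phi> y"
    proof (rule h_carrier_SucE[OF x]; rule h_carrier_SucE[OF y])
      fix a b a' b' assume ab: "a \<in> h_carrier k" "b \<in> h_carrier k" "a' \<in> h_carrier k" "b' \<in> h_carrier k"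
      note KS = KSc[OF ab(1,2)] KSc[OF ab(3,4)] and K = kc[OF ab(1,2)] kc[OF ab(3,4)]
      {
        assume "x = Wr a b 1" "y = Wr a' b' 1"
        then show ?thesis using km[OF ab] by simp
      next
        assume "x = Wr a b 1" "y = Wr a' b' (-1)"
        then show ?thesis
          using km[OF ab] assoc_mult_mat[OF K Sc] mult_smult_distrib[OF K(1) KS(2)] by simp
      next
        assume "x = Wr a b (-1)" "y = Wr a' b' 1"
        then show ?thesis
          using ks[OF ab] mult_smult_assoc_mat[OF KS(1) K(2)] by simp
      next
        \<comment> \<open>Two elements of sign -1 multiply into the base group: the swap is an
          involution and \<epsilon>^2 = 1, so both extra factors disappear.\<close>
        assume xy: "x = Wr a b (-1)" "y = Wr a' b' (-1)"
        have K': "?K (h_mult a b') (h_mult b a') \<in> carrier_mat (d * d) (d * d)"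
          using ab by (intro kc h_mult_carrier)
        have "?K a b * ?S * (?K a' b' * ?S) = ?K a b * ?S * ?K a' b' * ?S"
          by (rule assoc_mult_mat[OF KS(1) K(2) Sc, symmetric])
        also have "\<dots> = ?K (h_mult a b') (h_mult b a') * (?S * ?S)"
          unfolding ks[OF ab] by (rule assoc_mult_mat[OF K' Sc Sc])
        also have "\<dots> = ?K (h_mult a b') (h_mult b a')"
          using K' by (simp add: swap_mat_involution)
        finally have e: "?K a b * ?S * (?K a' b' * ?S) = ?K (h_mult a b') (h_mult b a')" .
        have "\<epsilon> \<cdot>\<^sub>m (?K a b * ?S) * (\<epsilon> \<cdot>\<^sub>m (?K a' b' * ?S)) = (\<epsilon> * \<epsilon>) \<cdot>\<^sub>m (?K a b * ?S * (?K a' b' * ?S))"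
          using mult_smult_assoc_mat[OF KS(1) smult_carrier_mat[OF KS(2)]] mult_smult_distrib[OF KS]
          by (simp add: smult_smult_mat)
        also have "\<dots> = ?K (h_mult a b') (h_mult b a')"
          unfolding e \<epsilon> by (rule eq_matI) auto
        finally show ?thesis using xy by simp
      }
    qed
  qed
qed

lemma ext_rep_is_Ext:
  assumes \<phi>: "rep_on (H k) d \<phi>" and \<epsilon>: "\<epsilon> * \<epsilon> = 1"
  shows "is_Ext \<epsilon> k \<phi> (ext_rep \<epsilon> d \<phi>)"
  unfolding is_Ext_def
proof (intro conjI ballI)
  show "representation (H (Suc k)) (ext_rep \<epsilon> d \<phi>)"
    by (rule rep_on_representation[OF group_H rep_on_ext_rep[OF assms]])
  fix x assume "x \<in> base k"
  then show "ext_rep \<epsilon> d \<phi> x = tensor \<phi> \<phi> x" by (auto simp: base_def)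
next
  fix a b assume "a \<in> carrier (H k)" "b \<in> carrier (H k)"
  then have c: "\<phi> a \<in> carrier_mat d d" "\<phi> b \<in> carrier_mat d d" and m: "\<phi> (h_mult a b) = \<phi> a * \<phi> b"
    using \<phi> by (auto simp: rep_on_def)
  have "mat_trace (ext_rep \<epsilon> d \<phi> (Wr a b (-1))) = \<epsilon> * mat_trace (kron (\<phi> a) (\<phi> b) * swap_mat d)"
    using kron_carrier[OF c] by (simp add: mat_trace_def swap_mat_def sum_distrib_left)
  then show "mat_trace (ext_rep \<epsilon> d \<phi> (Wr a b (-1))) = \<epsilon> * mat_trace (\<phi> (a \<otimes>\<^bsub>H k\<^esub> b))"
    using trace_kron_swap[OF c] m by simp
qed

text \<open>This covers every extension in the sense of \<open>is_Ext\<close>, not only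
  \<open>ext_rep\<close>: its matrices are prescribed on the base group and its traces off
  it.\<close>

lemma char_is_Ext:
  assumes \<phi>: "rep_on (H k) d \<phi>" and ext: "is_Ext \<epsilon> k \<phi> \<chi>" and x: "x \<in> h_carrier (Suc k)"
  shows "char_of \<chi> x = ext_char \<epsilon> (char_of \<phi>) x"
proof (rule h_carrier_SucE[OF x])
  fix a b assume ab: "a \<in> h_carrier k" "b \<in> h_carrier k" "x = Wr a b 1"
  then have "\<chi> x = kron (\<phi> a) (\<phi> b)" using ext by (auto simp: is_Ext_def base_def)
  moreover have "\<phi> a \<in> carrier_mat d d" "\<phi> b \<in> carrier_mat d d" using \<phi> ab by (auto simp: rep_on_def)
  ultimately show ?thesis using trace_kron ab by (simp add: char_of_def)
next
  fix a b assume ab: "a \<in> h_carrier k" "b \<in> h_carrier k" "x = Wr a b (-1)"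
  then show ?thesis using ext by (simp add: is_Ext_def char_of_def)
qed

section \<open>Induced representations and trees\<close>

lemma inv_h_one: "inv\<^bsub>H k\<^esub> (h_one k) = h_one k"
  by (rule group.inv_equality[OF group_H]) (simp_all add: h_one_carrier h_mult_one_left)

context
  fixes k d\<^sub>1 d\<^sub>2 :: nat and \<phi>\<^sub>1 \<phi>\<^sub>2 :: hrep
  assumes \<phi>\<^sub>1: "rep_on (H k) d\<^sub>1 \<phi>\<^sub>1" and \<phi>\<^sub>2: "rep_on (H k) d\<^sub>2 \<phi>\<^sub>2"
begin

private abbreviation (input) K where "K a b \<equiv> kron (\<phi>\<^sub>1 a) (\<phi>\<^sub>2 b)"
private abbreviation (input) d where "d \<equiv> d\<^sub>1 * d\<^sub>2"

text \<open>The transversal is 1 and the swap t = (1, 1)^{-1}. Each occurrence of t changes the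
  coset, so elements of the base group fill the diagonal blocks and the others the off-diagonal
  ones; multiplying by t on the left exchanges a and b in the second row of blocks.\<close>

lemma Ind_blocks:
  assumes a: "a \<in> h_carrier k" and b: "b \<in> h_carrier k"
  shows "Ind k \<phi>\<^sub>1 \<phi>\<^sub>2 (Wr a b 1) = four_block_mat (K a b) (0\<^sub>m d d) (0\<^sub>m d d) (K b a)"
    "Ind k \<phi>\<^sub>1 \<phi>\<^sub>2 (Wr a b (-1)) = four_block_mat (0\<^sub>m d d) (K a b) (K b a) (0\<^sub>m d d)"
proof -
  have c: "\<phi>\<^sub>1 a \<in> carrier_mat d\<^sub>1 d\<^sub>1" "\<phi>\<^sub>1 b \<in> carrier_mat d\<^sub>1 d\<^sub>1" "\<phi>\<^sub>2 a \<in> carrier_mat d\<^sub>2 d\<^sub>2" "\<phi>\<^sub>2 b \<in> carrier_mat d\<^sub>2 d\<^sub>2"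
    using \<phi>\<^sub>1 \<phi>\<^sub>2 a b by (auto simp: rep_on_def)
  have Kc: "K a b \<in> carrier_mat d d" "K b a \<in> carrier_mat d d"
    using kron_carrier[OF c(1,4)] kron_carrier[OF c(2,3)] by auto
  have dim: "rep_dim (H (Suc k)) (tensor \<phi>\<^sub>1 \<phi>\<^sub>2) = d"
    using \<phi>\<^sub>1 \<phi>\<^sub>2 by (simp add: rep_dim_def rep_on_def kron_def)
  note one = h_one_carrier[of k]
  note s = induced_rep_def Ind_def dim Let_def inv_H_Suc[OF one one] inv_h_one base_def
    h_mult_one_left h_mult_one_right a b one numeral_2_eq_2
  \<comment> \<open>There are only the block indices 0 and 1, so division by d is a case
    distinction.\<close>
  have dm: "i div d = (if i < d then 0 else 1)" "i mod d = (if i < d then i else i - d)" if "i < d + d" for i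
    using that by (auto simp: div_nat_eqI le_mod_geq)
  show "Ind k \<phi>\<^sub>1 \<phi>\<^sub>2 (Wr a b 1) = four_block_mat (K a b) (0\<^sub>m d d) (0\<^sub>m d d) (K b a)"
  proof (rule eq_matI)
    fix i j
    assume "i < dim_row (four_block_mat (K a b) (0\<^sub>m d d) (0\<^sub>m d d) (K b a))"
      "j < dim_col (four_block_mat (K a b) (0\<^sub>m d d) (0\<^sub>m d d) (K b a))"
    then have ij: "i < d + d" "j < d + d" using Kc by auto
    show "Ind k \<phi>\<^sub>1 \<phi>\<^sub>2 (Wr a b 1) $$ (i, j) = four_block_mat (K a b) (0\<^sub>m d d) (0\<^sub>m d d) (K b a) $$ (i, j)"
      using ij Kc dm[OF ij(1)] dm[OF ij(2)]
      by (cases "i < d"; cases "j < d") (auto simp: s)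
  qed (use Kc in \<open>auto simp: s\<close>)
  show "Ind k \<phi>\<^sub>1 \<phi>\<^sub>2 (Wr a b (-1)) = four_block_mat (0\<^sub>m d d) (K a b) (K b a) (0\<^sub>m d d)"
  proof (rule eq_matI)
    fix i j
    assume "i < dim_row (four_block_mat (0\<^sub>m d d) (K a b) (K b a) (0\<^sub>m d d))"
      "j < dim_col (four_block_mat (0\<^sub>m d d) (K a b) (K b a) (0\<^sub>m d d))"
    then have ij: "i < d + d" "j < d + d" using Kc by auto
    show "Ind k \<phi>\<^sub>1 \<phi>\<^sub>2 (Wr a b (-1)) $$ (i, j) = four_block_mat (0\<^sub>m d d) (K a b) (K b a) (0\<^sub>m d d) $$ (i, j)"
      using ij Kc dm[OF ij(1)] dm[OF ij(2)]
      by (cases "i < d"; cases "j < d") (auto simp: s)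
  qed (use Kc in \<open>auto simp: s\<close>)
qed

lemma rep_on_Ind: "rep_on (H (Suc k)) (d + d) (Ind k \<phi>\<^sub>1 \<phi>\<^sub>2)"
proof -
  have Kc: "K a b \<in> carrier_mat d d" if "a \<in> h_carrier k" "b \<in> h_carrier k" for a b
    using kron_carrier[of "\<phi>\<^sub>1 a" d\<^sub>1 d\<^sub>1 "\<phi>\<^sub>2 b" d\<^sub>2 d\<^sub>2] \<phi>\<^sub>1 \<phi>\<^sub>2 that by (simp add: rep_on_def)
  have Km: "K a b * K a' b' = K (h_mult a a') (h_mult b b')"
    if "a \<in> h_carrier k" "b \<in> h_carrier k" "a' \<in> h_carrier k" "b' \<in> h_carrier k" for a b a' b'
    using kron_mult[of "\<phi>\<^sub>1 a" d\<^sub>1 d\<^sub>1 "\<phi>\<^sub>2 b" d\<^sub>2 d\<^sub>2 "\<phi>\<^sub>1 a'" d\<^sub>1 "\<phi>\<^sub>2 b'" d\<^sub>2] \<phi>\<^sub>1 \<phi>\<^sub>2 that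
    by (simp add: rep_on_def)
  show ?thesis
    unfolding rep_on_def H_simps
  proof (intro conjI ballI)
    fix x assume "x \<in> h_carrier (Suc k)"
    then show "Ind k \<phi>\<^sub>1 \<phi>\<^sub>2 x \<in> carrier_mat (d + d) (d + d)"
      by (rule h_carrier_SucE) (use Kc in \<open>auto simp: Ind_blocks\<close>)
  next
    show "Ind k \<phi>\<^sub>1 \<phi>\<^sub>2 (h_one (Suc k)) = 1\<^sub>m (d + d)"
      using \<phi>\<^sub>1 \<phi>\<^sub>2 Ind_blocks(1)[OF h_one_carrier h_one_carrier] by (simp add: rep_on_def kron_one)
  next
    fix x y assume x: "x \<in> h_carrier (Suc k)" and y: "y \<in> h_carrier (Suc k)"
    show "Ind k \<phi>\<^sub>1 \<phi>\<^sub>2 (h_mult x y) = Ind k \<phi>\<^sub>1 \<phi>\<^sub>2 x * Ind k \<phi>\<^sub>1 \<phi>\<^sub>2 y"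
    proof (rule h_carrier_SucE[OF x]; rule h_carrier_SucE[OF y])
      fix a b a' b' assume ab: "a \<in> h_carrier k" "b \<in> h_carrier k" "a' \<in> h_carrier k" "b' \<in> h_carrier k"
      note c = Kc[OF ab(1,2)] Kc[OF ab(2,1)] Kc[OF ab(3,4)] Kc[OF ab(4,3)]
      note z = zero_carrier_mat[of d d]
      note m1 = mult_four_block_mat[OF c(1) z z c(2) c(3) z z c(4)]
        mult_four_block_mat[OF c(1) z z c(2) z c(3,4) z]
        mult_four_block_mat[OF z c(1,2) z c(3) z z c(4)]
        mult_four_block_mat[OF z c(1,2) z z c(3,4) z]
      have cc: "K a b * K a' b' \<in> carrier_mat d d" "K b a * K b' a' \<in> carrier_mat d d"
        "K a b * K b' a' \<in> carrier_mat d d" "K b a * K a' b' \<in> carrier_mat d d"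
        using c by (auto intro: mult_carrier_mat)
      note s = h_mult_carrier Ind_blocks ab m1 c cc left_mult_zero_mat[OF c(1)] left_mult_zero_mat[OF c(2)]
        left_mult_zero_mat[OF c(3)] left_mult_zero_mat[OF c(4)] right_mult_zero_mat[OF c(1)]
        right_mult_zero_mat[OF c(2)] right_mult_zero_mat[OF c(3)] right_mult_zero_mat[OF c(4)]
        left_add_zero_mat[OF cc(1)] left_add_zero_mat[OF cc(2)] left_add_zero_mat[OF cc(3)] left_add_zero_mat[OF cc(4)]
        right_add_zero_mat[OF cc(1)] right_add_zero_mat[OF cc(2)] right_add_zero_mat[OF cc(3)] right_add_zero_mat[OF cc(4)]
      note km = Km[OF ab] Km[OF ab(2,1,4,3)] Km[OF ab(1,2,4,3)] Km[OF ab(2,1,3,4)]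
      {
        assume "x = Wr a b 1" "y = Wr a' b' 1"
        then show ?thesis by (simp add: s) (simp add: km)
      next
        assume "x = Wr a b 1" "y = Wr a' b' (-1)"
        then show ?thesis by (simp add: s) (simp add: km)
      next
        assume "x = Wr a b (-1)" "y = Wr a' b' 1"
        then show ?thesis by (simp add: s) (simp add: km)
      next
        assume "x = Wr a b (-1)" "y = Wr a' b' (-1)"
        then show ?thesis by (simp add: s) (simp add: km)
      }
    qed
  qed
qed

lemma char_Ind:
  assumes x: "x \<in> h_carrier (Suc k)"
  shows "char_of (Ind k \<phi>\<^sub>1 \<phi>\<^sub>2) x = ind_char (char_of \<phi>\<^sub>1) (char_of \<phi>\<^sub>2) x"
proof (rule h_carrier_SucE[OF x])
  fix a b assume ab: "a \<in> h_carrier k" "b \<in> h_carrier k" "x = Wr a b 1"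
  have c: "\<phi>\<^sub>1 a \<in> carrier_mat d\<^sub>1 d\<^sub>1" "\<phi>\<^sub>1 b \<in> carrier_mat d\<^sub>1 d\<^sub>1" "\<phi>\<^sub>2 a \<in> carrier_mat d\<^sub>2 d\<^sub>2" "\<phi>\<^sub>2 b \<in> carrier_mat d\<^sub>2 d\<^sub>2"
    using \<phi>\<^sub>1 \<phi>\<^sub>2 ab by (auto simp: rep_on_def)
  show ?thesis
    using Ind_blocks(1)[OF ab(1,2)] ab kron_carrier[OF c(1,4)] kron_carrier[OF c(2,3)]
      trace_block_diag[of "K a b" "K b a"] trace_kron[OF c(1,4)] trace_kron[OF c(2,3)]
    by (simp add: char_of_def)
next
  fix a b assume ab: "a \<in> h_carrier k" "b \<in> h_carrier k" "x = Wr a b (-1)"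
  have c: "\<phi>\<^sub>1 a \<in> carrier_mat d\<^sub>1 d\<^sub>1" "\<phi>\<^sub>1 b \<in> carrier_mat d\<^sub>1 d\<^sub>1" "\<phi>\<^sub>2 a \<in> carrier_mat d\<^sub>2 d\<^sub>2" "\<phi>\<^sub>2 b \<in> carrier_mat d\<^sub>2 d\<^sub>2"
    using \<phi>\<^sub>1 \<phi>\<^sub>2 ab by (auto simp: rep_on_def)
  show ?thesis
    using Ind_blocks(2)[OF ab(1,2)] ab kron_carrier[OF c(1,4)] kron_carrier[OF c(2,3)]
    by (auto simp: char_of_def mat_trace_def intro!: sum.neutral)
qed

end

section \<open>Trees and orthogonality of their representations\<close>

lemma pair_mset_eq: "{#a, b#} = {#c, d#} \<longleftrightarrow> a = c \<and> b = d \<or> a = d \<and> b = c"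
  by (auto simp: add_eq_conv_ex)

lemma theta_irrep: "theta k \<psi> T \<Longrightarrow> irrep (H k) \<psi>"
  by (cases rule: theta.cases) auto

lemma theta_rep_on: "theta k \<psi> T \<Longrightarrow> rep_on (H k) (rep_dim (H k) \<psi>) \<psi>"
  using theta_irrep by (simp add: irrep_def representation_iff[OF group_H])

text \<open>Every character at height k + 1 is an \<open>ext_char\<close> or an
  \<open>ind_char\<close> of characters at height k, whose inner products are 0 or 1 by induction.
  The product formulas then evaluate to 1 exactly when the kind, the sign and the unordered pair of
  subtrees agree, which is equality of the trees.\<close>

lemma theta_char_ip:
  "theta k \<psi> T \<Longrightarrow> theta k \<psi>' T' \<Longrightarrow> char_ip (H k) (char_of \<psi>) (char_of \<psi>') = (if T = T' then 1 else 0)"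
proof (induction k arbitrary: \<psi> T \<psi>' T')
  case 0
  interpret finite_group "H 0" by (rule finite_group_H)
  have "iso_rep (H 0) \<psi> (\<lambda>_. 1\<^sub>m 1)" "iso_rep (H 0) \<psi>' (\<lambda>_. 1\<^sub>m 1)" "T = T'"
    using 0 by (auto elim: theta.cases)
  then show ?case
    using char_orthogonal theta_irrep[OF 0(1)] theta_irrep[OF 0(2)] iso_rep_trans iso_rep_sym by metis
next
  case (Suc k)
  interpret k: finite_group "H k" by (rule finite_group_H)
  interpret S: finite_group "H (Suc k)" by (rule finite_group_H)
  let ?ip = "\<lambda>\<phi> \<phi>'. char_ip (H k) (char_of \<phi>) (char_of \<phi>')"
  let ?ext = "\<lambda>\<psi> T \<epsilon> \<phi> U. theta k \<phi> U \<and> (\<forall>x\<in>h_carrier (Suc k). char_of \<psi> x = ext_char \<epsilon> (char_of \<phi>) x) \<and>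
    (\<epsilon> = 1 \<and> T = Node {#U, U#} \<or> \<epsilon> = -1 \<and> T = Node {#U#})"
  let ?ind = "\<lambda>\<psi> T \<phi>\<^sub>1 \<phi>\<^sub>2 U\<^sub>1 U\<^sub>2. theta k \<phi>\<^sub>1 U\<^sub>1 \<and> theta k \<phi>\<^sub>2 U\<^sub>2 \<and> U\<^sub>1 \<noteq> U\<^sub>2 \<and>
    (\<forall>x\<in>h_carrier (Suc k). char_of \<psi> x = ind_char (char_of \<phi>\<^sub>1) (char_of \<phi>\<^sub>2) x) \<and> T = Node {#U\<^sub>1, U\<^sub>2#}"
  \<comment> \<open>Reduces the rules of \<open>theta\<close> to two character shapes. The sign
    \<epsilon> records which Ext rule was used and thereby how many copies of U the tree
    contains.\<close>
  have shape: "(\<exists>\<epsilon> \<phi> U. ?ext \<psi> T \<epsilon> \<phi> U) \<or> (\<exists>\<phi>\<^sub>1 \<phi>\<^sub>2 U\<^sub>1 U\<^sub>2. ?ind \<psi> T \<phi>\<^sub>1 \<phi>\<^sub>2 U\<^sub>1 U\<^sub>2)"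
    if "theta (Suc k) \<psi> T" for \<psi> T
    using that
  proof cases
    case (Ext_plus \<phi> U \<chi>)
    then have "?ext \<psi> T 1 \<phi> U"
      using char_is_Ext[OF theta_rep_on] S.char_iso_rep by simp
    then show ?thesis by blast
  next
    case (Ext_minus \<phi> U \<chi>)
    then have "?ext \<psi> T (-1) \<phi> U"
      using char_is_Ext[OF theta_rep_on] S.char_iso_rep by simp
    then show ?thesis by blast
  next
    case (Ind \<phi>\<^sub>1 U\<^sub>1 \<phi>\<^sub>2 U\<^sub>2)
    have "?ip \<phi>\<^sub>1 \<phi>\<^sub>2 = 0"
      using k.char_orthogonal[OF theta_irrep[OF Ind(2)] theta_irrep[OF Ind(3)]] Ind by simp
    \<comment> \<open>The rule only excludes isomorphic \<phi>_1 and \<phi>_2; equal trees are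
      excluded because the induction hypothesis would give inner product 1 instead of 0.\<close>
    then have "U\<^sub>1 \<noteq> U\<^sub>2" using Suc.IH[OF Ind(2,3)] by auto
    then have "?ind \<psi> T \<phi>\<^sub>1 \<phi>\<^sub>2 U\<^sub>1 U\<^sub>2"
      using char_Ind[OF theta_rep_on[OF Ind(2)] theta_rep_on[OF Ind(3)]] S.char_iso_rep[OF Ind(6)] Ind by simp
    then show ?thesis by blast
  qed
  have ee: "char_ip (H (Suc k)) (char_of \<psi>) (char_of \<psi>') = (if T = T' then 1 else 0)"
    if e: "?ext \<psi> T \<epsilon> \<phi> U" and e': "?ext \<psi>' T' \<epsilon>' \<phi>' U'" for \<psi> T \<epsilon> \<phi> U \<psi>' T' \<epsilon>' \<phi>' U'
  proof -
    have "char_ip (H (Suc k)) (char_of \<psi>) (char_of \<psi>') = (?ip \<phi> \<phi>' * ?ip \<phi> \<phi>' + \<epsilon> * \<epsilon>' * ?ip \<phi> \<phi>') / 2"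
      unfolding char_ip_ext_ext[symmetric] by (rule S.char_ip_cong) (use e e' in auto)
    also have "?ip \<phi> \<phi>' = (if U = U' then 1 else 0)" using Suc.IH e e' by blast
    finally show ?thesis using e e' by (auto simp: pair_mset_eq split: if_splits)
  qed
  have ei: "char_ip (H (Suc k)) (char_of \<psi>) (char_of \<psi>') = (if T = T' then 1 else 0)"
    if e: "?ext \<psi> T \<epsilon> \<phi> U" and i: "?ind \<psi>' T' \<phi>\<^sub>1 \<phi>\<^sub>2 U\<^sub>1 U\<^sub>2" for \<psi> T \<epsilon> \<phi> U \<psi>' T' \<phi>\<^sub>1 \<phi>\<^sub>2 U\<^sub>1 U\<^sub>2
  proof -
    have "char_ip (H (Suc k)) (char_of \<psi>) (char_of \<psi>') = ?ip \<phi> \<phi>\<^sub>1 * ?ip \<phi> \<phi>\<^sub>2"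
      unfolding char_ip_ext_ind[of k \<epsilon>, symmetric] by (rule S.char_ip_cong) (use e i in auto)
    also have "?ip \<phi> \<phi>\<^sub>1 = (if U = U\<^sub>1 then 1 else 0)" using Suc.IH e i by blast
    also have "?ip \<phi> \<phi>\<^sub>2 = (if U = U\<^sub>2 then 1 else 0)" using Suc.IH e i by blast
    finally show ?thesis using e i by (auto simp: pair_mset_eq split: if_splits)
  qed
  have ii: "char_ip (H (Suc k)) (char_of \<psi>) (char_of \<psi>') = (if T = T' then 1 else 0)"
    if i: "?ind \<psi> T \<phi>\<^sub>1 \<phi>\<^sub>2 U\<^sub>1 U\<^sub>2" and i': "?ind \<psi>' T' \<phi>\<^sub>1' \<phi>\<^sub>2' U\<^sub>1' U\<^sub>2'"
    for \<psi> T \<phi>\<^sub>1 \<phi>\<^sub>2 U\<^sub>1 U\<^sub>2 \<psi>' T' \<phi>\<^sub>1' \<phi>\<^sub>2' U\<^sub>1' U\<^sub>2'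
  proof -
    have "char_ip (H (Suc k)) (char_of \<psi>) (char_of \<psi>') = ?ip \<phi>\<^sub>1 \<phi>\<^sub>1' * ?ip \<phi>\<^sub>2 \<phi>\<^sub>2' + ?ip \<phi>\<^sub>1 \<phi>\<^sub>2' * ?ip \<phi>\<^sub>2 \<phi>\<^sub>1'"
      unfolding char_ip_ind_ind[symmetric] by (rule S.char_ip_cong) (use i i' in auto)
    also have "?ip \<phi>\<^sub>1 \<phi>\<^sub>1' = (if U\<^sub>1 = U\<^sub>1' then 1 else 0)" using Suc.IH i i' by blast
    also have "?ip \<phi>\<^sub>2 \<phi>\<^sub>2' = (if U\<^sub>2 = U\<^sub>2' then 1 else 0)" using Suc.IH i i' by blast
    also have "?ip \<phi>\<^sub>1 \<phi>\<^sub>2' = (if U\<^sub>1 = U\<^sub>2' then 1 else 0)" using Suc.IH i i' by blast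
    also have "?ip \<phi>\<^sub>2 \<phi>\<^sub>1' = (if U\<^sub>2 = U\<^sub>1' then 1 else 0)" using Suc.IH i i' by blast
    finally show ?thesis using i i' by (auto simp: pair_mset_eq split: if_splits)
  qed
  show ?case
    using shape[OF Suc.prems(1)] shape[OF Suc.prems(2)]
  proof (elim disjE exE)
    fix \<epsilon> \<phi> U \<epsilon>' \<phi>' U' assume "?ext \<psi> T \<epsilon> \<phi> U" "?ext \<psi>' T' \<epsilon>' \<phi>' U'"
    then show ?case by (rule ee)
  next
    fix \<epsilon> \<phi> U \<phi>\<^sub>1 \<phi>\<^sub>2 U\<^sub>1 U\<^sub>2 assume "?ext \<psi> T \<epsilon> \<phi> U" "?ind \<psi>' T' \<phi>\<^sub>1 \<phi>\<^sub>2 U\<^sub>1 U\<^sub>2"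
    then show ?case by (rule ei)
  next
    fix \<epsilon> \<phi> U \<phi>\<^sub>1 \<phi>\<^sub>2 U\<^sub>1 U\<^sub>2 assume "?ind \<psi> T \<phi>\<^sub>1 \<phi>\<^sub>2 U\<^sub>1 U\<^sub>2" "?ext \<psi>' T' \<epsilon> \<phi> U"
    \<comment> \<open>The remaining mixed case is \<open>ei\<close> with the roles exchanged, by
      symmetry of the form.\<close>
    then have "char_ip (H (Suc k)) (char_of \<psi>') (char_of \<psi>) = (if T' = T then 1 else 0)" by (intro ei)
    then show ?case by (simp add: S.char_ip_commute[of "char_of \<psi>"] eq_commute[of T])
  next
    fix \<phi>\<^sub>1 \<phi>\<^sub>2 U\<^sub>1 U\<^sub>2 \<phi>\<^sub>1' \<phi>\<^sub>2' U\<^sub>1' U\<^sub>2'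
    assume "?ind \<psi> T \<phi>\<^sub>1 \<phi>\<^sub>2 U\<^sub>1 U\<^sub>2" "?ind \<psi>' T' \<phi>\<^sub>1' \<phi>\<^sub>2' U\<^sub>1' U\<^sub>2'"
    then show ?case by (rule ii)
  qed
qed

text \<open>The tree prescribes the construction: one child calls for Ext^-, two equal children for
  Ext^+, two different ones for Ind. Irreducibility is the norm 1 given by the character formulas,
  and orthogonality of different subtrees supplies the nonisomorphism that Ind demands.\<close>

lemma theta_exists: "is_tree k T \<Longrightarrow> \<exists>\<psi>. theta k \<psi> T"
proof (induction rule: is_tree.induct)
  case 1
  interpret finite_group "H 0" by (rule finite_group_H)
  let ?t = "\<lambda>_. 1\<^sub>m 1 :: complex mat"
  have r: "rep_on (H 0) 1 ?t" by (simp add: rep_on_def)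
  have "char_ip (H 0) (char_of ?t) (char_of ?t) = 1"
    by (simp add: char_ip_def char_of_def trace_one)
  then have "irrep (H 0) ?t" using irrep_if_char_ip_1 rep_onI_group(1)[OF r] by blast
  then have "theta 0 ?t (Node {#})" using theta.triv iso_rep_refl rep_onI_group(1)[OF r] by blast
  then show ?case by blast
next
  case (2 S k)
  interpret k: finite_group "H k" by (rule finite_group_H)
  interpret S: finite_group "H (Suc k)" by (rule finite_group_H)
  have ext: "irrep (H (Suc k)) (ext_rep \<epsilon> (rep_dim (H k) \<phi>) \<phi>) \<and> is_Ext \<epsilon> k \<phi> (ext_rep \<epsilon> (rep_dim (H k) \<phi>) \<phi>) \<and>
      iso_rep (H (Suc k)) (ext_rep \<epsilon> (rep_dim (H k) \<phi>) \<phi>) (ext_rep \<epsilon> (rep_dim (H k) \<phi>) \<phi>)"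
    if \<phi>: "theta k \<phi> U" and \<epsilon>: "\<epsilon> * \<epsilon> = 1" for \<phi> U \<epsilon>
  proof -
    let ?e = "ext_rep \<epsilon> (rep_dim (H k) \<phi>) \<phi>"
    note r = theta_rep_on[OF \<phi>]
    note E = ext_rep_is_Ext[OF r \<epsilon>]
    have "char_ip (H (Suc k)) (char_of ?e) (char_of ?e) =
        char_ip (H (Suc k)) (ext_char \<epsilon> (char_of \<phi>)) (ext_char \<epsilon> (char_of \<phi>))"
      by (rule S.char_ip_cong) (simp_all add: char_is_Ext[OF r E])
    also have "\<dots> = 1" using theta_char_ip[OF \<phi> \<phi>] \<epsilon> by (simp add: char_ip_ext_ext)
    finally show ?thesis
      using E S.irrep_if_char_ip_1 S.iso_rep_refl by (auto simp: is_Ext_def)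
  qed
  from 2 consider "size S = 1" | "size S = Suc 1" by auto
  then show ?case
  proof cases
    case 1
    then obtain U where S: "S = {#U#}" using size_1_singleton_mset by metis
    then obtain \<phi> where \<phi>: "theta k \<phi> U" using 2 by auto
    show ?thesis
      unfolding S using theta.Ext_minus[OF \<phi>] ext[OF \<phi>, of "-1"] by auto
  next
    case 2
    then obtain U S' where "S = add_mset U S'" "size S' = 1"
      by (metis size_eq_Suc_imp_eq_union size_add_mset nat.inject)
    then obtain V where S: "S = {#U, V#}" using size_1_singleton_mset by metis
    then obtain \<phi>\<^sub>1 \<phi>\<^sub>2 where \<phi>: "theta k \<phi>\<^sub>1 U" "theta k \<phi>\<^sub>2 V" using \<open>\<forall>T\<in>#S. _ T\<close> by auto
    show ?thesis
    proof (cases "U = V")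
      case True
      then show ?thesis
        unfolding S using theta.Ext_plus[OF \<phi>(1)] ext[OF \<phi>(1), of 1] by auto
    next
      case False
      let ?i = "Ind k \<phi>\<^sub>1 \<phi>\<^sub>2"
      note r = theta_rep_on[OF \<phi>(1)] theta_rep_on[OF \<phi>(2)]
      note rI = S.rep_onI_group(1)[OF rep_on_Ind[OF r]]
      have "char_ip (H (Suc k)) (char_of ?i) (char_of ?i) =
          char_ip (H (Suc k)) (ind_char (char_of \<phi>\<^sub>1) (char_of \<phi>\<^sub>2)) (ind_char (char_of \<phi>\<^sub>1) (char_of \<phi>\<^sub>2))"
        by (rule S.char_ip_cong) (simp_all add: char_Ind[OF r])
      also have "\<dots> = 1"
        using theta_char_ip[OF \<phi>(1,1)] theta_char_ip[OF \<phi>(1,2)] theta_char_ip[OF \<phi>(2,1)] theta_char_ip[OF \<phi>(2,2)] False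
        by (simp add: char_ip_ind_ind)
      finally have irr: "irrep (H (Suc k)) ?i" using S.irrep_if_char_ip_1[OF rI] by blast
      have "\<not> iso_rep (H k) \<phi>\<^sub>1 \<phi>\<^sub>2"
        using theta_char_ip[OF \<phi>(1,2)] False k.char_orthogonal[OF theta_irrep[OF \<phi>(1)] theta_irrep[OF \<phi>(2)]]
        by auto
      then show ?thesis
        unfolding S using theta.Ind[OF \<phi> _ irr S.iso_rep_refl[OF rI]] by blast
    qed
  qed
qed

section \<open>Products of the groups \<open>H\<^sub>k\<close>\<close>

lemma sum_powers_less:
  "sorted_wrt (>) ks \<Longrightarrow> \<forall>k\<in>set ks. k < K \<Longrightarrow> (\<Sum>k\<leftarrow>ks. 2 ^ k) < (2 ^ K :: nat)"
proof (induction ks arbitrary: K)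
  case (Cons k ks)
  have "(\<Sum>k\<leftarrow>ks. 2 ^ k) < (2 ^ k :: nat)" using Cons by auto
  then have "(\<Sum>k\<leftarrow>k # ks. 2 ^ k) < (2 ^ Suc k :: nat)" by simp
  also have "\<dots> \<le> 2 ^ K" using Cons.prems by (intro power_increasing) auto
  finally show ?case .
qed simp

text \<open>The leading power exceeds the sum of the others, so no carry occurs and addition is
  bitwise disjunction.\<close>

lemma bit_sum_powers: "sorted_wrt (>) ks \<Longrightarrow> bit (\<Sum>k\<leftarrow>ks. 2 ^ k :: nat) j \<longleftrightarrow> j \<in> set ks"
proof (induction ks)
  case (Cons k ks)
  let ?m = "\<Sum>k\<leftarrow>ks. 2 ^ k :: nat"
  have "?m < 2 ^ k" using Cons.prems by (intro sum_powers_less) auto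
  then have "take_bit k ?m = ?m" by (rule take_bit_nat_eq_self)
  then have low: "bit ?m i \<Longrightarrow> i < k" for i by (metis bit_take_bit_iff)
  have "and (2 ^ k) ?m = 0"
    by (rule bit_eqI) (use low in \<open>auto simp: bit_and_iff bit_exp_iff\<close>)
  then have "2 ^ k + ?m = or (2 ^ k) ?m" by (rule disjunctive_add_eq_or)
  then show ?case using Cons by (auto simp: bit_or_iff bit_exp_iff)
qed simp

text \<open>Uniqueness of the binary expansion. From here on a \<open>bin_list\<close> is computed
  by exhibiting a decreasing list of exponents with the right sum.\<close>

lemma bin_list_sum_powers:
  assumes "sorted_wrt (>) ks"
  shows "bin_list (\<Sum>k\<leftarrow>ks. 2 ^ k) = ks"
proof -
  have "sorted_wrt (<) (rev ks)" using assms by (simp add: sorted_wrt_rev)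
  then have "sorted_list_of_set (set (rev ks)) = rev ks"
    by (intro sorted_list_of_set.idem_if_sorted_distinct) (auto simp: strict_sorted_iff)
  moreover have "Bin (\<Sum>k\<leftarrow>ks. 2 ^ k) = set (rev ks)"
    using bit_sum_powers[OF assms] by (auto simp: Bin_def)
  ultimately show ?thesis by (simp add: bin_list_def)
qed

text \<open>By halving: the exponents of \<open>n div 2\<close> move up by one, and an odd n gains
  the exponent 0 at the end.\<close>

lemma sum_powers_exists: "\<exists>ks. sorted_wrt (>) ks \<and> n = (\<Sum>k\<leftarrow>ks. 2 ^ k :: nat)"
proof (induction n rule: less_induct)
  case (less n)
  show ?case
  proof (cases "n = 0")
    case False
    then obtain ks where ks: "sorted_wrt (>) ks" "n div 2 = (\<Sum>k\<leftarrow>ks. 2 ^ k)"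
      using less[of "n div 2"] by auto
    have s: "(\<Sum>k\<leftarrow>map Suc ks. 2 ^ k) = 2 * (\<Sum>k\<leftarrow>ks. 2 ^ k :: nat)"
      by (simp add: o_def sum_list_const_mult)
    have w: "sorted_wrt (>) (map Suc ks)" using ks by (simp add: sorted_wrt_map)
    show ?thesis
    proof (cases "even n")
      case True
      then show ?thesis using s w ks by (intro exI[of _ "map Suc ks"]) auto
    next
      case False
      then have "n = (\<Sum>k\<leftarrow>map Suc ks @ [0]. 2 ^ k)"
        using s ks by (simp del: map_map) presburger
      then show ?thesis using w by (intro exI[of _ "map Suc ks @ [0]"]) (auto simp: sorted_wrt_append)
    qed
  qed (auto intro: exI[of _ "[]"])
qed

lemma bin_list_sorted: "sorted_wrt (>) (bin_list n)"
  and bin_list_sum: "(\<Sum>k\<leftarrow>bin_list n. 2 ^ k) = n"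
  using sum_powers_exists[of n] bin_list_sum_powers by auto

lemma set_bin_list: "set (bin_list n) = Bin n"
  using bit_sum_powers[OF bin_list_sorted[of n]] by (auto simp: bin_list_sum Bin_def)

lemma sum_powers_rev_upt: "(\<Sum>k\<leftarrow>rev [0..<k]. 2 ^ k) = (2 ^ k - 1 :: nat)"
  by (induction k) auto

lemma bin_list_pred_power: "bin_list (2 ^ k - 1) = rev [0..<k]"
  using bin_list_sum_powers[of "rev [0..<k]"] sum_powers_rev_upt[of k]
  by (simp add: sorted_wrt_rev)

lemma bin_list_power: "bin_list (2 ^ k) = [k]"
  using bin_list_sum_powers[of "[k]"] by simp

text \<open>The borrow: 2^k - 1 is the sum of all smaller powers, and the exponents in
  \<open>as\<close> exceed k, so the new list is still decreasing.\<close>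

lemma bin_list_pred:
  assumes "bin_list n = as @ [k]"
  shows "bin_list (n - 1) = as @ rev [0..<k]"
proof -
  have s: "sorted_wrt (>) (as @ [k])" using bin_list_sorted[of n] assms by simp
  have "sorted_wrt (>) (as @ rev [0..<k])"
    using s by (force simp: sorted_wrt_append sorted_wrt_rev)
  moreover have "(\<Sum>k\<leftarrow>as @ rev [0..<k]. 2 ^ k) = n - 1"
    using bin_list_sum[of n] assms sum_powers_rev_upt[of k] by simp
  ultimately show ?thesis using bin_list_sum_powers by metis
qed

section \<open>Direct products of finite groups\<close>

lemma DirProd_list_Nil: "carrier (DirProd_list []) = {[]}" "\<one>\<^bsub>DirProd_list []\<^esub> = []" "x \<otimes>\<^bsub>DirProd_list []\<^esub> y = []"
  by (simp_all add: DirProd_list_def)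

lemma DirProd_list_Cons_one: "\<one>\<^bsub>DirProd_list (G # Gs)\<^esub> = \<one>\<^bsub>G\<^esub> # \<one>\<^bsub>DirProd_list Gs\<^esub>"
  by (simp add: DirProd_list_one)

lemma DirProd_list_Cons_mem:
  "x # xs \<in> carrier (DirProd_list (G # Gs)) \<longleftrightarrow> x \<in> carrier G \<and> xs \<in> carrier (DirProd_list Gs)"
  by (auto simp: DirProd_list_carrier)

lemma DirProd_list_Cons_cases:
  assumes "zs \<in> carrier (DirProd_list (G # Gs))"
  obtains x xs where "zs = x # xs" "x \<in> carrier G" "xs \<in> carrier (DirProd_list Gs)"
  using assms by (auto simp: DirProd_list_carrier)

lemma DirProd_list_Cons_mult:
  assumes "x \<in> carrier G" "y \<in> carrier G" "xs \<in> carrier (DirProd_list Gs)" "ys \<in> carrier (DirProd_list Gs)"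
  shows "(x # xs) \<otimes>\<^bsub>DirProd_list (G # Gs)\<^esub> (y # ys) = (x \<otimes>\<^bsub>G\<^esub> y) # (xs \<otimes>\<^bsub>DirProd_list Gs\<^esub> ys)"
proof -
  have "(\<lambda>(g, gs). g # gs) \<in> hom (G \<times>\<times> DirProd_list Gs) (DirProd_list (G # Gs))"
    using DirProd_list_iso by (auto simp: iso_def)
  from hom_mult[OF this, of "(x, xs)" "(y, ys)"] show ?thesis using assms by (simp add: DirProd_def)
qed

lemma finite_group_DirProd_list:
  "\<forall>G\<in>set Gs. finite_group G \<Longrightarrow> finite_group (DirProd_list Gs)"
proof -
  assume fin: "\<forall>G\<in>set Gs. finite_group G"
  then have "group (DirProd_list Gs)"
    by (intro DirProd_list_is_group) (auto simp: finite_group_def)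
  moreover have "finite (carrier (DirProd_list Gs))"
    using fin by (induction Gs) (auto simp: DirProd_list_Nil DirProd_list_carrier finite_group_def finite_group_axioms_def)
  ultimately show ?thesis by (simp add: finite_group_def finite_group_axioms_def)
qed

text \<open>Inverses are componentwise, so the sum over the product group factors. The form with
  \<open>hd\<close> and \<open>tl\<close> matches the recursion of
  \<open>forest_char\<close>.\<close>

lemma char_ip_DirProd_list_Cons:
  assumes G: "finite_group G" and Gs: "\<forall>G\<in>set Gs. finite_group G"
  shows "char_ip (DirProd_list (G # Gs)) (\<lambda>zs. f (hd zs) * F (tl zs)) (\<lambda>zs. f' (hd zs) * F' (tl zs)) =
    char_ip G f f' * char_ip (DirProd_list Gs) F F'"
proof -
  interpret G: finite_group G by fact
  interpret D: finite_group "DirProd_list Gs" by (rule finite_group_DirProd_list[OF Gs])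
  interpret GD: finite_group "DirProd_list (G # Gs)" by (rule finite_group_DirProd_list) (use G Gs in auto)
  let ?A = "carrier G" and ?B = "carrier (DirProd_list Gs)"
  have inv: "inv\<^bsub>DirProd_list (G # Gs)\<^esub> (x # xs) = inv\<^bsub>G\<^esub> x # inv\<^bsub>DirProd_list Gs\<^esub> xs"
    if "x \<in> ?A" "xs \<in> ?B" for x xs
    by (rule GD.inv_equality)
      (use that in \<open>simp_all add: DirProd_list_Cons_mult DirProd_list_Cons_mem DirProd_list_Cons_one\<close>)
  have car: "carrier (DirProd_list (G # Gs)) = (\<lambda>(x, xs). x # xs) ` (?A \<times> ?B)"
    by (rule DirProd_list_carrier)
  have inj: "inj_on (\<lambda>(x, xs). x # xs) (?A \<times> ?B)" by (auto simp: inj_on_def)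
  have "(\<Sum>zs\<in>carrier (DirProd_list (G # Gs)). (f (hd zs) * F (tl zs)) *
      (f' (hd (inv\<^bsub>DirProd_list (G # Gs)\<^esub> zs)) * F' (tl (inv\<^bsub>DirProd_list (G # Gs)\<^esub> zs)))) =
    (\<Sum>x\<in>?A. \<Sum>xs\<in>?B. (f x * F xs) * (f' (inv\<^bsub>G\<^esub> x) * F' (inv\<^bsub>DirProd_list Gs\<^esub> xs)))"
    unfolding car sum.reindex[OF inj] sum.cartesian_product
    by (intro sum.cong) (auto simp: inv)
  also have "\<dots> = (\<Sum>x\<in>?A. f x * f' (inv\<^bsub>G\<^esub> x)) * (\<Sum>xs\<in>?B. F xs * F' (inv\<^bsub>DirProd_list Gs\<^esub> xs))"
    by (simp add: sum_product mult_ac)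
  finally show ?thesis
    by (simp add: char_ip_def card_image[OF inj] car card_cartesian_product)
qed

section \<open>Characters of forests\<close>

abbreviation HL :: "nat list \<Rightarrow> helem list monoid" where
  "HL ks \<equiv> DirProd_list (map H ks)"

lemma finite_group_HL: "finite_group (HL ks)"
  by (rule finite_group_DirProd_list) (auto simp: finite_group_H)

definition tree_rep :: "nat \<Rightarrow> tree \<Rightarrow> hrep" where
  "tree_rep k T = (SOME \<phi>. theta k \<phi> T)"

definition tree_char :: "nat \<Rightarrow> tree \<Rightarrow> helem \<Rightarrow> complex" where
  "tree_char k T = char_of (tree_rep k T)"

lemma theta_tree_rep: "is_tree k T \<Longrightarrow> theta k (tree_rep k T) T"
  unfolding tree_rep_def using theta_exists by (rule someI_ex)

lemma theta_is_tree: "theta k \<phi> T \<Longrightarrow> is_tree k T"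
  by (induction rule: theta.induct) (auto intro: is_tree.intros)

text \<open>Two irreducibles with the same tree have inner product 1 and are therefore isomorphic,
  so a character depends on the tree alone. This is what makes representatives chosen at different
  sizes comparable.\<close>

lemma theta_char:
  assumes "theta k \<phi> T" "x \<in> h_carrier k"
  shows "char_of \<phi> x = tree_char k T x"
proof -
  interpret finite_group "H k" by (rule finite_group_H)
  note t = theta_tree_rep[OF theta_is_tree[OF assms(1)]]
  have "iso_rep (H k) \<phi> (tree_rep k T)"
    using char_orthogonal[OF theta_irrep[OF assms(1)] theta_irrep[OF t]] theta_char_ip[OF assms(1) t]
    by (simp split: if_splits)
  then show ?thesis unfolding tree_char_def by (rule char_iso_rep) (use assms in simp)
qed

lemma char_ip_tree_char:
  "is_tree k T \<Longrightarrow> is_tree k U \<Longrightarrow> char_ip (H k) (tree_char k T) (tree_char k U) = (if T = U then 1 else 0)"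
  unfolding tree_char_def using theta_char_ip theta_tree_rep by blast

fun forest_char :: "nat list \<Rightarrow> tree list \<Rightarrow> helem list \<Rightarrow> complex" where
  "forest_char [] F xs = 1"
| "forest_char (k # ks) F xs = tree_char k (hd F) (hd xs) * forest_char ks (tl F) (tl xs)"

lemma forest_char_append:
  "length A = length as \<Longrightarrow> length as \<le> length xs \<Longrightarrow> forest_char (as @ ls) (A @ B) xs =
    forest_char as A (take (length as) xs) * forest_char ls B (drop (length as) xs)"
proof (induction as arbitrary: A xs)
  case (Cons a as)
  then obtain T A' x xs' where "A = T # A'" "xs = x # xs'"
    by (metis Suc_le_length_iff length_Suc_conv list.size(4) One_nat_def add.right_neutral add_Suc_right list.size(3) length_Cons)
  then show ?case using Cons by simp
qed simp

text \<open>The common prefix \<open>as\<close> contributes the orthogonality relations of its trees; the rest is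
  an inner product on the remaining factors.\<close>

lemma char_ip_forest_char:
  assumes "list_all2 is_tree as A" "list_all2 is_tree as A'"
  shows "char_ip (HL (as @ ls)) (\<lambda>zs. forest_char as A (take (length as) zs) * g (drop (length as) zs))
      (\<lambda>zs. forest_char as A' (take (length as) zs) * g' (drop (length as) zs)) =
    (if A = A' then 1 else 0) * char_ip (HL ls) g g'"
  using assms
proof (induction as arbitrary: A A')
  case (Cons a as)
  then obtain T B T' B' where A: "A = T # B" "A' = T' # B'" "is_tree a T" "is_tree a T'"
    "list_all2 is_tree as B" "list_all2 is_tree as B'"
    by (auto simp: list_all2_Cons1)
  interpret finite_group "HL (a # as @ ls)" by (rule finite_group_HL)
  \<comment> \<open>On the carrier every element is a nonempty list; peeling off its first entry
    gives the shape required by \<open>char_ip_DirProd_list_Cons\<close>.\<close>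
  have e: "forest_char (a # as) (T # B) (take (length (a # as)) zs) * g (drop (length (a # as)) zs) =
      tree_char a T (hd zs) * (forest_char as B (take (length as) (tl zs)) * g (drop (length as) (tl zs)))"
    if "zs \<in> carrier (HL (a # as @ ls))" for zs T B and g :: "helem list \<Rightarrow> complex"
    using that by (auto elim: DirProd_list_Cons_cases)
  have "char_ip (HL (a # as @ ls)) (\<lambda>zs. forest_char (a # as) A (take (length (a # as)) zs) * g (drop (length (a # as)) zs))
      (\<lambda>zs. forest_char (a # as) A' (take (length (a # as)) zs) * g' (drop (length (a # as)) zs)) =
    char_ip (HL (a # as @ ls))
      (\<lambda>zs. tree_char a T (hd zs) * (\<lambda>ys. forest_char as B (take (length as) ys) * g (drop (length as) ys)) (tl zs))
      (\<lambda>zs. tree_char a T' (hd zs) * (\<lambda>ys. forest_char as B' (take (length as) ys) * g' (drop (length as) ys)) (tl zs))"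
    unfolding A by (rule char_ip_cong) (simp_all only: e)
  also have "\<dots> = char_ip (H a) (tree_char a T) (tree_char a T') *
      ((if B = B' then 1 else 0) * char_ip (HL ls) g g')"
    unfolding list.map Cons.IH[OF A(5,6), symmetric]
    by (rule char_ip_DirProd_list_Cons) (auto simp: finite_group_H)
  finally show ?case using char_ip_tree_char[OF A(3,4)] A by simp
qed simp

lemma char_ip_forest_char_self:
  assumes "list_all2 is_tree ks F"
  shows "char_ip (HL ks) (forest_char ks F) (forest_char ks F) = 1"
proof -
  interpret finite_group "HL ks" by (rule finite_group_HL)
  \<comment> \<open>The whole list serves as prefix and the remainder is the trivial group;
    \<open>take\<close> then disappears because elements of the carrier have length
    \<open>length ks\<close>.\<close>
  have "char_ip (HL []) (\<lambda>_. 1) (\<lambda>_. 1) = 1"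
    by (simp add: char_ip_def DirProd_list_Nil)
  then have "char_ip (HL ks) (\<lambda>zs. forest_char ks F (take (length ks) zs)) (\<lambda>zs. forest_char ks F (take (length ks) zs)) = 1"
    using char_ip_forest_char[OF assms assms, of "[]" "\<lambda>_. 1" "\<lambda>_. 1"] by simp
  moreover have "char_ip (HL ks) (forest_char ks F) (forest_char ks F) =
      char_ip (HL ks) (\<lambda>zs. forest_char ks F (take (length ks) zs)) (\<lambda>zs. forest_char ks F (take (length ks) zs))"
    by (rule char_ip_cong) (use DirProd_list_carrier_mem(1) in force)+
  ultimately show ?thesis by (rule trans[rotated])
qed

lemma tensor_list_rep:
  "list_all2 (\<lambda>k \<phi>. representation (H k) \<phi>) ks \<phi>s \<Longrightarrow> \<exists>d. rep_on (HL ks) d (tensor_list \<phi>s)"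
proof (induction rule: list_all2_induct)
  case Nil
  show ?case
    by (intro exI[of _ 1]) (auto simp: rep_on_def tensor_list_def DirProd_list_Nil)
next
  case (Cons k ks \<phi> \<phi>s)
  then obtain d where d: "rep_on (HL ks) d (tensor_list \<phi>s)" by blast
  let ?e = "rep_dim (H k) \<phi>"
  have \<phi>: "rep_on (H k) ?e \<phi>" using Cons by (simp add: representation_iff[OF group_H])
  have t: "tensor_list (\<phi> # \<phi>s) (x # xs) = kron (\<phi> x) (tensor_list \<phi>s xs)" for x xs
    by (simp add: tensor_list_def)
  have "rep_on (HL (k # ks)) (?e * d) (tensor_list (\<phi> # \<phi>s))"
    unfolding rep_on_def
  proof (intro conjI ballI)
    fix zs assume "zs \<in> carrier (HL (k # ks))"
    then show "tensor_list (\<phi> # \<phi>s) zs \<in> carrier_mat (?e * d) (?e * d)"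
      using \<phi> d unfolding list.map by (elim DirProd_list_Cons_cases) (auto simp: t rep_on_def intro: kron_carrier)
  next
    show "tensor_list (\<phi> # \<phi>s) \<one>\<^bsub>HL (k # ks)\<^esub> = 1\<^sub>m (?e * d)"
      using \<phi> d by (simp add: DirProd_list_Cons_one t rep_on_def kron_one)
  next
    fix zs ws assume "zs \<in> carrier (HL (k # ks))" "ws \<in> carrier (HL (k # ks))"
    then obtain x xs y ys where z: "zs = x # xs" "ws = y # ys" "x \<in> h_carrier k" "y \<in> h_carrier k"
      "xs \<in> carrier (HL ks)" "ys \<in> carrier (HL ks)"
      unfolding list.map by (elim DirProd_list_Cons_cases) auto
    have "kron (\<phi> x) (tensor_list \<phi>s xs) * kron (\<phi> y) (tensor_list \<phi>s ys) =
        kron (\<phi> x * \<phi> y) (tensor_list \<phi>s xs * tensor_list \<phi>s ys)"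
      by (rule kron_mult[of _ ?e ?e _ d d _ ?e _ d]) (use \<phi> d z in \<open>auto simp: rep_on_def\<close>)
    then show "tensor_list (\<phi> # \<phi>s) (zs \<otimes>\<^bsub>HL (k # ks)\<^esub> ws) = tensor_list (\<phi> # \<phi>s) zs * tensor_list (\<phi> # \<phi>s) ws"
      using z \<phi> d by (simp add: DirProd_list_Cons_mult t rep_on_def)
  qed
  then show ?case by blast
qed

lemma char_tensor_list:
  assumes "length \<phi>s = length ks" "length F = length ks" "\<forall>i<length ks. theta (ks ! i) (\<phi>s ! i) (F ! i)"
    and "xs \<in> carrier (HL ks)"
  shows "char_of (tensor_list \<phi>s) xs = forest_char ks F xs"
  using assms
proof (induction ks arbitrary: \<phi>s F xs)
  case Nil
  then show ?case by (simp add: char_of_def tensor_list_def trace_one)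
next
  case (Cons k ks)
  obtain \<phi> \<phi>s' T F' where e: "\<phi>s = \<phi> # \<phi>s'" "F = T # F'"
    using Cons.prems by (metis length_Suc_conv)
  obtain x xs' where x: "xs = x # xs'" "x \<in> h_carrier k" "xs' \<in> carrier (HL ks)"
    using Cons.prems unfolding list.map by (elim DirProd_list_Cons_cases) auto
  have th: "theta k \<phi> T" using Cons.prems(3) e by force
  have ths: "\<forall>i<length ks. theta (ks ! i) (\<phi>s' ! i) (F' ! i)" using Cons.prems(3) e by force
  have len: "length \<phi>s' = length ks" "length F' = length ks" using Cons.prems e by auto
  have "list_all2 (\<lambda>k \<phi>. representation (H k) \<phi>) ks \<phi>s'"
    using ths len theta_irrep by (force simp: list_all2_conv_all_nth irrep_def)
  then obtain d where d: "rep_on (HL ks) d (tensor_list \<phi>s')" using tensor_list_rep by blast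
  have c: "\<phi> x \<in> carrier_mat (rep_dim (H k) \<phi>) (rep_dim (H k) \<phi>)" "tensor_list \<phi>s' xs' \<in> carrier_mat d d"
    using theta_rep_on[OF th] d x by (auto simp: rep_on_def)
  have "char_of (tensor_list \<phi>s) xs = char_of \<phi> x * char_of (tensor_list \<phi>s') xs'"
    using trace_kron[OF c] x e by (simp add: char_of_def tensor_list_def)
  then show ?case using theta_char[OF th x(2)] Cons.IH[OF len ths x(3)] x e by simp
qed

lemma char_theta_forest:
  assumes "theta_forest n \<Gamma> F" "xs \<in> carrier (P n)"
  shows "char_of \<Gamma> xs = forest_char (bin_list n) F xs"
proof -
  interpret finite_group "P n" unfolding P_def by (rule finite_group_HL)
  show ?thesis
    using assms char_tensor_list char_iso_rep unfolding theta_forest_def P_def by metis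
qed

text \<open>Gives meaning to the \<open>SOME\<close> in \<open>theta_inv\<close>. An outer tensor
  product of irreducibles is irreducible because its norm is a product of norms 1.\<close>

lemma theta_forest_exists:
  assumes "is_forest n F"
  shows "\<exists>\<Gamma>. theta_forest n \<Gamma> F"
proof -
  let ?ks = "bin_list n"
  interpret finite_group "P n" unfolding P_def by (rule finite_group_HL)
  have F: "list_all2 is_tree ?ks F" using assms by (simp add: is_forest_def)
  define \<phi>s where "\<phi>s = map2 tree_rep ?ks F"
  have len: "length F = length ?ks" "length \<phi>s = length ?ks" using list_all2_lengthD[OF F] by (auto simp: \<phi>s_def)
  have th: "\<forall>i<length ?ks. theta (?ks ! i) (\<phi>s ! i) (F ! i)"
    using len list_all2_nthD[OF F] theta_tree_rep by (auto simp: \<phi>s_def)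
  have "list_all2 (\<lambda>k \<phi>. representation (H k) \<phi>) ?ks \<phi>s"
    using th len theta_irrep by (force simp: list_all2_conv_all_nth irrep_def)
  then have rep: "representation (P n) (tensor_list \<phi>s)"
    using tensor_list_rep rep_onI_group(1) unfolding P_def by blast
  have "char_ip (P n) (char_of (tensor_list \<phi>s)) (char_of (tensor_list \<phi>s)) =
      char_ip (P n) (forest_char ?ks F) (forest_char ?ks F)"
    by (rule char_ip_cong) (use char_tensor_list[OF len(2,1) th] in \<open>auto simp: P_def\<close>)
  then have "irrep (P n) (tensor_list \<phi>s)"
    using irrep_if_char_ip_1[OF rep] char_ip_forest_char_self[OF F] by (simp add: P_def)
  then show ?thesis
    using len th iso_rep_refl[OF rep] unfolding theta_forest_def by blast
qed

lemma theta_inv: "is_forest n F \<Longrightarrow> theta_forest n (theta_inv n F) F"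
  unfolding theta_inv_def using theta_forest_exists by (rule someI_ex)

section \<open>Restriction along the inclusions\<close>

lemma incl_H_hom: "incl_H k \<in> hom (HL (rev [0..<k])) (H k)"
proof (induction k)
  case 0
  then show ?case by (auto simp: hom_def DirProd_list_Nil)
next
  case (Suc k)
  have IH: "incl_H k xs \<in> h_carrier k" "incl_H k (xs \<otimes>\<^bsub>HL (rev [0..<k])\<^esub> ys) = h_mult (incl_H k xs) (incl_H k ys)"
    if "xs \<in> carrier (HL (rev [0..<k]))" "ys \<in> carrier (HL (rev [0..<k]))" for xs ys
    using Suc that by (auto simp: hom_def)
  \<comment> \<open>The factors for 2^{k+1} - 1 are H_k followed by those for 2^k - 1, matching the
    \<open>hd\<close> and \<open>tl\<close> in the recursion of \<open>incl_H\<close>.\<close>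
  have e: "map H (rev [0..<Suc k]) = H k # map H (rev [0..<k])" by simp
  show ?case
    unfolding hom_def e
  proof (intro CollectI conjI Pi_I ballI)
    fix zs assume "zs \<in> carrier (DirProd_list (H k # map H (rev [0..<k])))"
    then show "incl_H (Suc k) zs \<in> carrier (H (Suc k))"
      by (elim DirProd_list_Cons_cases) (use IH in auto)
  next
    fix zs ws assume "zs \<in> carrier (DirProd_list (H k # map H (rev [0..<k])))"
      "ws \<in> carrier (DirProd_list (H k # map H (rev [0..<k])))"
    then show "incl_H (Suc k) (zs \<otimes>\<^bsub>DirProd_list (H k # map H (rev [0..<k]))\<^esub> ws) =
        incl_H (Suc k) zs \<otimes>\<^bsub>H (Suc k)\<^esub> incl_H (Suc k) ws"
      by (elim DirProd_list_Cons_cases) (use IH in \<open>auto simp: DirProd_list_Cons_mult\<close>)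
  qed
qed

text \<open>Stated for an arbitrary homomorphism on the tail, so that the induction can run over the
  untouched prefix.\<close>

lemma hom_last_factor:
  assumes f: "f \<in> hom (HL ls) (H k)"
  shows "(\<lambda>zs. take (length as) zs @ [f (drop (length as) zs)]) \<in> hom (HL (as @ ls)) (HL (as @ [k]))"
proof (induction as)
  case Nil
  have "[x] \<otimes>\<^bsub>DirProd_list [H k]\<^esub> [y] = [h_mult x y]" if "x \<in> h_carrier k" "y \<in> h_carrier k" for x y
    using DirProd_list_Cons_mult[of x "H k" y "[]" "[]" "[]"] that by (simp add: DirProd_list_Nil)
  then show ?case
    using f by (fastforce simp: hom_def DirProd_list_Cons_mem DirProd_list_Nil)
next
  case (Cons a as)
  let ?g = "\<lambda>zs. take (length as) zs @ [f (drop (length as) zs)]"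
  have IH: "?g xs \<in> carrier (HL (as @ [k]))" "?g (xs \<otimes>\<^bsub>HL (as @ ls)\<^esub> ys) = ?g xs \<otimes>\<^bsub>HL (as @ [k])\<^esub> ?g ys"
    if "xs \<in> carrier (HL (as @ ls))" "ys \<in> carrier (HL (as @ ls))" for xs ys
    using Cons that unfolding hom_def by blast+
  show ?case
    unfolding hom_def append_Cons list.map
  proof (intro CollectI conjI Pi_I ballI)
    fix zs assume "zs \<in> carrier (DirProd_list (H a # map H (as @ ls)))"
    then show "take (length (a # as)) zs @ [f (drop (length (a # as)) zs)] \<in> carrier (DirProd_list (H a # map H (as @ [k])))"
      by (elim DirProd_list_Cons_cases) (use IH(1) in \<open>simp add: DirProd_list_Cons_mem\<close>)
  next
    fix zs ws assume "zs \<in> carrier (DirProd_list (H a # map H (as @ ls)))" "ws \<in> carrier (DirProd_list (H a # map H (as @ ls)))"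
    then obtain x xs y ys where z: "zs = x # xs" "ws = y # ys" "x \<in> carrier (H a)" "y \<in> carrier (H a)"
      "xs \<in> carrier (HL (as @ ls))" "ys \<in> carrier (HL (as @ ls))"
      by (elim DirProd_list_Cons_cases) auto
    show "take (length (a # as)) (zs \<otimes>\<^bsub>DirProd_list (H a # map H (as @ ls))\<^esub> ws) @
        [f (drop (length (a # as)) (zs \<otimes>\<^bsub>DirProd_list (H a # map H (as @ ls))\<^esub> ws))] =
        (take (length (a # as)) zs @ [f (drop (length (a # as)) zs)]) \<otimes>\<^bsub>DirProd_list (H a # map H (as @ [k]))\<^esub>
        (take (length (a # as)) ws @ [f (drop (length (a # as)) ws)])"
      using DirProd_list_Cons_mult[OF z(3,4) IH(1)[OF z(5,5)] IH(1)[OF z(6,6)]] IH(2)[OF z(5,6)]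
        DirProd_list_Cons_mult[OF z(3-6)] z(1,2)
      by simp
  qed
qed

lemma incl_P_eq:
  "bin_list n = as @ [k] \<Longrightarrow> incl_P n zs = take (length as) zs @ [incl_H k (drop (length as) zs)]"
  by (simp add: incl_P_def Let_def)

text \<open>The prefix \<open>as\<close> may be empty. Then n = 2^k, and the same formula describes
  the down-set of the last tree alone; comparing the two instances yields the theorem on down-sets
  with the inner product on the right left unevaluated.\<close>

lemma multiplicity_down:
  assumes n: "bin_list n = as @ [k]" and A: "list_all2 is_tree as A" and T: "is_tree k T"
    and A': "list_all2 is_tree as A'" and B: "list_all2 is_tree (rev [0..<k]) B"
  shows "of_nat (multiplicity_rep (P (n - 1)) (theta_inv (n - 1) (A' @ B)) (theta_inv n (A @ [T]) \<circ> incl_P n)) =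
    (if A' = A then 1 else 0) *
      char_ip (HL (rev [0..<k])) (forest_char (rev [0..<k]) B) (\<lambda>ys. tree_char k T (incl_H k ys))"
proof -
  let ?ls = "rev [0..<k]"
  note n' = bin_list_pred[OF n]
  interpret D: finite_group "P (n - 1)" unfolding P_def by (rule finite_group_HL)
  interpret U: finite_group "P n" unfolding P_def by (rule finite_group_HL)
  have la: "length A = length as" "length A' = length as" "length B = length ?ls"
    using A A' B by (auto dest: list_all2_lengthD)
  have down: "theta_forest (n - 1) (theta_inv (n - 1) (A' @ B)) (A' @ B)"
    by (rule theta_inv) (use A' B n' in \<open>auto simp: is_forest_def list_all2_appendI\<close>)
  have up: "theta_forest n (theta_inv n (A @ [T])) (A @ [T])"
    by (rule theta_inv) (use A T n in \<open>auto simp: is_forest_def list_all2_appendI\<close>)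
  \<comment> \<open>This makes the restriction a representation, so that
    \<open>multiplicity_rep_eq_char_ip\<close> can be applied to it.\<close>
  have hom: "incl_P n \<in> hom (P (n - 1)) (P n)"
    using hom_last_factor[OF incl_H_hom, of as k] unfolding P_def n n' incl_P_eq[OF n] .
  interpret h: group_hom "P (n - 1)" "P n" "incl_P n"
    unfolding group_hom_def group_hom_axioms_def using hom D.is_group U.is_group by blast
  let ?\<Gamma> = "theta_inv n (A @ [T])" and ?\<gamma> = "theta_inv (n - 1) (A' @ B)"
  have "representation (P n) ?\<Gamma>" using up by (simp add: theta_forest_def irrep_def)
  from U.rep_on[OF this] have "rep_on (P (n - 1)) (rep_dim (P n) ?\<Gamma>) (?\<Gamma> \<circ> incl_P n)"
    using h.hom_closed h.hom_mult h.hom_one by (simp add: rep_on_def)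
  then have rep: "representation (P (n - 1)) (?\<Gamma> \<circ> incl_P n)" by (rule D.rep_onI_group)
  have irr: "irrep (P (n - 1)) ?\<gamma>" using down by (simp add: theta_forest_def)
  have len: "length zs = length as + length ?ls" if "zs \<in> carrier (P (n - 1))" for zs
    using DirProd_list_carrier_mem(1)[of zs] that unfolding P_def n' by fastforce
  have "of_nat (multiplicity_rep (P (n - 1)) ?\<gamma> (?\<Gamma> \<circ> incl_P n)) =
      char_ip (P (n - 1)) (char_of ?\<gamma>) (char_of (?\<Gamma> \<circ> incl_P n))"
    by (rule D.multiplicity_rep_eq_char_ip[OF irr rep])
  \<comment> \<open>Both characters split at position \<open>length as\<close>: the inclusion fixes
    the prefix and changes only what follows it.\<close>
  also have "\<dots> = char_ip (P (n - 1))
      (\<lambda>zs. forest_char as A' (take (length as) zs) * forest_char ?ls B (drop (length as) zs))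
      (\<lambda>zs. forest_char as A (take (length as) zs) * (\<lambda>ys. tree_char k T (incl_H k ys)) (drop (length as) zs))"
  proof (rule D.char_ip_cong)
    fix zs assume z: "zs \<in> carrier (P (n - 1))"
    show "char_of ?\<gamma> zs = forest_char as A' (take (length as) zs) * forest_char ?ls B (drop (length as) zs)"
      using char_theta_forest[OF down z, unfolded n'] forest_char_append[of A' as zs ?ls B] la len[OF z] by simp
    have "char_of (?\<Gamma> \<circ> incl_P n) zs = char_of ?\<Gamma> (incl_P n zs)" by (simp add: char_of_def)
    also have "\<dots> = forest_char (as @ [k]) (A @ [T]) (incl_P n zs)"
      using char_theta_forest[OF up h.hom_closed[OF z]] by (simp add: n)
    also have "\<dots> = forest_char as A (take (length as) zs) * tree_char k T (incl_H k (drop (length as) zs))"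
      using forest_char_append[of A as "incl_P n zs" "[k]" "[T]"] la len[OF z] by (simp add: incl_P_eq[OF n])
    finally show "char_of (?\<Gamma> \<circ> incl_P n) zs = \<dots>" .
  qed
  also have "\<dots> = (if A' = A then 1 else 0) *
      char_ip (HL ?ls) (forest_char ?ls B) (\<lambda>ys. tree_char k T (incl_H k ys))"
    unfolding P_def n' by (rule char_ip_forest_char[OF A' A])
  finally show ?thesis .
qed

section \<open>Down-sets and up-sets\<close>

lemma count_sum_replicate_mset:
  "finite S \<Longrightarrow> count (\<Sum>x\<in>S. replicate_mset (f x) x) y = (if y \<in> S then f y else 0)"
  by (simp add: count_sum if_distrib cong: if_cong)

lemma count_down_set:
  "count (down_set n F) F' = (if is_forest (n - 1) F' then
    multiplicity_rep (P (n - 1)) (theta_inv (n - 1) F') (theta_inv n F \<circ> incl_P n) else 0)"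
  unfolding down_set_def by (simp add: count_sum_replicate_mset[OF finite_forests])

lemma count_up_set:
  "count (up_set n F) F' = (if is_forest (n + 1) F' then count (down_set (n + 1) F') F else 0)"
  unfolding up_set_def using count_sum_replicate_mset[OF finite_forests] by simp

lemma count_prepend: "count (prepend A M) (A @ B) = count M B"
  unfolding prepend_def by (induction M) auto

lemma count_prepend_not_prefix: "\<not> (\<exists>B. X = A @ B) \<Longrightarrow> count (prepend A M) X = 0"
  unfolding prepend_def by (auto simp: count_eq_zero_iff)

text \<open>Multisets are compared count by count. An element with prefix A gets the same
  multiplicity from both instances of \<open>multiplicity_down\<close>; a forest without this prefix
  starts with some A' \<noteq> A and is killed by orthogonality.\<close>

lemma down_set_eq_prepend:
  assumes F: "is_forest n F" and n: "bin_list n = as @ [k]"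
  shows "down_set n F = prepend (butlast F) (down_set (2 ^ k) [last F])"
proof (rule multiset_eqI)
  fix X
  obtain A T where A: "F = A @ [T]" "list_all2 is_tree as A" "is_tree k T"
    using F n by (auto simp: is_forest_def list_all2_append1 list_all2_Cons1)
  let ?ls = "rev [0..<k]"
  \<comment> \<open>The empty prefix is written out to match the hypothesis of
    \<open>multiplicity_down\<close>.\<close>
  have nk: "bin_list (2 ^ k) = [] @ [k]" by (simp add: bin_list_power)
  have split: "is_forest (n - 1) (A' @ B) \<longleftrightarrow> list_all2 is_tree as A' \<and> list_all2 is_tree ?ls B"
    if "length A' = length as" for A' B
    unfolding is_forest_def bin_list_pred[OF n] using that by (simp add: list_all2_append)
  have base: "is_forest (2 ^ k - 1) B \<longleftrightarrow> list_all2 is_tree ?ls B" for B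
    unfolding is_forest_def bin_list_pred_power ..
  have len: "length A = length as" using A(2) by (auto dest: list_all2_lengthD)
  show "count (down_set n F) X = count (prepend (butlast F) (down_set (2 ^ k) [last F])) X"
  proof (cases "\<exists>B. X = A @ B")
    case True
    then obtain B where X: "X = A @ B" by blast
    show ?thesis
    proof (cases "list_all2 is_tree ?ls B")
      case B: True
      \<comment> \<open>The multiplicities are natural numbers but are compared as complex numbers,
        where the inner products live; the embedding is injective.\<close>
      have "of_nat (multiplicity_rep (P (n - 1)) (theta_inv (n - 1) X) (theta_inv n F \<circ> incl_P n)) =
          (of_nat (multiplicity_rep (P (2 ^ k - 1)) (theta_inv (2 ^ k - 1) B)
            (theta_inv (2 ^ k) [T] \<circ> incl_P (2 ^ k))) :: complex)"
        using multiplicity_down[OF n A(2,3) A(2) B] multiplicity_down[OF nk _ A(3) _ B, of "[]" "[]"] X A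
        by (simp del: One_nat_def)
      then show ?thesis
        using split[OF len] base A(2) B X A(1) by (simp add: count_down_set count_prepend del: One_nat_def)
    next
      case False
      then show ?thesis
        using split[OF len] base X A(1) by (simp add: count_down_set count_prepend del: One_nat_def)
    qed
  next
    case False
    have "count (down_set n F) X = 0"
    proof (cases "is_forest (n - 1) X")
      case True
      then obtain A' B where X: "X = A' @ B" "list_all2 is_tree as A'" "list_all2 is_tree ?ls B"
        unfolding is_forest_def bin_list_pred[OF n] by (auto simp: list_all2_append1)
      then have "A' \<noteq> A" using False by blast
      then have "(of_nat (multiplicity_rep (P (n - 1)) (theta_inv (n - 1) X) (theta_inv n F \<circ> incl_P n)) :: complex) = 0"
        using multiplicity_down[OF n A(2,3) X(2,3)] X(1) A(1) by (simp del: One_nat_def)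
      then show ?thesis by (simp add: count_down_set del: One_nat_def)
    qed (simp add: count_down_set del: One_nat_def)
    then show ?thesis using count_prepend_not_prefix[OF False] A(1) by simp
  qed
qed

text \<open>A node of positive height has at least one child, so the height can be read off along
  any branch. Hence, for a fixed d, no tree passes the filters of both \<open>trees_above\<close>
  and \<open>trees_below\<close>.\<close>

lemma is_tree_unique: "is_tree k T \<Longrightarrow> is_tree j T \<Longrightarrow> j = k"
proof (induction arbitrary: j rule: is_tree.induct)
  case 1
  then show ?case by (auto elim: is_tree.cases)
next
  case (2 S k)
  then obtain T where T: "T \<in># S" by (cases S) auto
  from 2(3) obtain i where "j = Suc i" "\<forall>T\<in>#S. is_tree i T"
    using T by (auto elim: is_tree.cases)
  then show ?case using 2(2) T by auto
qed

text \<open>The carry is a borrow read backwards: removing 1 from the last exponent k of n + 1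
  leaves k - 1, ..., 0 in its place. Every exponent below k then occurs in n and k itself does not,
  so k is d.\<close>

lemma carry_bin_list:
  assumes d: "d = (LEAST d. d \<notin> Bin n)"
  obtains hi where "bin_list n = hi @ rev [0..<d]" "bin_list (n + 1) = hi @ [d]" "\<forall>k\<in>set hi. d < k"
proof -
  have "bin_list (n + 1) \<noteq> []" using bin_list_sum[of "n + 1"] by auto
  then obtain hi k where hi: "bin_list (n + 1) = hi @ [k]" using rev_exhaust by blast
  then have n: "bin_list n = hi @ rev [0..<k]" using bin_list_pred[of "n + 1"] by simp
  have gt: "\<forall>j\<in>set hi. k < j" using bin_list_sorted[of "n + 1"] hi by (auto simp: sorted_wrt_append)
  have "Bin n = set hi \<union> {..<k}" using set_bin_list[of n] n by auto
  then have "k = (LEAST d. d \<notin> Bin n)"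
    using gt by (intro Least_equality[symmetric]) (auto simp: not_less[symmetric])
  then show thesis using that[of hi] hi n gt d by blast
qed

lemma trees_above_below:
  assumes "list_all2 is_tree hi A" "\<forall>k\<in>set hi. d < k" "list_all2 is_tree (rev [0..<d]) B"
  shows "trees_above d (A @ B) = A" "trees_below d (A @ B) = B"
proof -
  have height: "\<exists>k\<in>set ks. is_tree k T" if "list_all2 is_tree ks F" "T \<in> set F" for ks F T
    using that by (induction rule: list_all2_induct) auto
  have A: "\<exists>k>d. is_tree k T" "\<not> (\<exists>k<d. is_tree k T)" if T: "T \<in> set A" for T
  proof -
    obtain j where j: "d < j" "is_tree j T" using height[OF assms(1) T] assms(2) by blast
    then show "\<exists>k>d. is_tree k T" by blast
    show "\<not> (\<exists>k<d. is_tree k T)" using is_tree_unique[OF j(2)] j(1) by fastforce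
  qed
  have B: "\<exists>k<d. is_tree k T" "\<not> (\<exists>k>d. is_tree k T)" if T: "T \<in> set B" for T
  proof -
    obtain j where j: "j < d" "is_tree j T" using height[OF assms(3) T] by auto
    then show "\<exists>k<d. is_tree k T" by blast
    show "\<not> (\<exists>k>d. is_tree k T)" using is_tree_unique[OF j(2)] j(1) by fastforce
  qed
  show "trees_above d (A @ B) = A" "trees_below d (A @ B) = B"
    unfolding trees_above_def trees_below_def using A B by (simp_all add: filter_id_conv filter_empty_conv)
qed

text \<open>The count of X in an up-set is a count in the down-set of X. A forest X of size n + 1 is
  some A' followed by one tree T of height d, and the result on down-sets reduces the count of A @ B
  there to the condition A' = A and the count of B in the down-set of T.\<close>

lemma up_set_eq_prepend:
  assumes n: "bin_list n = hi @ rev [0..<d]" and n1: "bin_list (n + 1) = hi @ [d]"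
    and A: "list_all2 is_tree hi A" and B: "list_all2 is_tree (rev [0..<d]) B"
  shows "up_set n (A @ B) = prepend A (up_set (2 ^ d - 1) B)"
proof (rule multiset_eqI)
  fix X
  \<comment> \<open>Subtraction here is on natural numbers; it is exact because 2^d is at least 1,
    so the up-set of B consists of forests of size 2^d.\<close>
  have pow: "2 ^ d - 1 + 1 = (2 ^ d :: nat)" by simp
  have lA: "length A = length hi" using A by (auto dest: list_all2_lengthD)
  show "count (up_set n (A @ B)) X = count (prepend A (up_set (2 ^ d - 1) B)) X"
  proof (cases "is_forest (n + 1) X")
    case True
    then obtain A' T where X: "X = A' @ [T]" "list_all2 is_tree hi A'" "is_tree d T"
      using n1 by (auto simp: is_forest_def list_all2_append1 list_all2_Cons1)
    have lA': "length A' = length hi" using X by (auto dest: list_all2_lengthD)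
    have T: "is_forest (2 ^ d) [T]" using X by (simp add: is_forest_def bin_list_power)
    have "count (up_set n (A @ B)) X = count (prepend A' (down_set (2 ^ d) [T])) (A @ B)"
      using True down_set_eq_prepend[OF True n1] X by (simp add: count_up_set)
    also have "\<dots> = count (prepend A (up_set (2 ^ d - 1) B)) X"
    proof (cases "A' = A")
      case True
      then show ?thesis using T X pow by (simp add: count_prepend count_up_set)
    next
      case False
      \<comment> \<open>A' and A have the same length but differ, so neither forest has the other's
        prefix and both counts are 0.\<close>
      then show ?thesis
        using X lA lA' by (simp add: count_prepend_not_prefix)
    qed
    finally show ?thesis .
  next
    case False
    \<comment> \<open>A followed by a forest of size 2^d would be a forest of size n + 1, so such an
      X has count 0 on the right as well.\<close>
    have "count (up_set (2 ^ d - 1) B) Y = 0" if "X = A @ Y" for Y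
    proof -
      have "\<not> is_forest (2 ^ d) Y"
        using False that A n1 by (auto simp: is_forest_def bin_list_power list_all2_appendI)
      then show ?thesis using pow by (simp add: count_up_set)
    qed
    then have "count (prepend A (up_set (2 ^ d - 1) B)) X = 0"
      by (cases "\<exists>Y. X = A @ Y") (auto simp: count_prepend count_prepend_not_prefix)
    then show ?thesis using False by (simp add: count_up_set)
  qed
qed

theorem theorem3p4:
  fixes n :: nat and ks :: "nat list" and F :: "tree list"
  assumes "n \<ge> 1"
    and "n = (\<Sum>k\<leftarrow>ks. 2 ^ k)"
    and "sorted_wrt (>) ks"
    and "is_forest n F"
  shows "down_set n F = prepend (butlast F) (down_set (2 ^ last ks) [last F]) \<and>
    (let d = (LEAST d. d \<notin> Bin n) in
       F = trees_above d F @ trees_below d F \<and>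
       is_forest (2 ^ d - 1) (trees_below d F) \<and>
       up_set n F = prepend (trees_above d F) (up_set (2 ^ d - 1) (trees_below d F)))"
proof (intro conjI)
  \<comment> \<open>By uniqueness of binary expansions, the given exponents are the list read off
    from the bits of n.\<close>
  have ks: "bin_list n = ks" using bin_list_sum_powers assms by simp
  have "ks \<noteq> []" using assms by auto
  then have "bin_list n = butlast ks @ [last ks]" using ks by simp
  then show "down_set n F = prepend (butlast F) (down_set (2 ^ last ks) [last F])"
    by (rule down_set_eq_prepend[OF assms(4)])
next
  define d where "d = (LEAST d. d \<notin> Bin n)"
  obtain hi where hi: "bin_list n = hi @ rev [0..<d]" "bin_list (n + 1) = hi @ [d]" "\<forall>k\<in>set hi. d < k"
    by (rule carry_bin_list[OF d_def])
  \<comment> \<open>The split of F at the position of the carry; \<open>trees_above_below\<close>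
    identifies it with the split by height in the statement.\<close>
  obtain A B where F: "F = A @ B" "list_all2 is_tree hi A" "list_all2 is_tree (rev [0..<d]) B"
    using assms(4) hi(1) by (auto simp: is_forest_def list_all2_append1)
  note tr = trees_above_below[OF F(2) hi(3) F(3)]
  show "let d = (LEAST d. d \<notin> Bin n) in
       F = trees_above d F @ trees_below d F \<and>
       is_forest (2 ^ d - 1) (trees_below d F) \<and>
       up_set n F = prepend (trees_above d F) (up_set (2 ^ d - 1) (trees_below d F))"
    unfolding Let_def d_def[symmetric] F(1) tr is_forest_def bin_list_pred_power
    using up_set_eq_prepend[OF hi(1,2) F(2,3)] F(3) by (intro conjI refl)
qed

end
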